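(* For positive integers $a_1 < a_2$, let $a_n = a_{n-1} + a_{n-2}$ for all $n \geq 3$, and let $F_{(a_1,a_2)} = \{a_1,a_2,a_3,\ldots\} \subset \mathbb{N}$. Then the following statements hold. (i) If $a_1 = 1$ and $a_2 \geq 3$, then $$\left[0, \dim_H(J_{F_{(a_1,a_2)}})\right] = DS(F_{(a_1,a_2)}).$$ (ii) There exists $s$ with $0 < s < \dim_H(J_{F_{(1,2)}})$ such that $[0,s] \subset DS(F_{(1,2)})$. (iii) There exist $a, b$ with $0 < a < b < \dim_H(J_{F_{(1,2)}})$ such that $(a,b) \cap DS(F_{(1,2)}) = \varnothing$.
   Context: $\mathbb{N}$ denotes the set of positive integers. For positive integers $b_1, b_2, \ldots$, let $[b_1,b_2,\ldots] := \cfrac{1}{b_1+\cfrac{1}{b_2+\cfrac{1}{b_3+\cdots}}}$ denote the infinite continued fraction (an irrational number in $[0,1]$). For $\Lambda \subseteq \mathbb{N}$, define $J_\Lambda := \{x = [b_1,b_2,\ldots] : b_i \in \Lambda \text{ for all } i\} \subset [0,1]$. $\dim_H$ denotes Hausdorff dimension (with $\dim_H(\varnothing)=0$). For an infinite set $\Lambda \subseteq \mathbb{N}$, the dimension spectrum of $\Lambda$ is $DS(\Lambda) := \{\dim_H(J_A) : A \subseteq \Lambda\}$, where $A$ ranges over all (finite or infinite) subsets of $\Lambda$. In particular $F_{(1,2)} = \{1,2,3,5,8,13,\ldots\}$. *)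

theory Defs
  imports "HOL-Analysis.Analysis"
begin

section \<open>Hausdorff dimension\<close>

text \<open>
  The summand \<open>|U|\<^sup>s\<close> of the Hausdorff measure, with the conventions \<open>|{}|\<^sup>s = 0\<close> and
  \<open>|U|\<^sup>0 = 1\<close> for nonempty \<open>U\<close> (whereas \<^term>\<open>0 powr 0 = (0::real)\<close>), so that the
  zero-dimensional measure is counting measure.
\<close>

definition diam_weight :: "real \<Rightarrow> 'a::metric_space set \<Rightarrow> ennreal" where
  "diam_weight s U =
     (if U = {} then 0 else if s = 0 then 1 else ennreal (diameter U powr s))"

text \<open>
  Boundedness is required explicitly because \<^const>\<open>diameter\<close> is unspecified on unbounded sets.
  Finite covers are included, as some of the \<open>U i\<close> may be empty.
\<close>

definition delta_covers :: "real \<Rightarrow> 'a::metric_space set \<Rightarrow> (nat \<Rightarrow> 'a set) set" where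
  "delta_covers \<delta> A =
     {U. A \<subseteq> (\<Union>i. U i) \<and> (\<forall>i. bounded (U i) \<and> diameter (U i) \<le> \<delta>)}"

definition hausdorff_premeasure :: "real \<Rightarrow> real \<Rightarrow> 'a::metric_space set \<Rightarrow> ennreal" where
  "hausdorff_premeasure s \<delta> A = (INF U\<in>delta_covers \<delta> A. \<Sum>i. diam_weight s (U i))"

definition hausdorff_measure :: "real \<Rightarrow> 'a::metric_space set \<Rightarrow> ennreal" where
  "hausdorff_measure s A = (SUP \<delta>\<in>{0<..}. hausdorff_premeasure s \<delta> A)"

text \<open>
  Restricted to subsets of the line, where the \<open>s\<close>-dimensional measure vanishes for all
  \<open>s > 1\<close>; the infimum is therefore over a nonempty set and the dimension is a real number.
\<close>

definition hausdorff_dim :: "real set \<Rightarrow> real" where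
  "hausdorff_dim A = Inf {s. 0 \<le> s \<and> hausdorff_measure s A = 0}"

section \<open>Continued fractions with restricted digits\<close>

text \<open>
  The digit sequence \<open>b\<^sub>1, b\<^sub>2, \<dots>\<close> is indexed from \<open>0\<close>, and \<open>cfrac_convergent b n\<close> is the
  finite continued fraction \<open>[b\<^sub>1, \<dots>, b\<^sub>n]\<close>. The convergents converge whenever all digits
  are positive; only such sequences are of interest.
\<close>

fun cfrac_convergent :: "(nat \<Rightarrow> nat) \<Rightarrow> nat \<Rightarrow> real" where
  "cfrac_convergent b 0 = 0"
| "cfrac_convergent b (Suc n) = 1 / (real (b 0) + cfrac_convergent (\<lambda>i. b (Suc i)) n)"

definition cfrac :: "(nat \<Rightarrow> nat) \<Rightarrow> real" where
  "cfrac b = lim (cfrac_convergent b)"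

definition cfrac_set :: "nat set \<Rightarrow> real set" where
  "cfrac_set \<Lambda> = {cfrac b | b. \<forall>i. b i \<in> \<Lambda>}"

definition dim_spectrum :: "nat set \<Rightarrow> real set" where
  "dim_spectrum \<Lambda> = {hausdorff_dim (cfrac_set A) | A. A \<subseteq> \<Lambda>}"

section \<open>Generalised Fibonacci sequences\<close>

text \<open>Indexed from \<open>0\<close>: \<open>gen_fib a\<^sub>1 a\<^sub>2 n\<close> is \<open>a\<close> with index \<open>n + 1\<close>.\<close>

fun gen_fib :: "nat \<Rightarrow> nat \<Rightarrow> nat \<Rightarrow> nat" where
  "gen_fib a1 a2 0 = a1"
| "gen_fib a1 a2 (Suc 0) = a2"
| "gen_fib a1 a2 (Suc (Suc n)) = gen_fib a1 a2 (Suc n) + gen_fib a1 a2 n"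

definition gen_fib_set :: "nat \<Rightarrow> nat \<Rightarrow> nat set" where
  "gen_fib_set a1 a2 = range (gen_fib a1 a2)"

end

theory Submission
  imports Defs
begin

text \<open>
  Let \<open>q(w)\<close> be the denominator of the finite continued fraction with digit word \<open>w\<close>. The
  Hausdorff dimension of the set of continued fractions with digits in \<open>A\<close> is the critical exponent
  of the sums of \<open>q(w) powr (-2 * s)\<close> over the words of length \<open>n\<close>: for larger \<open>s\<close> one of these
  sums is below \<open>1\<close>, so that they decay geometrically. Cylinders give the upper bound. For the lower
  bound with a finite alphabet, a cover of small total weight can be replaced by a finite prefix set
  \<open>C\<close> of words with total weight below \<open>1\<close>; as \<open>q(uv) \<ge> q(u) q(v)\<close>, cutting words into pieces from
  \<open>C\<close> makes the sums decay.

  A target dimension \<open>t\<close> is attained by running through the digits \<open>e 0 < e 1 < \<dots>\<close> and accepting a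
  digit whenever the dimension stays at most \<open>t\<close>. This works as long as trading a rejected digit
  \<open>e n\<close> for all later ones does not lose dimension. Replacing \<open>e n\<close> by \<open>e (n + k)\<close> in a word
  multiplies \<open>q\<close> by at most \<open>e (n + k) / e n\<close>, so it suffices that the sum over \<open>k\<close> of
  \<open>(e n / e (n + k)) powr (2 * s)\<close> is at least \<open>1\<close>. For Fibonacci-like digits this holds up to \<open>s\<close>
  about \<open>0.72\<close>; the alphabets of the first claim have smaller dimension.

  The digits \<open>1, 2, 3, 5, 8, \<dots>\<close> have dimension about \<open>0.82\<close>. There the reverse comparison is
  strict: for large \<open>n\<close>, dropping \<open>e n\<close> while keeping all later digits gives a smaller dimension than
  the digits up to \<open>e n\<close> alone, and every set of digits either contains the latter or omits one of
  them.
\<close>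

section \<open>Sums over continuants\<close>

text \<open>Ratios of consecutive digits tend to the golden ratio \<phi>, so the swap condition
  becomes asymptotically that the sum over k \<ge> 1 of \<phi> powr (-2sk) is at least 1. It turns
  where \<phi> powr (2s) = 2, at s = log 2 / (2 log \<phi>), about 0.7202; what matters is on which
  side of this value a dimension lies. The digits 1, 3, 4, 7, 11, ... are the tight case: 5/7 has to
  be certified for them, and this takes tables of exact integer inequalities. For the gap the
  obstacle is strictness. Every occurrence of the dropped digit costs a factor z < 1, but words in
  which it is rare hardly pay. A renewal estimate shows that such words carry little weight at the
  critical exponent, and this turns the factor into a strict drop of dimension. Infinite alphabets
  are reached through their finite subsets: Koenig's lemma needs finite branching, and the
  separation of points by their digits needs bounded digits. Passing to a finite subset costs an
  arbitrarily small part of the exponent.\<close>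

text \<open>The arguments \<open>p, q\<close> are the last two denominators of the digits read so far. Thus
  \<open>cf_sum A (\<lambda>_. 1) s n 1 0\<close> is the sum of \<open>q(w) powr (-2 * s)\<close> over all words \<open>w\<close> of length \<open>n\<close>
  over \<open>A\<close>; for infinite \<open>A\<close> it is \<open>0\<close>, so only finite alphabets are used.\<close>

fun cf_sum :: "nat set \<Rightarrow> (nat \<Rightarrow> real) \<Rightarrow> real \<Rightarrow> nat \<Rightarrow> real \<Rightarrow> real \<Rightarrow> real" where
  "cf_sum A g s 0 p q = p powr (-2 * s)"
| "cf_sum A g s (Suc n) p q = (\<Sum>a\<in>A. g a * cf_sum A g s n (real a * p + q) p)"

abbreviation word_sum :: "nat set \<Rightarrow> real \<Rightarrow> nat \<Rightarrow> real \<Rightarrow> real \<Rightarrow> real" where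
  "word_sum A \<equiv> cf_sum A (\<lambda>_. 1)"

lemma digit_ge_1: "0 \<notin> A \<Longrightarrow> a \<in> A \<Longrightarrow> 1 \<le> real a"
  by (metis Suc_leI gr0I of_nat_1 of_nat_le_iff One_nat_def)

lemma next_state:
  assumes "0 \<notin> A" "a \<in> A" "0 < p" "0 \<le> q"
  shows "0 < real a * p + q" "p \<le> real a * p + q"
proof -
  have "1 * p \<le> real a * p"
    using digit_ge_1[OF assms(1,2)] assms(3) by (intro mult_right_mono) auto
  then show "p \<le> real a * p + q" using assms(4) by simp
  then show "0 < real a * p + q" using assms(3) by simp
qed

lemma cf_sum_nonneg:
  assumes "\<And>a. a \<in> A \<Longrightarrow> 0 \<le> g a"
  shows "0 \<le> cf_sum A g s n p q"
  using assms by (induction n arbitrary: p q) (auto intro!: sum_nonneg)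

text \<open>A denominator grown from the state \<open>(p, q)\<close> is
  \<open>\<alpha> * p + \<beta> * q\<close> with \<open>0 \<le> \<beta> \<le> \<alpha>\<close>, that
  is \<open>(\<alpha> - \<beta>) * p + \<beta> * (p + q)\<close>. So it is enough to compare
  \<open>p\<close> and \<open>p + q\<close>; \<open>q'\<close> alone may fall below
  \<open>r * q\<close>.\<close>

lemma cf_sum_dominate:
  assumes "0 \<notin> A" "\<And>a. a \<in> A \<Longrightarrow> 0 \<le> g a" "0 < r" "0 \<le> s"
    and "0 < p" "0 \<le> q" "r * p \<le> p'" "r * (p + q) \<le> p' + q'"
  shows "cf_sum A g s n p' q' \<le> r powr (-2 * s) * cf_sum A g s n p q"
  using assms(5-)
proof (induction n arbitrary: p q p' q')
  case 0
  have "p' powr (-2 * s) \<le> (r * p) powr (-2 * s)"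
    using 0 assms(3,4) by (intro powr_mono2') auto
  then show ?case using 0 assms(3) by (simp add: powr_mult)
next
  case (Suc n)
  have "cf_sum A g s n (real a * p' + q') p' \<le>
      r powr (-2 * s) * cf_sum A g s n (real a * p + q) p" if "a \<in> A" for a
  proof (rule Suc.IH)
    have a: "0 \<le> real a - 1" using digit_ge_1[OF assms(1) that] by simp
    have *: "(real a - 1) * (r * p) \<le> (real a - 1) * p'"
      using Suc.prems a by (intro mult_left_mono) auto
    show "0 < real a * p + q" using next_state[OF assms(1) that] Suc.prems by simp
    show "0 \<le> p" using Suc.prems by simp
    show "r * (real a * p + q) \<le> real a * p' + q'"
      using * Suc.prems(4) by (simp add: algebra_simps)
    show "r * (real a * p + q + p) \<le> real a * p' + q' + p'"
      using * Suc.prems(3,4) by (simp add: algebra_simps)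
  qed
  then show ?case
    using assms(2) by (auto simp: sum_distrib_left mult.left_commute intro!: sum_mono mult_left_mono)
qed

text \<open>The case \<open>r = p\<close> of \<open>cf_sum_dominate\<close>, started from the state
  \<open>(1, 0)\<close>, amounts to \<open>q(uv) \<ge> q(u) q(v)\<close>.\<close>

lemma cf_sum_submult:
  assumes "0 \<notin> A" "\<And>a. a \<in> A \<Longrightarrow> 0 \<le> g a" "0 \<le> s" "0 < p" "0 \<le> q"
  shows "cf_sum A g s (n + m) p q \<le> cf_sum A g s m 1 0 * cf_sum A g s n p q"
  using assms(4-)
proof (induction n arbitrary: p q)
  case 0
  then show ?case
    using cf_sum_dominate[of A g p s 1 0 p q m] assms by (simp add: mult.commute)
next
  case (Suc n)
  have "cf_sum A g s (n + m) (real a * p + q) p \<le>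
    cf_sum A g s m 1 0 * cf_sum A g s n (real a * p + q) p" if "a \<in> A" for a
    using next_state[OF assms(1) that] Suc.prems by (intro Suc.IH) auto
  then show ?case
    using assms(2) by (auto simp: sum_distrib_left mult.left_commute intro!: sum_mono mult_left_mono)
qed

text \<open>Conversely \<open>q(uv) \<le> 2 q(u) q(v)\<close>, whence the constant
  \<open>4 powr s = 2 powr (2 * s)\<close>. The hypothesis \<open>q \<le> p\<close> enters through
  \<open>p + q \<le> 2 * p\<close>.\<close>

lemma cf_sum_supermult:
  assumes "0 \<notin> A" "\<And>a. a \<in> A \<Longrightarrow> 0 \<le> g a" "0 \<le> s" "0 < p" "0 \<le> q" "q \<le> p"
  shows "cf_sum A g s m 1 0 * cf_sum A g s n p q \<le> 4 powr s * cf_sum A g s (n + m) p q"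
  using assms(4-)
proof (induction n arbitrary: p q)
  case 0
  have "cf_sum A g s m 1 0 \<le> (1 / (2 * p)) powr (-2 * s) * cf_sum A g s m p q"
    using assms 0 by (intro cf_sum_dominate) (auto simp: field_simps)
  also have "(1 / (2 * p)) powr (-2 * s) = 4 powr s * p powr (2 * s)"
  proof -
    have "(4::real) powr s = 2 powr (2 * s)"
      by (subst powr_powr[symmetric]) auto
    then show ?thesis using 0 by (simp add: powr_divide powr_mult powr_minus field_simps)
  qed
  finally have "cf_sum A g s m 1 0 * p powr (-2 * s)
      \<le> (4 powr s * p powr (2 * s) * cf_sum A g s m p q) * p powr (-2 * s)"
    by (intro mult_right_mono) auto
  then show ?case using 0 by (simp add: powr_minus field_simps)
next
  case (Suc n)
  have "cf_sum A g s m 1 0 * cf_sum A g s n (real a * p + q) p \<le>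
      4 powr s * cf_sum A g s (n + m) (real a * p + q) p" if "a \<in> A" for a
    using next_state[OF assms(1) that] Suc.prems by (intro Suc.IH) auto
  then have "(\<Sum>a\<in>A. g a * (cf_sum A g s m 1 0 * cf_sum A g s n (real a * p + q) p)) \<le>
     (\<Sum>a\<in>A. g a * (4 powr s * cf_sum A g s (n + m) (real a * p + q) p))"
    using assms(2) by (intro sum_mono mult_left_mono) auto
  then show ?case
    by (simp add: sum_distrib_left mult.left_commute)
qed

lemma cf_sum_mono_s:
  assumes "0 \<notin> A" "\<And>a. a \<in> A \<Longrightarrow> 0 \<le> g a" "s \<le> s'" "1 \<le> p" "0 \<le> q"
  shows "cf_sum A g s' n p q \<le> cf_sum A g s n p q"
  using assms(4-)
proof (induction n arbitrary: p q)
  case 0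
  then show ?case using assms(3) by (auto intro!: powr_mono)
next
  case (Suc n)
  have "cf_sum A g s' n (real a * p + q) p \<le> cf_sum A g s n (real a * p + q) p" if "a \<in> A" for a
    using next_state[OF assms(1) that, of p q] Suc.prems by (intro Suc.IH) auto
  then show ?case
    using assms(2) by (auto intro!: sum_mono mult_left_mono)
qed

text \<open>Two steps of the recursion at least double the denominator.\<close>

lemma cf_sum_gap:
  assumes "0 \<notin> A" "\<And>a. a \<in> A \<Longrightarrow> 0 \<le> g a" "s \<le> s'" "0 < p" "0 \<le> q"
  shows "(2 ^ n * p) powr (2 * (s' - s)) * cf_sum A g s' (2 * n) p q \<le> cf_sum A g s (2 * n) p q"
  using assms(4-)
proof (induction n arbitrary: p q)
  case 0
  then show ?case by (simp flip: powr_add)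
next
  case (Suc n)
  have "(2 ^ Suc n * p) powr (2 * (s' - s)) * cf_sum A g s' (2 * n) (real b * (real a * p + q) + p) (real a * p + q)
      \<le> cf_sum A g s (2 * n) (real b * (real a * p + q) + p) (real a * p + q)"
    if ab: "a \<in> A" "b \<in> A" for a b
  proof -
    let ?P = "real b * (real a * p + q) + p"
    note 1 = next_state[OF assms(1) ab(1) Suc.prems]
    have 2: "real a * p + q \<le> real b * (real a * p + q)"
      using digit_ge_1[OF assms(1) ab(2)] 1 by (simp add: mult_le_cancel_right1)
    have P: "2 * p \<le> ?P" "0 < ?P" using 1 2 Suc.prems by linarith+
    have "(2 ^ Suc n * p) powr (2 * (s' - s)) \<le> (2 ^ n * ?P) powr (2 * (s' - s))"
    proof (rule powr_mono2)
      have "2 ^ n * (2 * p) \<le> 2 ^ n * ?P" using P by (intro mult_left_mono) auto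
      then show "2 ^ Suc n * p \<le> 2 ^ n * ?P" by (simp add: ac_simps)
    qed (use assms Suc.prems in auto)
    then have "(2 ^ Suc n * p) powr (2 * (s' - s)) * cf_sum A g s' (2 * n) ?P (real a * p + q)
       \<le> (2 ^ n * ?P) powr (2 * (s' - s)) * cf_sum A g s' (2 * n) ?P (real a * p + q)"
      using assms by (intro mult_right_mono cf_sum_nonneg) auto
    also have "\<dots> \<le> cf_sum A g s (2 * n) ?P (real a * p + q)"
      using P 1 by (intro Suc.IH) auto
    finally show ?thesis .
  qed
  then show ?case
    using assms(2)
    by (auto simp: sum_distrib_left mult.left_commute intro!: sum_mono mult_left_mono)
qed

text \<open>Replacing letters by \<open>h\<close> never increases a denominator, and injectivity
  keeps distinct words distinct. Inclusion of alphabets is the case of the identity.\<close>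

lemma word_sum_inj_le:
  assumes "0 \<notin> A'" "finite A'" "inj_on h A" "h ` A \<subseteq> A'" "\<And>a. a \<in> A \<Longrightarrow> h a \<le> a" "0 \<le> s"
    and "0 < p" "0 \<le> q"
  shows "word_sum A s n p q \<le> word_sum A' s n p q"
  using assms(7-)
proof (induction n arbitrary: p q)
  case 0
  then show ?case by simp
next
  case (Suc n)
  have A: "0 \<notin> A" using assms(1,4,5) by force
  have "word_sum A s n (real a * p + q) p \<le> word_sum A' s n (real (h a) * p + q) p" if a: "a \<in> A" for a
  proof -
    have "word_sum A s n (real a * p + q) p \<le> word_sum A' s n (real a * p + q) p"
      using next_state[OF A a Suc.prems] Suc.prems by (intro Suc.IH) auto
    also have "\<dots> \<le> 1 powr (-2 * s) * word_sum A' s n (real (h a) * p + q) p"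
    proof (rule cf_sum_dominate)
      show "0 < real (h a) * p + q"
        using next_state(1)[of A' "h a" p q] assms a Suc.prems by auto
      show "1 * (real (h a) * p + q) \<le> real a * p + q"
        using assms(5)[OF a] Suc.prems by (auto intro!: mult_right_mono)
      show "1 * (real (h a) * p + q + p) \<le> real a * p + q + p"
        using assms(5)[OF a] Suc.prems by (auto intro!: mult_right_mono)
    qed (use assms Suc.prems in auto)
    finally show ?thesis by simp
  qed
  then have "word_sum A s (Suc n) p q \<le> (\<Sum>a\<in>A. word_sum A' s n (real (h a) * p + q) p)"
    by (auto intro!: sum_mono)
  also have "\<dots> = (\<Sum>a\<in>h ` A. word_sum A' s n (real a * p + q) p)"
    using assms(3) by (simp add: sum.reindex)
  also have "\<dots> \<le> word_sum A' s (Suc n) p q"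
    using assms(2,4) by (auto intro!: sum_mono2 cf_sum_nonneg)
  finally show ?case .
qed

lemma word_sum_mono:
  assumes "0 \<notin> A'" "finite A'" "A \<subseteq> A'" "0 \<le> s" "0 < p" "0 \<le> q"
  shows "word_sum A s n p q \<le> word_sum A' s n p q"
  using assms by (intro word_sum_inj_le[where h = "\<lambda>a. a"]) auto

lemma cf_sum_power_le:
  assumes "0 \<notin> A" "\<And>a. a \<in> A \<Longrightarrow> 0 \<le> g a" "0 \<le> s"
  shows "cf_sum A g s (n * k) 1 0 \<le> cf_sum A g s n 1 0 ^ k"
proof (induction k)
  case (Suc k)
  have "cf_sum A g s (n * Suc k) 1 0 \<le> cf_sum A g s (n * k) 1 0 * cf_sum A g s n 1 0"
    using cf_sum_submult[of A g s 1 0 n "n * k"] assms by (simp add: mult.commute)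
  also have "\<dots> \<le> cf_sum A g s n 1 0 ^ k * cf_sum A g s n 1 0"
    using assms by (intro mult_right_mono Suc.IH cf_sum_nonneg)
  finally show ?case by (simp add: mult.commute)
qed auto

lemma word_sum_power_ge:
  assumes "0 \<notin> A" "0 \<le> s" "4 powr s \<le> word_sum A s n 1 0"
  shows "1 \<le> word_sum A s (n * k) 1 0"
proof (induction k)
  case (Suc k)
  have "4 powr s * 1 \<le> word_sum A s n 1 0 * word_sum A s (n * k) 1 0"
    using assms Suc.IH by (intro mult_mono) (auto intro: cf_sum_nonneg)
  also have "\<dots> \<le> 4 powr s * word_sum A s (n * k + n) 1 0"
    using assms by (intro cf_sum_supermult) auto
  finally show ?case by (simp add: add.commute)
qed auto

section \<open>Subcritical exponents of an alphabet\<close>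

text \<open>For an infinite alphabet the series over words is replaced by its finite partial sums.
  The bound \<open>c\<close> is common to all of them, so that the supremum stays below 1 and powers
  of \<open>c\<close> give a common rate of decay.\<close>

definition subcritical :: "nat set \<Rightarrow> real \<Rightarrow> bool" where
  "subcritical A s \<longleftrightarrow>
     (\<exists>n>0. \<exists>c<1. \<forall>A'\<subseteq>A. finite A' \<longrightarrow> word_sum A' s n 1 0 \<le> c)"

text \<open>For the empty alphabet every exponent is subcritical; the condition \<open>0 < s\<close>
  makes its critical exponent 0.\<close>

definition crit_exp :: "nat set \<Rightarrow> real" where
  "crit_exp A = Inf {s. 0 < s \<and> subcritical A s}"

lemma subcriticalI:
  assumes "0 < n" "c < 1" "\<And>A'. A' \<subseteq> A \<Longrightarrow> finite A' \<Longrightarrow> word_sum A' s n 1 0 \<le> c"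
  shows "subcritical A s"
  using assms unfolding subcritical_def by blast

lemma subcritical_finite_iff:
  assumes "0 \<notin> A" "finite A" "0 \<le> s"
  shows "subcritical A s \<longleftrightarrow> (\<exists>n>0. word_sum A s n 1 0 < 1)"
proof
  assume "subcritical A s"
  then show "\<exists>n>0. word_sum A s n 1 0 < 1"
    unfolding subcritical_def using assms(2) by (meson dual_order.refl order.strict_trans1)
next
  assume "\<exists>n>0. word_sum A s n 1 0 < 1"
  then obtain n where "n > 0" "word_sum A s n 1 0 < 1" by blast
  then show "subcritical A s"
    using assms by (intro subcriticalI[of n "word_sum A s n 1 0"] word_sum_mono) auto
qed

lemma subcritical_subset: "subcritical B s \<Longrightarrow> A \<subseteq> B \<Longrightarrow> subcritical A s"
  unfolding subcritical_def by (meson order_trans)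

lemma subcritical_mono:
  assumes "0 \<notin> A" "subcritical A s" "s \<le> s'"
  shows "subcritical A s'"
proof -
  from assms(2) obtain n c where n: "n > 0" "c < 1"
    and le: "\<And>A'. A' \<subseteq> A \<Longrightarrow> finite A' \<Longrightarrow> word_sum A' s n 1 0 \<le> c"
    unfolding subcritical_def by blast
  show ?thesis
  proof (rule subcriticalI[OF n])
    fix A' assume A': "A' \<subseteq> A" "finite A'"
    have "word_sum A' s' n 1 0 \<le> word_sum A' s n 1 0"
      using A' assms by (intro cf_sum_mono_s) auto
    with le[OF A'] show "word_sum A' s' n 1 0 \<le> c" by simp
  qed
qed

section \<open>The critical exponent\<close>

lemma subcritical_decay:
  assumes "0 \<notin> A" "subcritical A s" "0 \<le> s" "0 < \<epsilon>"
  obtains n where "N \<le> n"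
    "\<And>A'. A' \<subseteq> A \<Longrightarrow> finite A' \<Longrightarrow> word_sum A' s n 1 0 \<le> \<epsilon>"
proof -
  from assms(2) obtain n c where n: "n > 0" "c < 1"
    and le: "\<And>A'. A' \<subseteq> A \<Longrightarrow> finite A' \<Longrightarrow> word_sum A' s n 1 0 \<le> c"
    unfolding subcritical_def by blast
  have c0: "0 \<le> c"
    using le[of "{}"] cf_sum_nonneg[of "{}" "\<lambda>_. 1" s n 1 0] by auto
  obtain k0 where k0: "c ^ k0 < \<epsilon>"
    using real_arch_pow_inv[OF assms(4) n(2)] by blast
  define k where "k = max N k0"
  have k: "c ^ k \<le> \<epsilon>"
    using power_decreasing[of k0 k c] k0 n c0 by (auto simp: k_def)
  show ?thesis
  proof (rule that[of "n * k"])
    have "1 * k \<le> n * k" using n(1) by (intro mult_right_mono) auto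
    then show "N \<le> n * k" by (simp add: k_def)
    fix A' assume A': "A' \<subseteq> A" "finite A'"
    have "word_sum A' s (n * k) 1 0 \<le> word_sum A' s n 1 0 ^ k"
      using A' assms by (intro cf_sum_power_le) auto
    also have "\<dots> \<le> c ^ k"
      using le[OF A'] by (intro power_mono cf_sum_nonneg) auto
    finally show "word_sum A' s (n * k) 1 0 \<le> \<epsilon>" using k by simp
  qed
qed

lemma not_subcritical_ge_1:
  assumes "0 \<notin> A" "finite A" "0 \<le> s" "\<not> subcritical A s" "0 < n"
  shows "1 \<le> word_sum A s n 1 0"
  using assms subcritical_finite_iff[OF assms(1-3)] by (meson not_le)

text \<open>A certificate by a single length: once the supermultiplicativity constant is reached,
  all multiples of \<open>n\<close> have sums at least 1, whereas a length \<open>m\<close> with sum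
  below 1 would force the sum of length \<open>m * n\<close> below 1.\<close>

lemma not_subcriticalI:
  assumes "0 \<notin> A" "finite A" "0 \<le> s" "0 < n" "4 powr s \<le> word_sum A s n 1 0"
  shows "\<not> subcritical A s"
proof
  assume "subcritical A s"
  then obtain m where m: "m > 0" "word_sum A s m 1 0 < 1"
    using subcritical_finite_iff[OF assms(1-3)] by blast
  have "word_sum A s (m * n) 1 0 \<le> word_sum A s m 1 0 ^ n"
    using assms by (intro cf_sum_power_le) auto
  also have "\<dots> < 1"
    using m \<open>0 < n\<close> by (simp add: power_less_one_iff cf_sum_nonneg)
  finally show False
    using word_sum_power_ge[OF assms(1,3,5), of m] by (simp add: mult.commute)
qed

lemma pow2_powr_unbounded:
  fixes C t :: real
  assumes "0 < t"
  obtains n :: nat where "0 < n" "C \<le> (2 ^ n) powr t"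
proof -
  have gt: "1 < 2 powr t" using assms by simp
  obtain n where n: "C < (2 powr t) ^ n"
    using real_arch_pow[OF gt] by blast
  have "(2 powr t) ^ n \<le> (2 powr t) ^ Suc n"
    using gt by (intro power_increasing) auto
  also have "(2 powr t) ^ Suc n = (2 ^ Suc n) powr t"
    by (simp add: powr_power powr_realpow[symmetric] powr_powr mult.commute del: power_Suc)
  finally show ?thesis using n that[of "Suc n"] by simp
qed

text \<open>At \<open>s'\<close> finite subsets are only known to have sums close to 1, short of the
  constant that \<open>not_subcriticalI\<close> demands. Lowering the exponent to \<open>s\<close>
  multiplies sums of length \<open>2 * n\<close> by at least
  \<open>(2 ^ n) powr (2 * (s' - s))\<close>, which overcomes any constant.\<close>

lemma not_subcritical_finite_subset:
  assumes "0 \<notin> A" "0 \<le> s" "s < s'" "\<not> subcritical A s'"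
  obtains A' where "A' \<subseteq> A" "finite A'" "\<not> subcritical A' s"
proof -
  obtain n :: nat where n: "0 < n" "2 * 4 powr s \<le> (2 ^ n) powr (2 * (s' - s))"
    using pow2_powr_unbounded[of "2 * (s' - s)"] assms(3) by auto
  have "\<exists>A'\<subseteq>A. finite A' \<and> 1 / 2 < word_sum A' s' (2 * n) 1 0"
  proof (rule ccontr)
    assume "\<not> ?thesis"
    then have "word_sum A' s' (2 * n) 1 0 \<le> 1 / 2" if "A' \<subseteq> A" "finite A'" for A'
      using that by (meson not_le)
    then have "subcritical A s'"
      using n(1) by (intro subcriticalI[of "2 * n" "1 / 2"]) auto
    with assms(4) show False by simp
  qed
  then obtain A' where A': "A' \<subseteq> A" "finite A'" "1 / 2 < word_sum A' s' (2 * n) 1 0"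
    by blast
  have "4 powr s \<le> (2 * 4 powr s) * word_sum A' s' (2 * n) 1 0"
    using A'(3) by simp
  also have "\<dots> \<le> (2 ^ n * 1) powr (2 * (s' - s)) * word_sum A' s' (2 * n) 1 0"
    using n by (intro mult_right_mono cf_sum_nonneg) auto
  also have "(2 ^ n * 1) powr (2 * (s' - s)) * word_sum A' s' (2 * n) 1 0 \<le> word_sum A' s (2 * n) 1 0"
    using A' assms by (intro cf_sum_gap) auto
  finally have "\<not> subcritical A' s"
    using A' n assms by (intro not_subcriticalI[of A' s "2 * n"]) auto
  with A' that show ?thesis by blast
qed

section \<open>Test functions for the transfer operator\<close>

text \<open>The operator sends a function of the state to its sum over the successor states, and
  \<open>f\<close> is a supersolution with rate \<open>c\<close>. Iteration reduces the analysis of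
  long words to an inequality for one letter. States with \<open>q \<le> p\<close> suffice, since
  successors are again of this kind.\<close>

lemma word_sum_test_le:
  assumes "0 \<notin> A" "0 < l"
    and lower: "\<And>p q. 0 < p \<Longrightarrow> 0 \<le> q \<Longrightarrow> q \<le> p \<Longrightarrow> l * p powr (-2 * s) \<le> f p q"
    and step: "\<And>p q. 0 < p \<Longrightarrow> 0 \<le> q \<Longrightarrow> q \<le> p \<Longrightarrow> (\<Sum>a\<in>A. f (real a * p + q) p) \<le> c * f p q"
    and "0 \<le> c" "0 < p" "0 \<le> q" "q \<le> p"
  shows "l * word_sum A s n p q \<le> c ^ n * f p q"
  using assms(6-)
proof (induction n arbitrary: p q)
  case 0
  then show ?case using lower by simp
next
  case (Suc n)
  have "l * word_sum A s (Suc n) p q \<le> (\<Sum>a\<in>A. c ^ n * f (real a * p + q) p)"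
    unfolding cf_sum.simps sum_distrib_left mult_1
    using next_state[OF assms(1) _ Suc.prems(1,2)] Suc.prems by (intro sum_mono Suc.IH) auto
  also have "\<dots> \<le> c ^ n * (c * f p q)"
    unfolding sum_distrib_left[symmetric] using assms(5) step Suc.prems by (intro mult_left_mono) auto
  finally show ?case by (simp add: ac_simps)
qed

lemma word_sum_test_ge:
  assumes "0 \<notin> A" "0 < u"
    and upper: "\<And>p q. 0 < p \<Longrightarrow> 0 \<le> q \<Longrightarrow> q \<le> p \<Longrightarrow> f p q \<le> u * p powr (-2 * s)"
    and step: "\<And>p q. 0 < p \<Longrightarrow> 0 \<le> q \<Longrightarrow> q \<le> p \<Longrightarrow> c * f p q \<le> (\<Sum>a\<in>A. f (real a * p + q) p)"
    and "0 \<le> c" "0 < p" "0 \<le> q" "q \<le> p"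
  shows "c ^ n * f p q \<le> u * word_sum A s n p q"
  using assms(6-)
proof (induction n arbitrary: p q)
  case 0
  then show ?case using upper by simp
next
  case (Suc n)
  have "c ^ n * (c * f p q) \<le> (\<Sum>a\<in>A. c ^ n * f (real a * p + q) p)"
    unfolding sum_distrib_left[symmetric] using assms(5) step Suc.prems by (intro mult_left_mono) auto
  also have "\<dots> \<le> u * word_sum A s (Suc n) p q"
    unfolding cf_sum.simps sum_distrib_left mult_1
    using next_state[OF assms(1) _ Suc.prems(1,2)] Suc.prems by (intro sum_mono Suc.IH) auto
  finally show ?case by (simp add: ac_simps)
qed

text \<open>The test function is modelled on Gauss's invariant density \<open>1 / (1 + x)\<close>, to which it reduces
  for \<open>s = c = 1\<close> and \<open>x = q / p\<close>.\<close>

definition branch :: "real \<Rightarrow> real \<Rightarrow> real \<Rightarrow> real" where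
  "branch c x a = (1 + c * x) / ((a + x) * (a + c + x))"

text \<open>For \<open>f p q = (p * (p + c * q)) powr (-s)\<close> the quotient of \<open>f\<close>
  at a successor and at the state depends on \<open>x = q / p\<close> alone and equals
  \<open>branch c x a powr s\<close>. The factor \<open>(1 + c) powr s\<close> is the price of
  comparing \<open>f\<close> with \<open>p powr (-2 * s)\<close> when
  \<open>q \<le> p\<close>.\<close>

lemma word_sum_le_branch:
  assumes "0 \<notin> A" "0 \<le> c" "0 \<le> s" "0 \<le> k"
    and step: "\<And>x. 0 \<le> x \<Longrightarrow> x \<le> 1 \<Longrightarrow> (\<Sum>a\<in>A. branch c x (real a) powr s) \<le> k"
  shows "word_sum A s n 1 0 \<le> (1 + c) powr s * k ^ n"
proof -
  define f where "f p q = (p * (p + c * q)) powr (-s)" for p q :: real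
  have "(1 + c) powr (-s) * word_sum A s n 1 0 \<le> k ^ n * f 1 0"
  proof (rule word_sum_test_le[OF assms(1)])
    show "0 < (1 + c) powr (-s)" using assms by simp
    fix p q :: real assume pq: "0 < p" "0 \<le> q" "q \<le> p"
    have cq: "0 \<le> c * q" "c * q \<le> c * p" using pq assms(2) by (auto intro: mult_left_mono)
    have "(1 + c) powr (-s) * p powr (-2 * s) = (p * (p + c * p)) powr (-s)"
    proof -
      have "p powr (-2 * s) = (p * p) powr (-s)"
        using pq by (simp add: powr_mult flip: powr_add)
      then show ?thesis using pq assms(2)
        by (simp add: powr_mult[symmetric] algebra_simps)
    qed
    also have "\<dots> \<le> f p q"
      unfolding f_def using pq assms cq
      by (intro powr_mono2' mult_pos_pos mult_left_mono add_pos_nonneg) auto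
    finally show "(1 + c) powr (-s) * p powr (-2 * s) \<le> f p q" .
    have "f (real a * p + q) p = branch c (q / p) (real a) powr s * f p q" if "a \<in> A" for a
    proof -
      have a: "0 < real a" using digit_ge_1[OF assms(1) that] by simp
      have "((real a * p + q) * (real a * p + q + c * p)) =
          p * (p + c * q) * inverse (branch c (q / p) (real a))"
        using pq cq a unfolding branch_def
        by (simp add: divide_simps add_pos_nonneg) (simp add: algebra_simps)
      moreover have "0 < branch c (q / p) (real a)"
        using pq cq a assms(2) unfolding branch_def
        by (intro divide_pos_pos mult_pos_pos add_pos_nonneg) auto
      moreover from this have "inverse (branch c (q / p) (real a)) powr (-s) = branch c (q / p) (real a) powr s"
        by (simp add: powr_minus inverse_eq_divide powr_divide)
      moreover have "0 < p * (p + c * q)"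
        using pq cq by (intro mult_pos_pos add_pos_nonneg) auto
      ultimately show ?thesis
        unfolding f_def by (simp add: powr_mult mult.commute del: mult_pos_pos)
    qed
    then have "(\<Sum>a\<in>A. f (real a * p + q) p) = (\<Sum>a\<in>A. branch c (q / p) (real a) powr s) * f p q"
      by (simp add: sum_distrib_right)
    also have "\<dots> \<le> k * f p q"
      using step[of "q / p"] pq by (intro mult_right_mono) (auto simp: f_def)
    finally show "(\<Sum>a\<in>A. f (real a * p + q) p) \<le> k * f p q" .
  qed (use assms in auto)
  then show ?thesis
    using assms(2) by (simp add: f_def powr_minus field_simps)
qed

text \<open>The sum telescopes, as
  \<open>branch 1 x a = (1 + x) * (1 / (a + x) - 1 / (a + 1 + x))\<close>; with all digits allowed
  this is the invariance of Gauss's density.\<close>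

lemma sum_branch_1_le:
  assumes "0 \<notin> A" "finite A" "0 \<le> x"
  shows "(\<Sum>a\<in>A. branch 1 x (real a)) \<le> 1"
proof -
  obtain N where N: "A \<subseteq> {Suc 0..<Suc N}"
  proof (cases "A = {}")
    case False
    have "A \<subseteq> {Suc 0..<Suc (Max A)}"
      using assms False by (auto simp: Suc_le_eq less_Suc_eq_le intro!: gr0I)
    then show ?thesis using that by blast
  qed auto
  have eq: "branch 1 x (real a) = (1 + x) * (1 / (real a + x) - 1 / (real (Suc a) + x))" if "a > 0" for a
    using assms(3) that unfolding branch_def by (simp add: divide_simps)
  have "(\<Sum>a\<in>A. branch 1 x (real a)) \<le> (\<Sum>a=Suc 0..<Suc N. branch 1 x (real a))"
    using N assms(3) by (intro sum_mono2) (auto simp: branch_def)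
  also have "\<dots> = (\<Sum>a=Suc 0..<Suc N. (1 + x) * (1 / (real a + x) - 1 / (real (Suc a) + x)))"
    by (intro sum.cong eq) auto
  also have "\<dots> = (1 + x) * (1 / (1 + x) - 1 / (real (Suc N) + x))"
    by (induction N) (simp_all add: algebra_simps)
  also have "\<dots> \<le> (1 + x) * (1 / (1 + x))"
    using assms(3) by (intro mult_left_mono) auto
  finally show ?thesis using assms(3) by simp
qed

text \<open>At exponent 1 word sums never exceed 2, and at a larger exponent they are smaller by an
  unbounded factor. The finite subset is extracted at the midpoint of 1 and \<open>s\<close>, which
  leaves room for that factor.\<close>

lemma subcritical_gt_1:
  assumes "0 \<notin> A" "1 < s"
  shows "subcritical A s"
proof (rule ccontr)
  assume "\<not> subcritical A s"
  then obtain A' where A': "A' \<subseteq> A" "finite A'" "\<not> subcritical A' ((1 + s) / 2)"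
    using not_subcritical_finite_subset[OF assms(1), of "(1 + s) / 2" s] assms(2) by auto
  define s' where "s' = (1 + s) / 2"
  have s': "1 < s'" using assms(2) by (simp add: s'_def)
  have A0: "0 \<notin> A'" using A' assms by auto
  have bound: "word_sum A' 1 n 1 0 \<le> 2" for n
    using word_sum_le_branch[OF A0, of 1 1 1 n] sum_branch_1_le[OF A0 A'(2)] 
    by (simp add: branch_def)
  have ns: "\<not> subcritical A' s'" using A'(3) by (simp add: s'_def)
  have ge: "1 \<le> word_sum A' s' n 1 0" if "n > 0" for n
    using not_subcritical_ge_1[OF A0 A'(2) _ ns that] s' by simp
  obtain n :: nat where n: "0 < n" "3 \<le> (2 ^ n) powr (2 * (s' - 1))"
    using pow2_powr_unbounded[of "2 * (s' - 1)"] s' by auto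
  have "3 * 1 \<le> (2 ^ n * 1) powr (2 * (s' - 1)) * word_sum A' s' (2 * n) 1 0"
    using n ge[of "2 * n"] by (intro mult_mono) auto
  also have "(2 ^ n * 1) powr (2 * (s' - 1)) * word_sum A' s' (2 * n) 1 0 \<le> word_sum A' 1 (2 * n) 1 0"
    using A0 s' by (intro cf_sum_gap) auto
  also have "\<dots> \<le> 2" by (rule bound)
  finally show False by simp
qed

lemma subcritical_finite_not_ge_1:
  assumes "0 \<notin> A" "0 \<le> s" "finite A" "\<And>n. 0 < n \<Longrightarrow> 1 \<le> word_sum A s n 1 0"
  shows "\<not> subcritical A s"
  using assms subcritical_finite_iff[of A s] by (meson not_le)

lemma crit_exp_set_nonempty: "0 \<notin> A \<Longrightarrow> {s. 0 < s \<and> subcritical A s} \<noteq> {}"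
  using subcritical_gt_1[of A 2] by force

lemma crit_exp_bdd: "bdd_below {s. 0 < s \<and> subcritical A s}"
  by (rule bdd_belowI[of _ 0]) auto

lemma crit_exp_nonneg: "0 \<notin> A \<Longrightarrow> 0 \<le> crit_exp A"
  unfolding crit_exp_def using crit_exp_set_nonempty by (intro cInf_greatest) auto

lemma crit_exp_le: "0 < s \<Longrightarrow> subcritical A s \<Longrightarrow> crit_exp A \<le> s"
  unfolding crit_exp_def by (rule cInf_lower[OF _ crit_exp_bdd]) auto

lemma crit_exp_ge:
  assumes "0 \<notin> A" "\<not> subcritical A s"
  shows "s \<le> crit_exp A"
  unfolding crit_exp_def
proof (rule cInf_greatest[OF crit_exp_set_nonempty[OF assms(1)]])
  fix t assume "t \<in> {s. 0 < s \<and> subcritical A s}"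
  then show "s \<le> t"
    using assms subcritical_mono[of A t s] by (cases "s \<le> t") auto
qed

lemma subcritical_above: "0 \<notin> A \<Longrightarrow> crit_exp A < s \<Longrightarrow> subcritical A s"
  using crit_exp_ge[of A s] by force

lemma crit_exp_mono:
  assumes "0 \<notin> B" "A \<subseteq> B"
  shows "crit_exp A \<le> crit_exp B"
  unfolding crit_exp_def using assms
  by (intro cInf_superset_mono crit_exp_set_nonempty crit_exp_bdd) (auto intro: subcritical_subset)

text \<open>The critical exponent is the supremum over finite subsets. Two exponents are inserted
  between \<open>t\<close> and \<open>crit_exp A\<close>, because extracting a finite subset lowers
  the exponent.\<close>

lemma crit_exp_le_finite:
  assumes "0 \<notin> A" "\<And>A'. A' \<subseteq> A \<Longrightarrow> finite A' \<Longrightarrow> crit_exp A' \<le> t"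
  shows "crit_exp A \<le> t"
proof (rule ccontr)
  assume t: "\<not> ?thesis"
  have "0 \<le> t" using assms(2)[of "{}"] crit_exp_nonneg[of "{}"] by simp
  define s s' where "s = (2 * t + crit_exp A) / 3" and "s' = (t + 2 * crit_exp A) / 3"
  have s: "t < s" "s < s'" "s' < crit_exp A" using t by (auto simp: s_def s'_def)
  then have "\<not> subcritical A s'" using crit_exp_le[of s' A] \<open>0 \<le> t\<close> by force
  then obtain A' where A': "A' \<subseteq> A" "finite A'" "\<not> subcritical A' s"
    using not_subcritical_finite_subset[OF assms(1), of s s'] s \<open>0 \<le> t\<close> by auto
  then have "s \<le> crit_exp A'" using assms(1) by (intro crit_exp_ge) auto
  with assms(2)[OF A'(1,2)] s show False by simp
qed

section \<open>Adding a large digit and trading a digit for larger ones\<close>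

text \<open>Splitting at an occurrence of \<open>e\<close> gives at most \<open>n\<close> positions;
  this letter contributes \<open>e powr (-2 * s)\<close> and the others at most
  \<open>C ^ n\<close>. For fixed \<open>n\<close> the error therefore vanishes as \<open>e\<close>
  grows, which keeps a sum below 1 where it is.\<close>

lemma word_sum_insert_le:
  assumes "0 \<notin> A" "finite A" "0 \<le> s" "1 \<le> C" "word_sum A s 1 1 0 + 1 \<le> C" "e \<notin> A" "0 < e"
    and "0 < p" "0 \<le> q"
  shows "word_sum (insert e A) s n p q
      \<le> word_sum A s n p q + real n * C ^ n * real e powr (-2 * s) * p powr (-2 * s)"
  using assms(8-)
proof (induction n arbitrary: p q)
  case 0
  then show ?case by simp
next
  case (Suc n)
  let ?E = "real e powr (-2 * s)"
  have e: "0 \<notin> insert e A" "1 \<le> real e" using assms by auto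
  have E: "0 \<le> ?E" "?E \<le> 1" using e assms(3) powr_mono2'[of "-2 * s" 1 "real e"] by auto
  have Z1: "word_sum (insert e A) s 1 1 0 \<le> C"
    using assms E by auto
  have sum_le: "(\<Sum>a\<in>A. (real a * p + q) powr (-2 * s)) \<le> C * p powr (-2 * s)"
  proof -
    have "0 < real a * p" if "a \<in> A" for a
      using digit_ge_1[OF assms(1) that] Suc.prems by simp
    then have "(\<Sum>a\<in>A. (real a * p + q) powr (-2 * s)) \<le> (\<Sum>a\<in>A. (real a * p) powr (-2 * s))"
      using assms(3) Suc.prems by (intro sum_mono powr_mono2') auto
    also have "\<dots> = word_sum A s 1 1 0 * p powr (-2 * s)"
      using Suc.prems by (simp add: sum_distrib_right powr_mult)
    also have "\<dots> \<le> C * p powr (-2 * s)"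
      using assms(5) by (intro mult_right_mono) auto
    finally show ?thesis .
  qed
  have pe: "0 < real e * p + q" using next_state(1)[OF e(1), of e p q] Suc.prems by simp
  have "word_sum (insert e A) s n (real e * p + q) p \<le>
      word_sum (insert e A) s n 1 0 * word_sum (insert e A) s 0 (real e * p + q) p"
    using cf_sum_submult[OF e(1), of "\<lambda>_. 1" s "real e * p + q" p 0 n] assms(3) pe Suc.prems by simp
  also have "\<dots> \<le> C ^ n * (?E * p powr (-2 * s))"
  proof (rule mult_mono)
    have "word_sum (insert e A) s (1 * n) 1 0 \<le> word_sum (insert e A) s 1 1 0 ^ n"
      using e assms(3) by (intro cf_sum_power_le) auto
    also have "\<dots> \<le> C ^ n" using Z1 by (intro power_mono cf_sum_nonneg) auto
    finally show "word_sum (insert e A) s n 1 0 \<le> C ^ n" by simp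
    have "(real e * p + q) powr (-2 * s) \<le> (real e * p) powr (-2 * s)"
      using e Suc.prems assms(3) by (intro powr_mono2') auto
    then show "word_sum (insert e A) s 0 (real e * p + q) p \<le> ?E * p powr (-2 * s)"
      using Suc.prems by (simp add: powr_mult)
  qed (use assms(4) in \<open>auto intro: cf_sum_nonneg\<close>)
  finally have new: "word_sum (insert e A) s n (real e * p + q) p \<le> C ^ n * (?E * p powr (-2 * s))" .
  have "(\<Sum>a\<in>A. word_sum (insert e A) s n (real a * p + q) p) \<le>
      (\<Sum>a\<in>A. word_sum A s n (real a * p + q) p
          + real n * C ^ n * ?E * (real a * p + q) powr (-2 * s))"
    using next_state[OF assms(1)] Suc.prems by (intro sum_mono Suc.IH) auto
  also have "\<dots> = word_sum A s (Suc n) p q + real n * C ^ n * ?E * (\<Sum>a\<in>A. (real a * p + q) powr (-2 * s))"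
    by (simp add: sum.distrib sum_distrib_left)
  also have "real n * C ^ n * ?E * (\<Sum>a\<in>A. (real a * p + q) powr (-2 * s)) \<le>
     real n * C ^ n * ?E * (C * p powr (-2 * s))"
    using sum_le assms(4) E by (intro mult_left_mono) auto
  finally have old: "(\<Sum>a\<in>A. word_sum (insert e A) s n (real a * p + q) p) \<le>
     word_sum A s (Suc n) p q + real n * C ^ Suc n * ?E * p powr (-2 * s)"
    by (simp add: ac_simps)
  have "C ^ n * (?E * p powr (-2 * s)) \<le> C ^ Suc n * (?E * p powr (-2 * s))"
    using assms(4) E by (intro mult_right_mono power_increasing) auto
  with old new show ?case
    using assms(2,6) by (simp add: algebra_simps)
qed

lemma subcritical_insert_large:
  assumes "0 \<notin> A" "0 < s" "subcritical A s"
  obtains N where "\<And>e. N \<le> e \<Longrightarrow> subcritical (insert e A) s"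
proof -
  from assms(3) obtain n c where n: "n > 0" "c < 1"
    and le: "\<And>A'. A' \<subseteq> A \<Longrightarrow> finite A' \<Longrightarrow> word_sum A' s n 1 0 \<le> c"
    unfolding subcritical_def by blast
  \<comment> \<open>One-letter sums of a finite subcritical alphabet are below
    \<open>4 powr s\<close>; the 1 leaves room for the added digit.\<close>
  define C where "C = 1 + 4 powr s"
  have Z1: "word_sum A' s 1 1 0 + 1 \<le> C" if "A' \<subseteq> A" "finite A'" for A'
  proof -
    have "subcritical A' s" using assms(3) that(1) by (rule subcritical_subset)
    then have "\<not> 4 powr s \<le> word_sum A' s 1 1 0"
      using not_subcriticalI[of A' s 1] that assms by auto
    then show ?thesis by (simp add: C_def)
  qed
  have "((\<lambda>e. real n * C ^ n * real e powr (-2 * s)) \<longlongrightarrow> real n * C ^ n * 0) sequentially"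
    using assms(2)
    by (intro tendsto_mult tendsto_const tendsto_neg_powr filterlim_real_sequentially) auto
  then have "eventually (\<lambda>e. real n * C ^ n * real e powr (-2 * s) < (1 - c) / 2) sequentially"
    using n by (intro order_tendstoD) auto
  then obtain N where N: "\<And>e. N \<le> e \<Longrightarrow> real n * C ^ n * real e powr (-2 * s) < (1 - c) / 2"
    unfolding eventually_sequentially by blast
  have "subcritical (insert e A) s" if e: "max 1 N \<le> e" for e
  proof (rule subcriticalI[of n "(1 + c) / 2"])
    fix A' assume A': "A' \<subseteq> insert e A" "finite A'"
    have sub: "A' - {e} \<subseteq> A" "finite (A' - {e})" using A' by auto
    have "word_sum A' s n 1 0 \<le> word_sum (insert e (A' - {e})) s n 1 0"
      using A' e assms by (intro word_sum_mono) auto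
    also have "\<dots> \<le> word_sum (A' - {e}) s n 1 0 + real n * C ^ n * real e powr (-2 * s) * 1 powr (-2 * s)"
      using sub assms e Z1[OF sub] by (intro word_sum_insert_le) (auto simp: C_def)
    also have "\<dots> \<le> (1 + c) / 2"
      using le[OF sub] N[of e] e by (simp add: field_simps)
    finally show "word_sum A' s n 1 0 \<le> (1 + c) / 2" .
  qed (use n in auto)
  with that show ?thesis by blast
qed

text \<open>Induction treats the letters after the first. A leading \<open>e\<close> is then traded:
  its words are dominated by those with leading \<open>r\<close>, with a factor that compensates
  \<open>(e / r) powr (2 * s)\<close>. As \<open>B\<close> and \<open>R\<close> are disjoint, no
  word is counted twice.\<close>

lemma word_sum_replace_le:
  assumes "0 \<notin> B" "0 < e" "e \<notin> B" "finite B" "finite R" "B \<inter> R = {}"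
    and R: "\<And>r. r \<in> R \<Longrightarrow> e \<le> r" "1 \<le> (\<Sum>r\<in>R. (real e / real r) powr (2 * s))"
    and "0 \<le> s" "0 < p" "0 \<le> q"
  shows "word_sum (insert e B) s n p q \<le> word_sum (B \<union> R) s n p q"
  using assms(10-)
proof (induction n arbitrary: p q)
  case 0
  then show ?case by simp
next
  case (Suc n)
  let ?W = "word_sum (B \<union> R) s n"
  have BR: "0 \<notin> B \<union> R" using R(1) assms(1,2) by force
  have eB: "0 \<notin> insert e B" using assms by auto
  have "word_sum (insert e B) s (Suc n) p q =
     word_sum (insert e B) s n (real e * p + q) p + (\<Sum>a\<in>B. word_sum (insert e B) s n (real a * p + q) p)"
    using assms(3,4) by simp
  also have "\<dots> \<le> ?W (real e * p + q) p + (\<Sum>a\<in>B. ?W (real a * p + q) p)"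
    using next_state[OF eB] Suc.prems by (intro add_mono sum_mono Suc.IH) auto
  also have "?W (real e * p + q) p \<le> (\<Sum>r\<in>R. (real e / real r) powr (2 * s)) * ?W (real e * p + q) p"
    using R(2) mult_right_mono[OF R(2) cf_sum_nonneg[of "B \<union> R" "\<lambda>_. 1" s n "real e * p + q" p]] by simp
  also have "\<dots> \<le> (\<Sum>r\<in>R. ?W (real r * p + q) p)"
    unfolding sum_distrib_right
  proof (rule sum_mono)
    fix r assume r: "r \<in> R"
    have er: "real e \<le> real r" "0 < real e" using R(1)[OF r] assms(2) by auto
    have "?W (real e * p + q) p \<le> (real e / real r) powr (-2 * s) * ?W (real r * p + q) p"
    proof (rule cf_sum_dominate[OF BR])
      show "0 < real r * p + q" using er Suc.prems by (simp add: add_pos_nonneg)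
      have eq: "(real e / real r) * q \<le> 1 * q" "(real e / real r) * p \<le> 1 * p"
        using er Suc.prems mult_right_mono[of "real e / real r" 1 q] mult_right_mono[of "real e / real r" 1 p]
        by simp_all
      show "(real e / real r) * (real r * p + q) \<le> real e * p + q"
        using eq er by (simp add: algebra_simps)
      show "(real e / real r) * (real r * p + q + p) \<le> real e * p + q + p"
        using eq er by (simp add: algebra_simps)
    qed (use er assms Suc.prems in auto)
    then have "(real e / real r) powr (2 * s) * ?W (real e * p + q) p \<le>
        (real e / real r) powr (2 * s) * ((real e / real r) powr (-2 * s) * ?W (real r * p + q) p)"
      by (intro mult_left_mono) auto
    also have "\<dots> = ?W (real r * p + q) p"
      using er by (simp add: powr_minus)
    finally show "(real e / real r) powr (2 * s) * ?W (real e * p + q) p \<le> ?W (real r * p + q) p" .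
  qed
  finally show ?case
    using assms(4-6) by (simp add: sum.union_disjoint)
qed

lemma crit_exp_replace:
  assumes "0 \<notin> B" "0 < e" "e \<notin> B" "finite B" "finite R" "B \<inter> R = {}"
    and R: "\<And>r. r \<in> R \<Longrightarrow> e \<le> r" "1 \<le> (\<Sum>r\<in>R. (real e / real r) powr (2 * \<tau>))"
    and "0 \<le> t" "t < \<tau>" "t < crit_exp (insert e B)"
  shows "t < crit_exp (B \<union> R)"
proof -
  define s where "s = (t + min \<tau> (crit_exp (insert e B))) / 2"
  have s: "t < s" "s < \<tau>" "s < crit_exp (insert e B)" "0 < s"
    using assms(9-) by (auto simp: s_def min_def)
  have eB: "0 \<notin> insert e B" "finite (insert e B)" using assms by auto
  have BR: "0 \<notin> B \<union> R" "finite (B \<union> R)" using R(1) assms by force+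
  have "(\<Sum>r\<in>R. (real e / real r) powr (2 * \<tau>)) \<le> (\<Sum>r\<in>R. (real e / real r) powr (2 * s))"
    using R(1) assms(2) s by (intro sum_mono powr_mono') (auto simp: divide_le_eq_1)
  then have R2: "1 \<le> (\<Sum>r\<in>R. (real e / real r) powr (2 * s))" using R(2) by simp
  have ns: "\<not> subcritical (insert e B) s"
    using crit_exp_le[of s "insert e B"] s by force
  have "\<not> subcritical (B \<union> R) s"
  proof (rule subcritical_finite_not_ge_1)
    fix n :: nat assume n: "0 < n"
    have "1 \<le> word_sum (insert e B) s n 1 0"
      using eB s ns n by (intro not_subcritical_ge_1) auto
    also have "\<dots> \<le> word_sum (B \<union> R) s n 1 0"
      using assms s R2 by (intro word_sum_replace_le) auto
    finally show "1 \<le> word_sum (B \<union> R) s n 1 0" .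
  qed (use BR s in auto)
  then have "s \<le> crit_exp (B \<union> R)" using BR by (intro crit_exp_ge) auto
  with s show ?thesis by simp
qed

section \<open>Continued fractions and cylinders\<close>

text \<open>With start \<open>1 0\<close> this is \<open>q_n + q_(n-1) * x\<close>, where
  \<open>q_n\<close> and \<open>q_(n-1)\<close> are the denominators of the last two convergents of
  \<open>w\<close> and \<open>x\<close> is the value of the unread tail. Up to sign, its inverse
  square is the derivative of \<open>cf_eval w\<close> at \<open>x\<close>.\<close>

fun cf_denom :: "nat list \<Rightarrow> real \<Rightarrow> real \<Rightarrow> real \<Rightarrow> real" where
  "cf_denom [] p q x = p + q * x"
| "cf_denom (a # w) p q x = cf_denom w (real a * p + q) p x"

fun cf_eval :: "nat list \<Rightarrow> real \<Rightarrow> real" where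
  "cf_eval [] x = x"
| "cf_eval (a # w) x = 1 / (real a + cf_eval w x)"

definition digit_words :: "nat set \<Rightarrow> nat \<Rightarrow> nat list set" where
  "digit_words A n = {w. set w \<subseteq> A \<and> length w = n}"

definition digit_seqs :: "nat set \<Rightarrow> (nat \<Rightarrow> nat) set" where
  "digit_seqs A = {b. \<forall>i. b i \<in> A}"

abbreviation den :: "nat list \<Rightarrow> real" where
  "den w \<equiv> cf_denom w 1 0 0"

lemma finite_digit_words: "finite A \<Longrightarrow> finite (digit_words A n)"
  unfolding digit_words_def by (rule finite_lists_length_eq)

lemma digit_words_Suc: "digit_words A (Suc n) = (\<lambda>(a, w). a # w) ` (A \<times> digit_words A n)"
  by (auto simp: digit_words_def length_Suc_conv image_iff)

lemma word_sum_eq_sum_words: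
  "word_sum A s n p q = (\<Sum>w\<in>digit_words A n. cf_denom w p q 0 powr (-2 * s))"
proof (induction n arbitrary: p q)
  case 0
  have "digit_words A 0 = {[]}" by (auto simp: digit_words_def)
  then show ?case by simp
next
  case (Suc n)
  have "inj_on (\<lambda>(a, w). a # w) (A \<times> digit_words A n)" by (auto simp: inj_on_def)
  then show ?case
    by (simp add: Suc digit_words_Suc sum.reindex sum.cartesian_product case_prod_unfold)
qed

lemma cf_eval_nonneg: "0 \<le> x \<Longrightarrow> 0 \<le> cf_eval w x"
  by (induction w) auto

lemma cf_eval_le_1: "0 \<notin> set w \<Longrightarrow> 0 \<le> x \<Longrightarrow> x \<le> 1 \<Longrightarrow> cf_eval w x \<le> 1"
proof (induction w)
  case (Cons a w)
  then have "1 \<le> real a" "0 \<le> cf_eval w x" using cf_eval_nonneg[of x w] by auto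
  then show ?case by simp
qed auto

lemma cf_denom_pos:
  "0 \<notin> set w \<Longrightarrow> 0 < p \<Longrightarrow> 0 \<le> q \<Longrightarrow> 0 \<le> x \<Longrightarrow> 0 < cf_denom w p q x"
proof (induction w arbitrary: p q)
  case (Cons a w)
  then show ?case using next_state[of "{a}" a p q] by simp
qed (auto intro: add_pos_nonneg)

text \<open>The denominator is linear in the initial state, and the quotient of its two coefficients
  is the value \<open>cf_eval w x\<close>.\<close>

lemma cf_denom_factor:
  "0 \<notin> set w \<Longrightarrow> 0 \<le> x \<Longrightarrow> cf_denom w p q x = (p + q * cf_eval w x) * cf_denom w 1 0 x"
proof (induction w arbitrary: p q)
  case (Cons a w)
  have "0 < real a + cf_eval w x"
    using Cons.prems cf_eval_nonneg[of x w] by (auto intro: add_pos_nonneg)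
  then show ?case
    using Cons.prems Cons.IH[of "real a * p + q" p] Cons.IH[of "real a" 1]
    by (simp add: field_simps)
qed auto

lemma cf_denom_Cons:
  "0 \<notin> set (a # w) \<Longrightarrow> 0 \<le> x \<Longrightarrow>
    cf_denom (a # w) 1 0 x = (real a + cf_eval w x) * cf_denom w 1 0 x"
  using cf_denom_factor[of w x "real a" 1] by simp

lemma cf_eval_append: "cf_eval (u @ v) x = cf_eval u (cf_eval v x)"
  by (induction u) auto

text \<open>This is the chain rule for the derivatives of the maps \<open>cf_eval\<close>.\<close>

lemma cf_denom_append:
  assumes "0 \<notin> set (u @ v)" "0 \<le> x"
  shows "cf_denom (u @ v) 1 0 x = cf_denom u 1 0 (cf_eval v x) * cf_denom v 1 0 x"
  using assms
proof (induction u)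
  case (Cons a u)
  then show ?case
    using cf_denom_Cons[of a "u @ v" x] cf_denom_Cons[of a u "cf_eval v x"] cf_eval_nonneg[of x v]
    by (simp add: cf_eval_append)
qed auto

lemma cf_denom_mono:
  assumes "0 \<le> p" "0 \<le> q" "0 \<le> x" "x \<le> y"
  shows "cf_denom w p q x \<le> cf_denom w p q y"
  using assms by (induction w arbitrary: p q) (auto intro: mult_left_mono)

text \<open>Bounded distortion: over tails in \<open>[0, 1]\<close> the denominator varies by a
  factor of at most 2.\<close>

lemma cf_denom_le_twice:
  assumes "0 \<notin> set w" "0 < p" "0 \<le> q" "q \<le> p" "0 \<le> x" "x \<le> 1"
  shows "cf_denom w p q x \<le> 2 * cf_denom w p q 0"
  using assms
proof (induction w arbitrary: p q)
  case Nil
  then have "q * x \<le> p * 1" by (intro mult_mono) auto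
  then show ?case by simp
next
  case (Cons a w)
  then show ?case using next_state[of "{a}" a p q] by simp
qed

lemma den_append_ge:
  assumes "0 \<notin> set (u @ v)"
  shows "den u * den v \<le> den (u @ v)"
  using assms cf_denom_mono[of 1 0 0 "cf_eval v 0" u] cf_eval_nonneg[of 0 v] cf_denom_pos[of v 1 0 0]
  by (auto simp: cf_denom_append intro!: mult_right_mono)

lemma cf_denom_ge_pow2:
  assumes "0 \<notin> set w" "0 < p" "0 \<le> q"
  shows "2 ^ (length w div 2) * p \<le> cf_denom w p q 0"
  using assms
proof (induction w arbitrary: p q rule: induct_list012)
  case (2 a)
  then show ?case using next_state[of "{a}" a p q] by simp
next
  case (3 a b w)
  note 1 = next_state[of "{a}" a p q]
  have ab: "0 < real a * p + q" "p \<le> real a * p + q"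
    using 1 3(3-) by auto
  have "real a * p + q \<le> real b * (real a * p + q)" "0 < real b * (real a * p + q) + p"
    using next_state[of "{b}" b "real a * p + q" 0] next_state[of "{b}" b "real a * p + q" p] ab 3(3-)
    by auto
  then have ge: "2 * p \<le> real b * (real a * p + q) + p" and pos: "0 < real b * (real a * p + q) + p"
    using ab by linarith+
  have "2 ^ (length w div 2) * (2 * p) \<le> 2 ^ (length w div 2) * (real b * (real a * p + q) + p)"
    using ge by (intro mult_left_mono) auto
  also have "\<dots> \<le> cf_denom w (real b * (real a * p + q) + p) (real a * p + q) 0"
    using 3(3-) pos 1 by (intro 3(1)) auto
  finally show ?case by (simp add: ac_simps)
qed auto

lemma den_ge_1: "0 \<notin> set w \<Longrightarrow> 1 \<le> den w"
  using cf_denom_ge_pow2[of w 1 0] order_trans[of 1 "2 ^ (length w div 2)" "den w"] by simp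

text \<open>For a Moebius map the mean value formula is exact, with the geometric mean of the
  derivatives at the two points.\<close>

lemma cf_eval_diff:
  assumes "0 \<notin> set w" "0 \<le> x" "0 \<le> y"
  shows "\<bar>cf_eval w x - cf_eval w y\<bar> = \<bar>x - y\<bar> / (cf_denom w 1 0 x * cf_denom w 1 0 y)"
  using assms
proof (induction w)
  case (Cons a w)
  have pos: "0 < real a + cf_eval w x" "0 < real a + cf_eval w y"
    using Cons.prems cf_eval_nonneg[of x w] cf_eval_nonneg[of y w] by (auto intro: add_pos_nonneg)
  have "cf_eval (a # w) x - cf_eval (a # w) y =
      - (cf_eval w x - cf_eval w y) / ((real a + cf_eval w x) * (real a + cf_eval w y))"
    using pos by (simp add: field_simps)
  then have "\<bar>cf_eval (a # w) x - cf_eval (a # w) y\<bar> =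
      \<bar>cf_eval w x - cf_eval w y\<bar> / ((real a + cf_eval w x) * (real a + cf_eval w y))"
    using pos by (simp add: abs_mult)
  then show ?case
    using Cons by (simp add: cf_denom_Cons del: cf_denom.simps cf_eval.simps) 
qed auto

lemma cf_eval_diff_le:
  assumes "0 \<notin> set w" "0 \<le> x" "0 \<le> y"
  shows "\<bar>cf_eval w x - cf_eval w y\<bar> \<le> \<bar>x - y\<bar> / den w ^ 2"
proof -
  have "den w * den w \<le> cf_denom w 1 0 x * cf_denom w 1 0 y"
    using assms cf_denom_pos[of w 1 0 0] cf_denom_pos[of w 1 0 x]
    by (intro mult_mono cf_denom_mono) auto
  then show ?thesis
    unfolding cf_eval_diff[OF assms] power2_eq_square
    using cf_denom_pos[of w 1 0 0] assms by (intro divide_left_mono mult_pos_pos) (auto intro: cf_denom_pos)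
qed

lemma cf_eval_diff_ge:
  assumes "0 \<notin> set w" "x \<in> {0..1}" "y \<in> {0..1}"
  shows "\<bar>x - y\<bar> / (4 * den w ^ 2) \<le> \<bar>cf_eval w x - cf_eval w y\<bar>"
proof -
  have "cf_denom w 1 0 x * cf_denom w 1 0 y \<le> (2 * den w) * (2 * den w)"
    using assms cf_denom_pos[of w 1 0 0] cf_denom_pos[of w 1 0 y]
    by (intro mult_mono cf_denom_le_twice) auto
  moreover have "0 < cf_denom w 1 0 x * cf_denom w 1 0 y"
    using assms by (intro mult_pos_pos cf_denom_pos) auto
  ultimately have "\<bar>x - y\<bar> / ((2 * den w) * (2 * den w)) \<le> \<bar>x - y\<bar> / (cf_denom w 1 0 x * cf_denom w 1 0 y)"
    by (intro divide_left_mono) auto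
  then show ?thesis
    using cf_eval_diff[of w x y] assms by (simp add: power2_eq_square)
qed

section \<open>Infinite digit sequences and their values\<close>

definition prefix_word :: "(nat \<Rightarrow> nat) \<Rightarrow> nat \<Rightarrow> nat list" where
  "prefix_word b n = map b [0..<n]"

lemma length_prefix_word [simp]: "length (prefix_word b n) = n"
  by (simp add: prefix_word_def)

lemma prefix_word_Suc: "prefix_word b (Suc n) = b 0 # prefix_word (\<lambda>i. b (Suc i)) n"
  unfolding prefix_word_def by (simp add: upt_conv_Cons map_Suc_upt[symmetric] del: upt_Suc)

lemma prefix_word_Suc': "prefix_word b (Suc n) = prefix_word b n @ [b n]"
  unfolding prefix_word_def by simp

lemma prefix_word_eq_iff: "prefix_word b n = prefix_word c n \<longleftrightarrow> (\<forall>i<n. b i = c i)"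
  by (auto simp: prefix_word_def)

lemma set_prefix_word: "b \<in> digit_seqs A \<Longrightarrow> set (prefix_word b n) \<subseteq> A"
  by (auto simp: prefix_word_def digit_seqs_def)

lemma convergent_add:
  "cfrac_convergent b (n + m) = cf_eval (prefix_word b n) (cfrac_convergent (\<lambda>i. b (i + n)) m)"
proof (induction n arbitrary: b)
  case (Suc n)
  then show ?case using Suc[of "\<lambda>i. b (Suc i)"] by (simp add: prefix_word_Suc)
qed (simp add: prefix_word_def)

lemma shift_digit_seqs: "b \<in> digit_seqs A \<Longrightarrow> (\<lambda>i. b (i + n)) \<in> digit_seqs A"
  by (simp add: digit_seqs_def)

lemma convergent_bounds:
  assumes "0 \<notin> A" "b \<in> digit_seqs A"
  shows "cfrac_convergent b n \<in> {0..1}"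
proof -
  have "0 \<notin> set (prefix_word b n)" using set_prefix_word[OF assms(2)] assms(1) by blast
  then show ?thesis
    using convergent_add[of b n 0] cf_eval_nonneg[of 0 "prefix_word b n"]
      cf_eval_le_1[of "prefix_word b n" 0] by simp
qed

lemma cf_eval_diff_le_pow2:
  assumes "0 \<notin> set w" "length w = 2 * k" "x \<in> {0..1}" "y \<in> {0..1}"
  shows "\<bar>cf_eval w x - cf_eval w y\<bar> \<le> (1 / 2) ^ k"
proof -
  have d: "2 ^ k \<le> den w" using cf_denom_ge_pow2[of w 1 0] assms by simp
  have "2 ^ k * 1 \<le> den w * den w"
    using d den_ge_1[OF assms(1)] by (intro mult_mono) auto
  then have "\<bar>x - y\<bar> / den w ^ 2 \<le> 1 / 2 ^ k"
    using assms by (intro frac_le) (auto simp: power2_eq_square)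
  then show ?thesis
    using cf_eval_diff_le[of w x y] assms by (simp add: power_divide)
qed

lemma cfrac_convergent_LIMSEQ:
  assumes "0 \<notin> A" "b \<in> digit_seqs A"
  shows "cfrac_convergent b \<longlonglongrightarrow> cfrac b"
proof -
  have "Cauchy (cfrac_convergent b)"
  proof (rule CauchyI)
    fix e :: real assume "0 < e"
    then obtain k where k: "(1 / 2) ^ k < e"
      using real_arch_pow_inv[of e "1 / 2"] by auto
    have "norm (cfrac_convergent b m - cfrac_convergent b n) < e" if "2 * k \<le> m" "2 * k \<le> n" for m n
    proof -
      define w where "w = prefix_word b (2 * k)"
      have eq: "cfrac_convergent b j = cf_eval w (cfrac_convergent (\<lambda>i. b (i + 2 * k)) (j - 2 * k))"
        if "2 * k \<le> j" for j
        using convergent_add[of b "2 * k" "j - 2 * k"] that by (simp add: w_def)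
      have "0 \<notin> set w" using set_prefix_word[OF assms(2)] assms(1) unfolding w_def by blast
      then show ?thesis
        using cf_eval_diff_le_pow2[of w k "cfrac_convergent (\<lambda>i. b (i + 2 * k)) (m - 2 * k)"
            "cfrac_convergent (\<lambda>i. b (i + 2 * k)) (n - 2 * k)"] k
          convergent_bounds[OF assms(1) shift_digit_seqs[OF assms(2), of "2 * k"]]
        by (simp add: eq that) (simp add: w_def)
    qed
    then show "\<exists>M. \<forall>m\<ge>M. \<forall>n\<ge>M. norm (cfrac_convergent b m - cfrac_convergent b n) < e"
      by blast
  qed
  then show ?thesis
    unfolding cfrac_def by (simp add: Cauchy_convergent_iff convergent_LIMSEQ_iff)
qed

lemma cfrac_bounds:
  assumes "0 \<notin> A" "b \<in> digit_seqs A"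
  shows "cfrac b \<in> {0..1}"
  by (rule closed_sequentially[OF closed_atLeastAtMost convergent_bounds[OF assms]
      cfrac_convergent_LIMSEQ[OF assms]])

lemma cfrac_shift:
  assumes "0 \<notin> A" "b \<in> digit_seqs A"
  shows "cfrac b = cf_eval (prefix_word b n) (cfrac (\<lambda>i. b (i + n)))"
proof (rule LIMSEQ_unique)
  define w where "w = prefix_word b n"
  define c where "c i = b (i + n)" for i
  have w0: "0 \<notin> set w" using set_prefix_word[OF assms(2)] assms(1) unfolding w_def by blast
  have c: "c \<in> digit_seqs A" using shift_digit_seqs[OF assms(2)] by (simp add: c_def[abs_def])
  show "(\<lambda>m. cfrac_convergent b (m + n)) \<longlonglongrightarrow> cfrac b"
    using cfrac_convergent_LIMSEQ[OF assms] by (rule LIMSEQ_ignore_initial_segment)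
  have "(\<lambda>m. cf_eval w (cfrac_convergent c m) - cf_eval w (cfrac c)) \<longlonglongrightarrow> 0"
  proof (rule Lim_null_comparison)
    have le: "\<bar>cf_eval w (cfrac_convergent c m) - cf_eval w (cfrac c)\<bar> \<le> \<bar>cfrac_convergent c m - cfrac c\<bar>" for m
    proof -
      have "\<bar>cf_eval w (cfrac_convergent c m) - cf_eval w (cfrac c)\<bar> \<le> \<bar>cfrac_convergent c m - cfrac c\<bar> / den w ^ 2"
        using cf_eval_diff_le[OF w0] convergent_bounds[OF assms(1) c] cfrac_bounds[OF assms(1) c] by auto
      also have "\<dots> \<le> \<bar>cfrac_convergent c m - cfrac c\<bar> / 1"
        using den_ge_1[OF w0] by (intro divide_left_mono) (auto simp: one_le_power)
      finally show ?thesis by simp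
    qed
    then show "eventually (\<lambda>m. norm (cf_eval w (cfrac_convergent c m) - cf_eval w (cfrac c)) \<le> \<bar>cfrac_convergent c m - cfrac c\<bar>) sequentially"
      by simp
    show "(\<lambda>m. \<bar>cfrac_convergent c m - cfrac c\<bar>) \<longlonglongrightarrow> 0"
      using cfrac_convergent_LIMSEQ[OF assms(1) c] by (simp add: LIM_zero tendsto_rabs_zero)
  qed
  then have "(\<lambda>m. cf_eval w (cfrac_convergent c m)) \<longlonglongrightarrow> cf_eval w (cfrac c)"
    by (rule LIM_zero_cancel)
  then show "(\<lambda>m. cfrac_convergent b (m + n)) \<longlonglongrightarrow> cf_eval (prefix_word b n) (cfrac (\<lambda>i. b (i + n)))"
    by (simp add: add.commute[of _ n] convergent_add w_def c_def[abs_def])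
qed

section \<open>Hausdorff measure\<close>

lemma cfrac_set_eq: "cfrac_set A = cfrac ` digit_seqs A"
  by (auto simp: cfrac_set_def digit_seqs_def)

lemma diam_weight_pos_exp:
  fixes U :: "'a::metric_space set"
  assumes "s \<noteq> 0"
  shows "diam_weight s U = ennreal (diameter U powr s)"
  using assms by (auto simp: diam_weight_def)

text \<open>Cylinders of length \<open>n\<close> have diameter at most \<open>1 / den w ^ 2\<close>,
  so their total weight is bounded by word sums, which become arbitrarily small along suitable
  lengths.\<close>

lemma hausdorff_measure_upper:
  assumes "0 \<notin> A" "0 < s" "subcritical A s"
  shows "hausdorff_measure s (cfrac_set A) = 0"
proof -
  have "hausdorff_premeasure s \<delta> (cfrac_set A) \<le> 0" if \<delta>: "0 < \<delta>" for \<delta>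
  proof (rule ennreal_le_epsilon)
    fix \<epsilon> :: real assume \<epsilon>: "0 < \<epsilon>"
    obtain k where k: "(1 / 2) ^ k < \<delta>"
      using real_arch_pow_inv[OF \<delta>, of "1 / 2"] by auto
    obtain n where n: "2 * k \<le> n"
      and le: "\<And>A'. A' \<subseteq> A \<Longrightarrow> finite A' \<Longrightarrow> word_sum A' s n 1 0 \<le> \<epsilon>"
      using subcritical_decay[OF assms(1,3) _ \<epsilon>, of "2 * k"] assms(2) by auto
    define cyl where "cyl w = cfrac ` {b \<in> digit_seqs A. prefix_word b n = w}" for w
    \<comment> \<open>The cylinders of one length may be infinitely many, so
      \<open>list_decode\<close> enumerates them; indices of other words get the empty set, whose
      weight is 0.\<close>
    define U where "U i = (if list_decode i \<in> digit_words A n then cyl (list_decode i) else {})" for i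
    have cyl_diff: "\<bar>x - y\<bar> \<le> 1 / den w ^ 2" if xy: "x \<in> cyl w" "y \<in> cyl w" for x y w
    proof -
      obtain b c where bc: "b \<in> digit_seqs A" "c \<in> digit_seqs A" "prefix_word b n = w" "prefix_word c n = w"
        "x = cfrac b" "y = cfrac c"
        using xy unfolding cyl_def by blast
      have w0: "0 \<notin> set w" using set_prefix_word[OF bc(1), of n] bc(3) assms(1) by blast
      have 1: "cfrac (\<lambda>i. b (i + n)) \<in> {0..1}" "cfrac (\<lambda>i. c (i + n)) \<in> {0..1}"
        by (rule cfrac_bounds[OF assms(1) shift_digit_seqs[OF bc(1)]],
            rule cfrac_bounds[OF assms(1) shift_digit_seqs[OF bc(2)]])
      have "\<bar>x - y\<bar> \<le> \<bar>cfrac (\<lambda>i. b (i + n)) - cfrac (\<lambda>i. c (i + n))\<bar> / den w ^ 2"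
        using cf_eval_diff_le[OF w0, of "cfrac (\<lambda>i. b (i + n))" "cfrac (\<lambda>i. c (i + n))"] 1
          cfrac_shift[OF assms(1) bc(1), of n] cfrac_shift[OF assms(1) bc(2), of n] bc by simp
      also have "\<dots> \<le> 1 / den w ^ 2"
        using 1 by (intro divide_right_mono) auto
      finally show ?thesis .
    qed
    have diam: "diameter (U i) \<le> (if list_decode i \<in> digit_words A n then 1 / den (list_decode i) ^ 2 else 0)" for i
      by (auto simp: U_def intro!: diameter_le cyl_diff[unfolded real_norm_def[symmetric]])
    have small: "1 / den w ^ 2 \<le> \<delta>" if "w \<in> digit_words A n" for w
    proof -
      have w: "0 \<notin> set w" "length w = n" using that assms(1) by (auto simp: digit_words_def)
      have "2 ^ k \<le> (2::real) ^ (n div 2)" using n by (intro power_increasing) auto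
      also have "\<dots> \<le> den w" using cf_denom_ge_pow2[OF w(1), of 1 0] w(2) by simp
      finally have "2 ^ k * 1 \<le> den w * den w"
        using den_ge_1[OF w(1)] by (intro mult_mono) auto
      then have "1 / den w ^ 2 \<le> 1 / 2 ^ k"
        by (intro frac_le) (auto simp: power2_eq_square)
      then show ?thesis using k by (simp add: power_divide)
    qed
    have "U \<in> delta_covers \<delta> (cfrac_set A)"
      unfolding delta_covers_def mem_Collect_eq
    proof (intro conjI allI)
      show "cfrac_set A \<subseteq> (\<Union>i. U i)"
      proof
        fix x assume "x \<in> cfrac_set A"
        then obtain b where b: "b \<in> digit_seqs A" "x = cfrac b" by (auto simp: cfrac_set_eq)
        then have "x \<in> U (list_encode (prefix_word b n))"
          using set_prefix_word[OF b(1)] by (auto simp: U_def digit_words_def cyl_def)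
        then show "x \<in> (\<Union>i. U i)" by blast
      qed
      fix i
      have "U i \<subseteq> {0..1}"
        using cfrac_bounds[OF assms(1)] by (auto simp: U_def cyl_def)
      then show "bounded (U i)" using bounded_subset bounded_closed_interval by blast
      show "diameter (U i) \<le> \<delta>"
        using diam[of i] small \<delta> by (auto split: if_splits intro: order_trans)
    qed
    then have "hausdorff_premeasure s \<delta> (cfrac_set A) \<le> (\<Sum>i. diam_weight s (U i))"
      unfolding hausdorff_premeasure_def by (rule INF_lower)
    also have "\<dots> \<le> ennreal \<epsilon>"
    proof (rule suminf_le_const)
      fix m
      define I where "I = {i. i < m \<and> list_decode i \<in> digit_words A n}"
      \<comment> \<open>A partial sum meets finitely many words and hence a finite subalphabet, to
        which the uniform bound applies.\<close>
      define A' where "A' = (\<Union>i\<in>I. set (list_decode i))"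
      have A': "A' \<subseteq> A" "finite A'" by (auto simp: A'_def I_def digit_words_def)
      have weight: "diam_weight s (U i) \<le> ennreal (den (list_decode i) powr (-2 * s))"
        if "list_decode i \<in> digit_words A n" for i
      proof -
        have d: "1 \<le> den (list_decode i)"
          using that assms(1) by (intro den_ge_1) (auto simp: digit_words_def)
        have "diameter (U i) powr s \<le> (1 / den (list_decode i) ^ 2) powr s"
          using diam[of i] that assms(2) 
          by (intro powr_mono2) (auto simp: U_def cyl_def intro!: diameter_ge_0 bounded_subset[OF bounded_closed_interval[of 0 1]] dest: cfrac_bounds[OF assms(1)])
        also have "\<dots> = den (list_decode i) powr (-2 * s)"
          using d by (simp add: powr_divide powr_minus powr_powr powr_numeral[symmetric] field_simps del: powr_numeral)
        finally show ?thesis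
          using assms(2) by (simp add: diam_weight_pos_exp)
      qed
      have "(\<Sum>i<m. diam_weight s (U i)) = (\<Sum>i\<in>I. diam_weight s (U i))"
        by (rule sum.mono_neutral_right) (auto simp: I_def U_def diam_weight_def)
      also have "\<dots> \<le> (\<Sum>i\<in>I. ennreal (den (list_decode i) powr (-2 * s)))"
        by (intro sum_mono weight) (auto simp: I_def)
      also have "\<dots> = ennreal (\<Sum>i\<in>I. den (list_decode i) powr (-2 * s))"
        by (simp add: sum_ennreal)
      also have "(\<Sum>i\<in>I. den (list_decode i) powr (-2 * s)) = (\<Sum>w\<in>list_decode ` I. den w powr (-2 * s))"
        using inj_list_decode by (simp add: sum.reindex inj_on_def)
      also have "ennreal \<dots> \<le> ennreal (word_sum A' s n 1 0)"
        unfolding word_sum_eq_sum_words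
        by (intro ennreal_leI sum_mono2 finite_digit_words A') (auto simp: digit_words_def A'_def I_def)
      also have "\<dots> \<le> ennreal \<epsilon>" using le[OF A'] by (rule ennreal_leI)
      finally show "(\<Sum>i<m. diam_weight s (U i)) \<le> ennreal \<epsilon>" .
    qed auto
    finally show "hausdorff_premeasure s \<delta> (cfrac_set A) \<le> 0 + ennreal \<epsilon>" by simp
  qed
  then show ?thesis unfolding hausdorff_measure_def by (simp add: SUP_eq_const)
qed

section \<open>From covers to prefix sets\<close>

text \<open>Even adjacent digits are separated: \<open>b 0 + x \<le> c 0\<close>, while
  \<open>c 0 + y\<close> exceeds \<open>c 0\<close> by at least \<open>1 / (M + 1)\<close>. Here
  bounded digits matter, since otherwise \<open>y\<close> could be arbitrarily small.\<close>

lemma cfrac_separated: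
  assumes "0 \<notin> A" "\<And>a. a \<in> A \<Longrightarrow> a \<le> M" "b \<in> digit_seqs A" "c \<in> digit_seqs A" "b 0 < c 0"
  shows "1 / (real M + 1) ^ 3 \<le> \<bar>cfrac b - cfrac c\<bar>"
proof -
  define x where "x = cfrac (\<lambda>i. b (i + 1))"
  define y where "y = cfrac (\<lambda>i. c (i + 1))"
  have x: "0 \<le> x" "x \<le> 1" and y: "0 \<le> y" "y \<le> 1"
    using cfrac_bounds[OF assms(1) shift_digit_seqs[OF assms(3), of 1]]
      cfrac_bounds[OF assms(1) shift_digit_seqs[OF assms(4), of 1]] by (auto simp: x_def y_def)
  have b: "1 \<le> real (b 0)" "real (c 0) \<le> M" "real (c 0) - real (b 0) \<ge> 1"
    using assms digit_ge_1[OF assms(1)] by (auto simp: digit_seqs_def)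
  have y_ge: "1 / (real M + 1) \<le> y"
  proof -
    have z: "cfrac (\<lambda>i. c (i + 1 + 1)) \<in> {0..1}"
      using cfrac_bounds[OF assms(1) shift_digit_seqs[OF shift_digit_seqs[OF assms(4), of 1], of 1]] by (simp add: ac_simps)
    have "y = 1 / (real (c 1) + cfrac (\<lambda>i. c (i + 1 + 1)))"
      using cfrac_shift[OF assms(1) shift_digit_seqs[OF assms(4), of 1], of 1]
      by (simp add: y_def prefix_word_def)
    also have "\<dots> \<ge> 1 / (real M + 1)"
      using z assms(2,4) digit_ge_1[OF assms(1), of "c 1"] by (intro frac_le) (auto simp: digit_seqs_def intro!: add_mono)
    finally show ?thesis .
  qed
  have eq: "cfrac b = 1 / (real (b 0) + x)" "cfrac c = 1 / (real (c 0) + y)"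
    using cfrac_shift[OF assms(1,3), of 1] cfrac_shift[OF assms(1,4), of 1]
    by (simp_all add: x_def y_def prefix_word_def)
  have pos: "0 < real (b 0) + x" "0 < real (c 0) + y" using b x y by linarith+
  have "cfrac b - cfrac c = (real (c 0) - real (b 0) + y - x) / ((real (b 0) + x) * (real (c 0) + y))"
    unfolding eq using pos by (simp add: field_simps)
  also have "\<dots> \<ge> (1 / (real M + 1)) / ((real M + 1) * (real M + 1))"
  proof (rule frac_le)
    show "1 / (real M + 1) \<le> real (c 0) - real (b 0) + y - x" using b x y_ge by linarith
    show "0 \<le> real (c 0) - real (b 0) + y - x" using b x y by linarith
    show "(real (b 0) + x) * (real (c 0) + y) \<le> (real M + 1) * (real M + 1)"
      using b x y pos by (intro mult_mono) auto
    show "0 < (real (b 0) + x) * (real (c 0) + y)" using pos by simp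
  qed
  finally show ?thesis by (simp add: power3_eq_cube mult.assoc)
qed

text \<open>This is Koenig's lemma.\<close>

lemma uniform_prefix_bound:
  assumes "finite A" "\<And>b. b \<in> digit_seqs A \<Longrightarrow> \<exists>n. prefix_word b n \<in> C"
  obtains L where "\<And>v. v \<in> digit_words A L \<Longrightarrow> \<exists>n. take n v \<in> C"
proof (rule ccontr)
  define bad where "bad v \<longleftrightarrow> (\<forall>L. \<exists>u\<in>digit_words A L. \<forall>n. take n (v @ u) \<notin> C)" for v
  assume "\<not> thesis"
  then have "\<exists>v\<in>digit_words A L. \<forall>n. take n v \<notin> C" for L
    using that by blast
  then have bad_Nil: "bad []" by (simp add: bad_def)
  have step: "\<exists>a\<in>A. bad (v @ [a])" if "bad v" for v
  proof (rule ccontr)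
    assume "\<not> ?thesis"
    then have "\<forall>a\<in>A. \<exists>L. \<forall>u\<in>digit_words A L. \<exists>n. take n (v @ a # u) \<in> C"
      by (auto simp: bad_def)
    then obtain L where L: "\<And>a u. a \<in> A \<Longrightarrow> u \<in> digit_words A (L a) \<Longrightarrow> \<exists>n. take n (v @ a # u) \<in> C"
      by metis
    \<comment> \<open>Finitely many letters have a common length bound. A bad extension of that
      length contradicts the bound belonging to its own first letter.\<close>
    obtain w where w: "w \<in> digit_words A (Suc (Max (insert 0 (L ` A))))" "\<And>n. take n (v @ w) \<notin> C"
      using \<open>bad v\<close> unfolding bad_def by blast
    then obtain a u where au: "w = a # u" "a \<in> A" "set u \<subseteq> A" "length u = Max (insert 0 (L ` A))"
      by (auto simp: digit_words_def length_Suc_conv)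
    have "L a \<le> length u" using au assms(1) by auto
    then have "take (L a) u \<in> digit_words A (L a)"
      using au(3) set_take_subset[of "L a" u] by (auto simp: digit_words_def)
    then obtain n where "take n (v @ a # take (L a) u) \<in> C" using L[OF au(2)] by blast
    also have "v @ a # take (L a) u = take (length v + Suc (L a)) (v @ w)"
      by (simp add: au(1))
    finally show False unfolding take_take using w(2) by blast
  qed
  have "\<exists>f. \<forall>n. (bad (f n) \<and> f n \<in> digit_words A n) \<and> (\<exists>a. f (Suc n) = f n @ [a])"
  proof (rule dependent_nat_choice)
    show "\<exists>x. bad x \<and> x \<in> digit_words A 0" using bad_Nil by (auto simp: digit_words_def)
    fix v n assume "bad v \<and> v \<in> digit_words A n"
    moreover from this obtain a where "a \<in> A" "bad (v @ [a])" using step by blast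
    ultimately show "\<exists>y. (bad y \<and> y \<in> digit_words A (Suc n)) \<and> (\<exists>a. y = v @ [a])"
      by (intro exI[of _ "v @ [a]"]) (auto simp: digit_words_def)
  qed
  then obtain f where f: "\<And>n. bad (f n)" "\<And>n. f n \<in> digit_words A n" "\<And>n. \<exists>a. f (Suc n) = f n @ [a]"
    by blast
  then obtain b where b: "\<And>n. f (Suc n) = f n @ [b n]" by metis
  have pre: "prefix_word b n = f n" for n
  proof (induction n)
    case 0
    then show ?case using f(2)[of 0] by (simp add: digit_words_def prefix_word_def)
  next
    case (Suc n)
    then show ?case by (simp add: b prefix_word_Suc')
  qed
  have "b \<in> digit_seqs A"
    using f(2) by (force simp: digit_seqs_def digit_words_def b dest: spec[of _ "Suc _"])
  then obtain n where "f n \<in> C" using assms(2) pre by metis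
  moreover have "take n (f n) = f n" using f(2)[of n] by (simp add: digit_words_def)
  moreover have "\<forall>m. take m (f n) \<notin> C"
    using f(1)[of n] unfolding bad_def by (auto simp: digit_words_def dest: spec[of _ 0])
  ultimately show False by metis
qed

text \<open>Cutting off an initial piece from \<open>C\<close> gives a renewal inequality that
  bounds \<open>Z n\<close> by the weighted sum of \<open>Z (n - length w)\<close> over
  \<open>w\<close> in \<open>C\<close>. The weights add up to \<open>c < 1\<close> and the pieces
  have length at most \<open>L\<close>, so \<open>Z n\<close> decays like
  \<open>c ^ (n div L)\<close>. Words with several such cuts are overcounted, which only enlarges
  the right side.\<close>

lemma subcritical_prefix_set:
  assumes "0 \<notin> A" "finite A" "0 \<le> s" "finite C" "0 < L"
    and C: "\<And>w. w \<in> C \<Longrightarrow> set w \<subseteq> A \<and> length w \<le> L"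
    and cover: "\<And>v. v \<in> digit_words A L \<Longrightarrow> \<exists>n. take n v \<in> C"
    and less: "(\<Sum>w\<in>C. den w powr (-2 * s)) < 1"
  shows "subcritical A s"
proof -
  define c where "c = (\<Sum>w\<in>C. den w powr (-2 * s))"
  have c: "0 \<le> c" "c < 1" using less by (auto simp: c_def intro: sum_nonneg)
  define Z where "Z n = word_sum A s n 1 0" for n
  have Z0: "0 \<le> Z n" for n unfolding Z_def by (rule cf_sum_nonneg) simp
  have rec: "Z n \<le> (\<Sum>w\<in>C. den w powr (-2 * s) * Z (n - length w))" if "L \<le> n" for n
  proof -
    define D where "D = Sigma C (\<lambda>w. digit_words A (n - length w))"
    have D: "finite D" unfolding D_def using assms finite_digit_words by auto
    have "digit_words A n \<subseteq> (\<lambda>(w, u). w @ u) ` D"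
    proof
      fix v assume v: "v \<in> digit_words A n"
      then have "take L v \<in> digit_words A L"
        using that set_take_subset[of L v] by (auto simp: digit_words_def)
      then obtain m where "take m (take L v) \<in> C" using cover by blast
      then have m: "take (min m L) v \<in> C" by (simp add: take_take)
      have "(take (min m L) v, drop (min m L) v) \<in> D"
        using v m that set_drop_subset[of "min m L" v] by (auto simp: D_def digit_words_def)
      then show "v \<in> (\<lambda>(w, u). w @ u) ` D" by (force simp: image_iff)
    qed
    then have "Z n \<le> (\<Sum>v\<in>(\<lambda>(w, u). w @ u) ` D. den v powr (-2 * s))"
      unfolding Z_def word_sum_eq_sum_words using D by (intro sum_mono2) auto
    also have "\<dots> \<le> (\<Sum>x\<in>D. den (fst x @ snd x) powr (-2 * s))"
      using sum_image_le[of D "\<lambda>v. den v powr (-2 * s)" "\<lambda>(w, u). w @ u"] D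
      by (simp add: o_def case_prod_unfold)
    also have "\<dots> \<le> (\<Sum>x\<in>D. den (fst x) powr (-2 * s) * den (snd x) powr (-2 * s))"
    proof (rule sum_mono)
      fix x assume "x \<in> D"
      then have n0: "0 \<notin> set (fst x)" "0 \<notin> set (snd x)"
        using C[of "fst x"] assms(1) by (auto simp: D_def digit_words_def)
      note g = den_ge_1[OF n0(1)] den_ge_1[OF n0(2)]
      have "den (fst x @ snd x) powr (-2 * s) \<le> (den (fst x) * den (snd x)) powr (-2 * s)"
        using den_append_ge[of "fst x" "snd x"] n0 g assms(3) by (intro powr_mono2') auto
      then show "den (fst x @ snd x) powr (-2 * s) \<le> den (fst x) powr (-2 * s) * den (snd x) powr (-2 * s)"
        using g by (simp add: powr_mult)
    qed
    also have "\<dots> = (\<Sum>w\<in>C. \<Sum>u\<in>digit_words A (n - length w). den w powr (-2 * s) * den u powr (-2 * s))"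
      unfolding D_def using assms finite_digit_words by (subst sum.Sigma) (auto simp: case_prod_unfold)
    finally show ?thesis by (simp add: Z_def word_sum_eq_sum_words sum_distrib_left)
  qed
  define K where "K = (\<Sum>j<L. Z j)"
  have K: "Z j \<le> K" if "j < L" for j
    unfolding K_def using that Z0 by (intro member_le_sum) auto
  have K0: "0 \<le> K" unfolding K_def using Z0 by (intro sum_nonneg) auto
  have decay: "Z n \<le> K * c ^ (n div L)" for n
  proof (induction n rule: less_induct)
    case (less n)
    show ?case
    proof (cases "n < L")
      case True
      then show ?thesis using K by simp
    next
      case False
      \<comment> \<open>The empty word alone would have weight 1, which \<open>c < 1\<close>
        excludes; hence every piece shortens the word and the induction applies.\<close>
      have len: "0 < length w" if "w \<in> C" for w
      proof (rule ccontr)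
        assume "\<not> ?thesis"
        then have "[] \<in> C" using that by simp
        then have "den [] powr (-2 * s) \<le> c"
          unfolding c_def using assms(4) by (intro member_le_sum) auto
        with c show False by simp
      qed
      have "Z n \<le> (\<Sum>w\<in>C. den w powr (-2 * s) * Z (n - length w))" using rec False by simp
      also have "\<dots> \<le> (\<Sum>w\<in>C. den w powr (-2 * s) * (K * c ^ (n div L - 1)))"
      proof (intro sum_mono mult_left_mono)
        fix w assume w: "w \<in> C"
        have "Z (n - length w) \<le> K * c ^ ((n - length w) div L)"
          using len[OF w] False assms(5) by (intro less) auto
        also have "\<dots> \<le> K * c ^ (n div L - 1)"
        proof (intro mult_left_mono power_decreasing K0)
          have "(n - L) div L \<le> (n - length w) div L"
            using C[OF w] by (intro div_le_mono) auto
          then show "n div L - 1 \<le> (n - length w) div L"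
            using False assms(5) by (simp add: le_div_geq)
        qed (use c in auto)
        finally show "Z (n - length w) \<le> K * c ^ (n div L - 1)" .
      qed auto
      also have "\<dots> = K * (c * c ^ (n div L - 1))"
        unfolding sum_distrib_right[symmetric] c_def[symmetric] by (rule mult.left_commute)
      also have "c * c ^ (n div L - 1) = c ^ (n div L)"
        using False assms(5) by (simp flip: power_Suc add: div_greater_zero_iff)
      finally show ?thesis .
    qed
  qed
  have "0 < 1 / (K + 1)" using K0 by simp
  then obtain m where m: "c ^ m < 1 / (K + 1)" using real_arch_pow_inv c(2) by blast
  have "c ^ Suc m \<le> c ^ m" using c by (intro power_decreasing) auto
  with m have m': "c ^ Suc m < 1 / (K + 1)" by simp
  have "Z (L * Suc m) \<le> K * c ^ Suc m" using decay[of "L * Suc m"] assms(5) by simp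
  also have "\<dots> \<le> K * (1 / (K + 1))" using K0 m' by (intro mult_left_mono) auto
  also have "\<dots> < 1" using K0 by simp
  finally show ?thesis
    using subcritical_finite_iff[OF assms(1-3)] assms(5) unfolding Z_def by (metis nat_0_less_mult_iff zero_less_Suc)
qed

lemma den_arbitrarily_large:
  assumes "0 \<notin> A" "b \<in> digit_seqs A" "0 < s" "0 < (\<theta>::real)"
  obtains n where "den (prefix_word b n) powr (-2 * s) \<le> \<theta>"
proof -
  obtain k :: nat where k: "1 / \<theta> \<le> (2 ^ k) powr (2 * s)"
    using pow2_powr_unbounded[of "2 * s"] assms(3) by auto
  have w: "0 \<notin> set (prefix_word b (2 * k))" using set_prefix_word[OF assms(2)] assms(1) by blast
  have "den (prefix_word b (2 * k)) powr (-2 * s) \<le> (2 ^ k) powr (-2 * s)"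
    using cf_denom_ge_pow2[OF w, of 1 0] assms(3) by (intro powr_mono2') auto
  also have "\<dots> = 1 / (2 ^ k) powr (2 * s)" by (simp add: powr_minus_divide)
  also have "\<dots> \<le> 1 / (1 / \<theta>)" using k assms(4) by (intro frac_le) auto
  finally show ?thesis using that by simp
qed

text \<open>A set containing two points of the limit set is comparable in diameter to the longest
  cylinder containing all its points.\<close>

lemma cylinder_for_set:
  fixes U :: "real set"
  assumes "0 \<notin> A" "a0 \<in> A" "\<And>a. a \<in> A \<Longrightarrow> a \<le> M" "0 < s" "0 < (\<theta>::real)" "bounded U"
  obtains w where "set w \<subseteq> A"
    "\<And>b. b \<in> digit_seqs A \<Longrightarrow> cfrac b \<in> U \<Longrightarrow> prefix_word b (length w) = w"
    "den w powr (-2 * s) \<le> (4 * (real M + 1) ^ 3) powr s * diameter U powr s + \<theta>"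
proof (cases "\<exists>n. \<exists>b\<in>digit_seqs A. \<exists>c\<in>digit_seqs A. cfrac b \<in> U \<and> cfrac c \<in> U \<and> b n \<noteq> c n")
  case True
  define differ where "differ n \<longleftrightarrow> (\<exists>b\<in>digit_seqs A. \<exists>c\<in>digit_seqs A. cfrac b \<in> U \<and> cfrac c \<in> U \<and> b n < c n)" for n
  have differI: "differ n" if "b \<in> digit_seqs A" "c \<in> digit_seqs A" "cfrac b \<in> U" "cfrac c \<in> U" "b n \<noteq> c n" for b c n
    using that unfolding differ_def by (cases "b n < c n") (auto simp: not_less_iff_gr_or_eq)
  define n where "n = (LEAST n. differ n)"
  have "\<exists>n. differ n" using True differI by blast
  then have "differ n" unfolding n_def by (rule LeastI_ex)
  then obtain b c where bc: "b \<in> digit_seqs A" "c \<in> digit_seqs A" "cfrac b \<in> U" "cfrac c \<in> U" "b n < c n"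
    unfolding differ_def by blast
  have agree: "d m = e m" if de: "d \<in> digit_seqs A" "e \<in> digit_seqs A" "cfrac d \<in> U" "cfrac e \<in> U" "m < n" for d e m
  proof (rule ccontr)
    assume "d m \<noteq> e m"
    then have "differ m" using de(1-4) by (intro differI)
    with de(5) show False using not_less_Least[of m differ] by (simp add: n_def)
  qed
  define w where "w = prefix_word b n"
  have w: "set w \<subseteq> A" "0 \<notin> set w"
    using set_prefix_word[OF bc(1)] assms(1) unfolding w_def by blast+
  define x where "x = cfrac (\<lambda>i. b (i + n))"
  define y where "y = cfrac (\<lambda>i. c (i + n))"
  have xy: "x \<in> {0..1}" "y \<in> {0..1}" unfolding x_def y_def
    by (rule cfrac_bounds[OF assms(1) shift_digit_seqs[OF bc(1)]],
        rule cfrac_bounds[OF assms(1) shift_digit_seqs[OF bc(2)]])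
  have "prefix_word c n = w"
    unfolding w_def prefix_word_eq_iff using agree[OF bc(2,1,4,3)] by simp
  then have ev: "cfrac b = cf_eval w x" "cfrac c = cf_eval w y"
    using cfrac_shift[OF assms(1) bc(1), of n] cfrac_shift[OF assms(1) bc(2), of n]
    by (simp_all add: w_def x_def y_def)
  have d1: "1 \<le> den w" using w den_ge_1 by blast
  have "1 / (real M + 1) ^ 3 \<le> \<bar>x - y\<bar>"
    unfolding x_def y_def using bc(5)
    by (intro cfrac_separated[OF assms(1,3) shift_digit_seqs[OF bc(1)] shift_digit_seqs[OF bc(2)]]) auto
  then have "(1 / (real M + 1) ^ 3) / (4 * den w ^ 2) \<le> \<bar>x - y\<bar> / (4 * den w ^ 2)"
    by (intro divide_right_mono) auto
  also have "\<dots> \<le> \<bar>cfrac b - cfrac c\<bar>" unfolding ev by (rule cf_eval_diff_ge[OF w(2) xy])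
  also have "\<dots> \<le> diameter U"
    using diameter_bounded_bound[OF assms(6) bc(3,4)] by (simp add: dist_real_def)
  finally have "1 / (real M + 1) ^ 3 / (4 * den w ^ 2) * (4 * (real M + 1) ^ 3) \<le> diameter U * (4 * (real M + 1) ^ 3)"
    by (rule mult_right_mono) auto
  moreover have "(real M + 1) ^ 3 \<noteq> 0" by (simp add: add_nonneg_eq_0_iff)
  ultimately have "1 / den w ^ 2 \<le> (4 * (real M + 1) ^ 3) * diameter U"
    by (simp add: mult.commute)
  then have "(1 / den w ^ 2) powr s \<le> ((4 * (real M + 1) ^ 3) * diameter U) powr s"
    using assms(4) by (intro powr_mono2) auto
  also have "\<dots> = (4 * (real M + 1) ^ 3) powr s * diameter U powr s"
    using diameter_ge_0[OF assms(6)] by (intro powr_mult) 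
  also have "(1 / den w ^ 2) powr s = den w powr (-2 * s)"
  proof -
    have "den w ^ 2 = den w powr 2" using d1 by simp
    then have "(den w ^ 2) powr s = den w powr (2 * s)" by (simp only: powr_powr)
    then show ?thesis using d1 by (simp add: powr_divide powr_minus_divide)
  qed
  finally have "den w powr (-2 * s) \<le> (4 * (real M + 1) ^ 3) powr s * diameter U powr s + \<theta>"
    using assms(5) by simp
  moreover have "prefix_word d (length w) = w" if "d \<in> digit_seqs A" "cfrac d \<in> U" for d
    using agree[OF that(1) bc(1) that(2) bc(3)] by (simp add: w_def prefix_word_eq_iff)
  ultimately show ?thesis using that w(1) by blast
next
  case False
  \<comment> \<open>At most one sequence has its value in \<open>U\<close>, so the diameter may be 0
    and gives no lower bound; a prefix of weight at most \<open>\<theta>\<close> is used instead. If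
    there is no such sequence, a constant one serves.\<close>
  obtain b where b: "b \<in> digit_seqs A" "\<And>c. c \<in> digit_seqs A \<Longrightarrow> cfrac c \<in> U \<Longrightarrow> c = b"
  proof (cases "\<exists>b\<in>digit_seqs A. cfrac b \<in> U")
    case True
    then obtain b where b: "b \<in> digit_seqs A" "cfrac b \<in> U" by blast
    have "c = b" if "c \<in> digit_seqs A" "cfrac c \<in> U" for c
      by (rule ext) (use False b that in blast)
    then show ?thesis using that[OF b(1)] by blast
  next
    case False
    moreover have "(\<lambda>_. a0) \<in> digit_seqs A" using assms(2) by (simp add: digit_seqs_def)
    ultimately show ?thesis using that by blast
  qed
  obtain n where n: "den (prefix_word b n) powr (-2 * s) \<le> \<theta>"
    using den_arbitrarily_large[OF assms(1) b(1) assms(4,5)] by blast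
  show ?thesis
  proof (rule that[of "prefix_word b n"])
    show "set (prefix_word b n) \<subseteq> A" by (rule set_prefix_word[OF b(1)])
    show "prefix_word c (length (prefix_word b n)) = prefix_word b n"
      if "c \<in> digit_seqs A" "cfrac c \<in> U" for c using b(2)[OF that] by simp
    have "0 \<le> (4 * (real M + 1) ^ 3) powr s * diameter U powr s" by simp
    with n show "den (prefix_word b n) powr (-2 * s) \<le> (4 * (real M + 1) ^ 3) powr s * diameter U powr s + \<theta>"
      by linarith
  qed
qed

text \<open>Every covering set is replaced by a cylinder at the cost of a factor \<open>K\<close>
  and a slack. The cover is taken with total weight below \<open>1 / (4 * K)\<close> and the slacks
  \<open>(1 / 2) ^ i / 8\<close> add up to at most 1/4, so the cylinders have total weight at most
  1/2.\<close>

lemma subcritical_of_hausdorff_zero: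
  assumes "0 \<notin> A" "finite A" "0 < s" "hausdorff_measure s (cfrac_set A) = 0"
  shows "subcritical A s"
proof (cases "A = {}")
  case True
  then show ?thesis using subcritical_finite_iff[of A s] assms by (auto intro!: exI[of _ 1])
next
  case False
  then obtain a0 where a0: "a0 \<in> A" by blast
  define M where "M = Max A"
  have M: "a \<le> M" if "a \<in> A" for a using that assms(2) by (simp add: M_def)
  define K where "K = (4 * (real M + 1) ^ 3) powr s"
  have K: "0 < K" by (simp add: K_def)
  have "hausdorff_premeasure s 1 (cfrac_set A) \<le> hausdorff_measure s (cfrac_set A)"
    unfolding hausdorff_measure_def by (rule SUP_upper) auto
  then have "hausdorff_premeasure s 1 (cfrac_set A) < ennreal (1 / (4 * K))"
    using assms(4) K by (simp add: ennreal_zero_less_divide)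
  then obtain U where U: "U \<in> delta_covers 1 (cfrac_set A)" "(\<Sum>i. diam_weight s (U i)) < ennreal (1 / (4 * K))"
    unfolding hausdorff_premeasure_def by (auto simp: INF_less_iff)
  have Ub: "bounded (U i)" for i using U(1) by (simp add: delta_covers_def)
  have diam_sum: "(\<Sum>i\<in>I. diameter (U i) powr s) \<le> 1 / (4 * K)" if "finite I" for I
  proof -
    have "ennreal (\<Sum>i\<in>I. diameter (U i) powr s) = (\<Sum>i\<in>I. diam_weight s (U i))"
      using assms(3) by (simp add: diam_weight_pos_exp sum_ennreal)
    also have "\<dots> \<le> (\<Sum>i. diam_weight s (U i))" using that by (intro sum_le_suminf) auto
    also have "\<dots> < ennreal (1 / (4 * K))" by (rule U(2))
    finally show ?thesis using K by (auto simp: ennreal_less_iff sum_nonneg)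
  qed
  have "\<exists>w. set w \<subseteq> A \<and> (\<forall>b\<in>digit_seqs A. cfrac b \<in> U i \<longrightarrow> prefix_word b (length w) = w) \<and>
    den w powr (-2 * s) \<le> K * diameter (U i) powr s + (1 / 2) ^ i / 8" for i
    using cylinder_for_set[OF assms(1) a0 M assms(3) _ Ub[of i], of "(1 / 2) ^ i / 8"]
    unfolding K_def by (metis divide_pos_pos zero_less_numeral zero_less_power half_gt_zero zero_less_one)
  then obtain W where W: "\<And>i. set (W i) \<subseteq> A"
    "\<And>i b. b \<in> digit_seqs A \<Longrightarrow> cfrac b \<in> U i \<Longrightarrow> prefix_word b (length (W i)) = W i"
    "\<And>i. den (W i) powr (-2 * s) \<le> K * diameter (U i) powr s + (1 / 2) ^ i / 8"
    by metis
  have "\<exists>n. prefix_word b n \<in> range W" if b: "b \<in> digit_seqs A" for b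
  proof -
    have "cfrac b \<in> cfrac_set A" using b by (simp add: cfrac_set_eq)
    then obtain i where "cfrac b \<in> U i" using U(1) by (auto simp: delta_covers_def)
    then show ?thesis using W(2)[OF b] by (metis rangeI)
  qed
  then obtain L where L: "\<And>v. v \<in> digit_words A L \<Longrightarrow> \<exists>n. take n v \<in> range W"
    using uniform_prefix_bound[OF assms(2), of "range W"] by blast
  \<comment> \<open>\<open>range W\<close> may be infinite, but by compactness words of length at
    most \<open>L\<close> suffice. \<open>Suc\<close> makes the length bound positive, since
    \<open>L\<close> may be 0.\<close>
  define C where "C = {w \<in> range W. length w \<le> Suc L}"
  have C_fin: "finite C"
  proof (rule finite_subset)
    show "C \<subseteq> {w. set w \<subseteq> A \<and> length w \<le> Suc L}" using W(1) by (auto simp: C_def)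
    show "finite {w. set w \<subseteq> A \<and> length w \<le> Suc L}" using assms(2) by (rule finite_lists_length_le)
  qed
  \<comment> \<open>Each word is charged to one covering set, so that a word arising from several of
    them is counted once.\<close>
  define idx where "idx w = (SOME i. W i = w)" for w
  have idx: "W (idx w) = w" if "w \<in> C" for w
    using that unfolding idx_def C_def by (auto intro: someI)
  have inj: "inj_on idx C" by (rule inj_onI) (metis idx)
  show ?thesis
  proof (rule subcritical_prefix_set[OF assms(1,2) _ C_fin, of s "Suc L"])
    show "set w \<subseteq> A \<and> length w \<le> Suc L" if "w \<in> C" for w
      using that W(1) by (auto simp: C_def)
    fix v assume v: "v \<in> digit_words A (Suc L)"
    then have "take L v \<in> digit_words A L"
      using set_take_subset[of L v] by (auto simp: digit_words_def)
    then obtain n where "take n (take L v) \<in> range W" using L by blast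
    then have "take (min n L) v \<in> C" using v by (auto simp: C_def take_take digit_words_def)
    then show "\<exists>n. take n v \<in> C" by blast
  next
    have fin: "finite (idx ` C)" using C_fin by simp
    have "(\<Sum>w\<in>C. den w powr (-2 * s)) = (\<Sum>i\<in>idx ` C. den (W i) powr (-2 * s))"
      using inj idx by (simp add: sum.reindex)
    also have "\<dots> \<le> (\<Sum>i\<in>idx ` C. K * diameter (U i) powr s + (1 / 2) ^ i / 8)"
      by (intro sum_mono W(3))
    also have "\<dots> = K * (\<Sum>i\<in>idx ` C. diameter (U i) powr s) + (\<Sum>i\<in>idx ` C. (1 / 2) ^ i) / 8"
      by (simp add: sum.distrib sum_distrib_left sum_divide_distrib)
    also have "\<dots> \<le> K * (1 / (4 * K)) + 2 / 8"
    proof (intro add_mono mult_left_mono divide_right_mono diam_sum fin)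
      have "(\<Sum>i\<in>idx ` C. (1 / 2) ^ i) \<le> (\<Sum>i. (1 / 2 :: real) ^ i)"
        using fin by (intro sum_le_suminf summable_geometric) auto
      then show "(\<Sum>i\<in>idx ` C. (1 / 2 :: real) ^ i) \<le> 2"
        using suminf_geometric[of "1 / 2 :: real"] by simp
    qed (use K in auto)
    finally show "(\<Sum>w\<in>C. den w powr (-2 * s)) < 1" using K by simp
  qed (use assms in auto)
qed

section \<open>Hausdorff dimension as critical exponent\<close>

lemma hausdorff_measure_mono:
  assumes "A \<subseteq> B"
  shows "hausdorff_measure s A \<le> hausdorff_measure s B"
  unfolding hausdorff_measure_def hausdorff_premeasure_def
proof (rule SUP_mono)
  fix \<delta> :: real assume "\<delta> \<in> {0<..}"
  moreover have "(INF U\<in>delta_covers \<delta> A. \<Sum>i. diam_weight s (U i)) \<le> (INF U\<in>delta_covers \<delta> B. \<Sum>i. diam_weight s (U i))"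
    using assms by (intro INF_superset_mono) (auto simp: delta_covers_def)
  ultimately show "\<exists>m\<in>{0<..}. (INF U\<in>delta_covers \<delta> A. \<Sum>i. diam_weight s (U i)) \<le> (INF U\<in>delta_covers m B. \<Sum>i. diam_weight s (U i))"
    by blast
qed

lemma hausdorff_measure_0_empty:
  fixes A :: "'a::metric_space set"
  assumes "hausdorff_measure 0 A = 0"
  shows "A = {}"
proof -
  have "hausdorff_premeasure 0 1 A \<le> hausdorff_measure 0 A"
    unfolding hausdorff_measure_def by (rule SUP_upper) auto
  then have "hausdorff_premeasure 0 1 A < 1" using assms by simp
  then obtain U where U: "U \<in> delta_covers 1 A" "(\<Sum>i. diam_weight 0 (U i)) < 1"
    unfolding hausdorff_premeasure_def by (auto simp: INF_less_iff)
  have "U i = {}" for i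
  proof (rule ccontr)
    assume "U i \<noteq> {}"
    then have "1 = (\<Sum>i\<in>{i}. diam_weight 0 (U i))" by (simp add: diam_weight_def)
    also have "\<dots> \<le> (\<Sum>i. diam_weight 0 (U i))" by (intro sum_le_suminf) auto
    finally show False using U(2) by simp
  qed
  then show ?thesis using U(1) by (auto simp: delta_covers_def)
qed

lemma crit_exp_empty: "crit_exp {} = 0"
proof (rule antisym)
  show "crit_exp {} \<le> 0"
  proof (rule field_le_epsilon)
    fix e :: real assume "0 < e"
    moreover have "subcritical {} e"
      using subcritical_finite_iff[of "{}" e] \<open>0 < e\<close> by (auto intro!: exI[of _ 1])
    ultimately show "crit_exp {} \<le> 0 + e" using crit_exp_le[of e "{}"] by simp
  qed
qed (simp add: crit_exp_nonneg)

text \<open>The lower bound passes to finite subalphabets, where covers turn into prefix sets.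
  Exponent 0 is treated separately because \<open>crit_exp\<close> only sees positive exponents;
  there a null set is empty, and so is its alphabet.\<close>

theorem hausdorff_dim_cfrac_set:
  assumes "0 \<notin> A"
  shows "hausdorff_dim (cfrac_set A) = crit_exp A"
proof (rule antisym)
  have bdd: "bdd_below {s. 0 \<le> s \<and> hausdorff_measure s (cfrac_set A) = 0}"
    by (rule bdd_belowI[of _ 0]) auto
  show "hausdorff_dim (cfrac_set A) \<le> crit_exp A"
    unfolding crit_exp_def
  proof (rule cInf_greatest[OF crit_exp_set_nonempty[OF assms]])
    fix s assume "s \<in> {s. 0 < s \<and> subcritical A s}"
    then show "hausdorff_dim (cfrac_set A) \<le> s"
      unfolding hausdorff_dim_def using hausdorff_measure_upper[OF assms]
      by (intro cInf_lower[OF _ bdd]) auto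
  qed
  show "crit_exp A \<le> hausdorff_dim (cfrac_set A)"
    unfolding hausdorff_dim_def
  proof (rule cInf_greatest)
    show "{s. 0 \<le> s \<and> hausdorff_measure s (cfrac_set A) = 0} \<noteq> {}"
      using hausdorff_measure_upper[OF assms _ subcritical_gt_1[OF assms, of 2]] by force
    fix s assume s: "s \<in> {s. 0 \<le> s \<and> hausdorff_measure s (cfrac_set A) = 0}"
    show "crit_exp A \<le> s"
    proof (rule crit_exp_le_finite[OF assms])
      fix A' assume A': "A' \<subseteq> A" "finite A'"
      have "cfrac_set A' \<subseteq> cfrac_set A" using A'(1) unfolding cfrac_set_def by blast
      then have zero: "hausdorff_measure s (cfrac_set A') = 0"
        using hausdorff_measure_mono[of "cfrac_set A'" "cfrac_set A" s] s by simp
      show "crit_exp A' \<le> s"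
      proof (cases "s = 0")
        case True
        then have "cfrac_set A' = {}" using zero hausdorff_measure_0_empty by blast
        then have "A' = {}" by (auto simp: cfrac_set_def)
        then show ?thesis using True crit_exp_empty by simp
      next
        case False
        then show ?thesis
          using A' assms s zero by (intro crit_exp_le subcritical_of_hausdorff_zero) auto
      qed
    qed
  qed
qed

section \<open>Exhausting and separating dimensions\<close>

text \<open>There is one word of each length, so the sum at exponent 0 is always 1, and a positive
  exponent lowers it below any bound as the length grows.\<close>

lemma subcritical_singleton:
  assumes "0 < a" "0 < s"
  shows "subcritical {a} s"
proof -
  obtain n :: nat where n: "0 < n" "2 \<le> (2 ^ n) powr (2 * s)"
    using pow2_powr_unbounded[of "2 * s"] assms by auto
  have zero: "word_sum {a} 0 m p q = 1" if "0 < p" "0 \<le> q" for m p q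
    using that assms(1) by (induction m arbitrary: p q) (auto simp: add_pos_nonneg)
  have "2 * word_sum {a} s (2 * n) 1 0 \<le> (2 ^ n * 1) powr (2 * (s - 0)) * word_sum {a} s (2 * n) 1 0"
    using n by (intro mult_right_mono cf_sum_nonneg) auto
  also have "\<dots> \<le> word_sum {a} 0 (2 * n) 1 0"
    using assms by (intro cf_sum_gap) auto
  also have "\<dots> = 1" by (rule zero) auto
  finally have "word_sum {a} s (2 * n) 1 0 < 1" by simp
  moreover have "0 < 2 * n" using n by simp
  ultimately show ?thesis
    using subcritical_finite_iff[of "{a}" s] assms by (metis empty_iff finite.intros insert_iff less_eq_real_def less_numeral_extra(3))
qed

lemma crit_exp_singleton: "0 < a \<Longrightarrow> crit_exp {a} = 0"
proof (rule antisym)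
  assume a: "0 < a"
  show "crit_exp {a} \<le> 0"
  proof (rule field_le_epsilon)
    fix e :: real assume "0 < e"
    then show "crit_exp {a} \<le> 0 + e"
      using crit_exp_le[of e "{a}"] subcritical_singleton[OF a] by simp
  qed
  show "0 \<le> crit_exp {a}" using a by (intro crit_exp_nonneg) auto
qed

section \<open>Greedy choice of digits\<close>

fun greedy :: "(nat \<Rightarrow> nat) \<Rightarrow> real \<Rightarrow> nat \<Rightarrow> nat set" where
  "greedy e t 0 = {}"
| "greedy e t (Suc n) =
     (if crit_exp (insert (e n) (greedy e t n)) \<le> t then insert (e n) (greedy e t n) else greedy e t n)"

lemma greedy_subset: "greedy e t n \<subseteq> e ` {..<n}"
  by (induction n) (auto simp: lessThan_Suc)

lemma crit_exp_greedy: "0 \<le> t \<Longrightarrow> crit_exp (greedy e t n) \<le> t"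
  by (induction n) (auto simp: crit_exp_empty)

lemma greedy_mono: "m \<le> n \<Longrightarrow> greedy e t m \<subseteq> greedy e t n"
  by (induction rule: dec_induct) auto

text \<open>If infinitely many digits are rejected, arbitrarily large ones are; but a large digit
  raises the dimension by arbitrarily little, so no slack below \<open>t\<close> can remain. If none
  is rejected, all digits are used. Otherwise every digit after the last rejected \<open>e n\<close>
  is accepted, and the swap hypothesis puts the dimension above \<open>t\<close>.\<close>

lemma crit_exp_attained:
  fixes e :: "nat \<Rightarrow> nat"
  assumes e: "strict_mono e" "0 < e 0" and t: "0 \<le> t" "t \<le> crit_exp (range e)"
    and swap: "\<And>n B. B \<subseteq> e ` {..<n} \<Longrightarrow> t < crit_exp (insert (e n) B) \<Longrightarrow> t < crit_exp (B \<union> e ` {n<..})"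
  obtains A where "A \<subseteq> range e" "crit_exp A = t"
proof -
  define A where "A = (\<Union>n. greedy e t n)"
  have e0: "0 \<notin> range e"
    using e by (metis imageE less_nat_zero_code strict_mono_less_eq zero_le le_zero_eq)
  have sub: "A \<subseteq> range e" using greedy_subset[of e t] unfolding A_def by blast
  have A0: "0 \<notin> A" using sub e0 by auto
  have G: "greedy e t n \<subseteq> A" for n by (auto simp: A_def)
  have le: "crit_exp A \<le> t"
  proof (rule crit_exp_le_finite[OF A0])
    fix A' assume A': "A' \<subseteq> A" "finite A'"
    have "\<exists>n. A' \<subseteq> greedy e t n"
      using A'(2,1)
    proof (induction A')
      case (insert x F)
      then obtain n where n: "F \<subseteq> greedy e t n" by auto
      obtain m where "x \<in> greedy e t m" using insert by (auto simp: A_def)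
      with n have "insert x F \<subseteq> greedy e t (max m n)"
        using greedy_mono[of m "max m n" e t] greedy_mono[of n "max m n" e t] by auto
      then show ?case by blast
    qed auto
    then obtain n where n: "A' \<subseteq> greedy e t n" by blast
    then have "crit_exp A' \<le> crit_exp (greedy e t n)"
      using A0 G by (intro crit_exp_mono) auto
    then show "crit_exp A' \<le> t" using crit_exp_greedy[OF t(1), of e n] by simp
  qed
  have "\<not> crit_exp A < t"
  proof
    assume less: "crit_exp A < t"
    define rej where "rej n \<longleftrightarrow> t < crit_exp (insert (e n) (greedy e t n))" for n
    have acc: "e n \<in> A" if "\<not> rej n" for n
      using that G[of "Suc n"] by (auto simp: rej_def)
    show False
    proof (cases "finite {n. rej n}")
      case False
      define s where "s = (crit_exp A + t) / 2"
      have s: "crit_exp A < s" "s < t" "0 < s"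
        using less crit_exp_nonneg[OF A0] by (auto simp: s_def)
      obtain N where N: "\<And>a. N \<le> a \<Longrightarrow> subcritical (insert a A) s"
        using subcritical_insert_large[OF A0 s(3) subcritical_above[OF A0 s(1)]] by blast
      obtain n where n: "N \<le> n" "rej n"
        using False unfolding infinite_nat_iff_unbounded_le by auto
      have "N \<le> e n" using n(1) strict_mono_imp_increasing[OF e(1), of n] by simp
      have "crit_exp (insert (e n) (greedy e t n)) \<le> crit_exp (insert (e n) A)"
        using A0 e0 G[of n] by (intro crit_exp_mono) auto
      also have "\<dots> \<le> s" using N[OF \<open>N \<le> e n\<close>] s by (intro crit_exp_le) auto
      finally show False using n(2) s by (simp add: rej_def)
    next
      case True
      show False
      proof (cases "{n. rej n} = {}")
        case none: True
        then have "A = range e" using acc sub by auto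
        then show False using less t by simp
      next
        case False
        define n where "n = Max {n. rej n}"
        have n: "rej n" using Max_in[OF True False] by (simp add: n_def)
        have "\<not> rej k" if "n < k" for k
          using Max_ge[OF True, of k] that by (auto simp: n_def)
        then have sub': "greedy e t n \<union> e ` {n<..} \<subseteq> A" using acc G by auto
        have "t < crit_exp (greedy e t n \<union> e ` {n<..})"
          using n greedy_subset by (intro swap) (auto simp: rej_def)
        also have "\<dots> \<le> crit_exp A" using sub' A0 by (rule crit_exp_mono[rotated])
        finally show False using less by simp
      qed
    qed
  qed
  with le that[OF sub] show ?thesis by simp
qed

text \<open>The trade is made with the next \<open>m\<close> digits only, because sums are compared
  over finite alphabets; monotonicity supplies the remaining digits.\<close>

lemma crit_exp_swap:
  fixes e :: "nat \<Rightarrow> nat"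
  assumes e: "strict_mono e" "0 < e 0" and "0 \<le> t" "t < \<tau>"
    and B: "B \<subseteq> e ` {..<n}" "t < crit_exp (insert (e n) B)"
    and sum: "1 \<le> (\<Sum>k=1..m. (real (e n) / real (e (n + k))) powr (2 * \<tau>))"
  shows "t < crit_exp (B \<union> e ` {n<..})"
proof -
  have inj: "inj e" using e(1) by (rule strict_mono_imp_inj_on)
  have e0: "0 \<notin> range e"
    using e by (metis imageE less_nat_zero_code strict_mono_less_eq zero_le le_zero_eq)
  define R where "R = (\<lambda>k. e (n + k)) ` {1..m}"
  have "inj_on (\<lambda>k. e (n + k)) {1..m}" by (rule inj_onI) (auto dest: injD[OF inj])
  then have sumR: "(\<Sum>r\<in>R. (real (e n) / real r) powr (2 * \<tau>)) = (\<Sum>k=1..m. (real (e n) / real (e (n + k))) powr (2 * \<tau>))"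
    unfolding R_def by (simp add: sum.reindex)
  have "t < crit_exp (B \<union> R)"
  proof (rule crit_exp_replace[OF _ _ _ _ _ _ _ _ assms(3,4) B(2)])
    show "0 \<notin> B" using B(1) e0 by auto
    show "0 < e n" using e0 by (metis gr0I rangeI)
    show "e n \<notin> B" using B(1) inj by (auto dest: injD)
    show "finite B" using B(1) by (rule finite_subset) auto
    show "finite R" by (simp add: R_def)
    show "B \<inter> R = {}" using B(1) inj unfolding R_def by (force dest: injD)
    show "e n \<le> r" if "r \<in> R" for r
      using that e(1) by (auto simp: R_def strict_mono_less_eq)
    show "1 \<le> (\<Sum>r\<in>R. (real (e n) / real r) powr (2 * \<tau>))" using sum sumR by simp
  qed
  also have "\<dots> \<le> crit_exp (B \<union> e ` {n<..})"
    using e0 B(1) by (intro crit_exp_mono) (auto simp: R_def)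
  finally show ?thesis .
qed

lemma dim_spectrum_eq: "0 \<notin> \<Lambda> \<Longrightarrow> dim_spectrum \<Lambda> = {crit_exp A | A. A \<subseteq> \<Lambda>}"
  unfolding dim_spectrum_def using hausdorff_dim_cfrac_set by (metis subset_iff)

lemma isCont_cf_sum:
  assumes "0 \<notin> A" "0 < p" "0 \<le> q"
  shows "isCont (\<lambda>s. cf_sum A g s n p q) s"
  using assms(2,3)
proof (induction n arbitrary: p q)
  case 0
  then show ?case unfolding cf_sum.simps by (intro continuous_intros) auto
next
  case (Suc n)
  then have "isCont (\<lambda>s. cf_sum A g s n (real a * p + q) p) s" if "a \<in> A" for a
    using next_state[OF assms(1) that, of p q] by simp
  then show ?case by simp
qed

section \<open>Renewal and damping: a strict drop of dimension\<close>

text \<open>Inserting \<open>e\<close> into a word of length \<open>n\<close> over \<open>B\<close>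
  at any of the \<open>n + 1\<close> places yields distinct words, and each insertion multiplies the
  denominator by at most \<open>e + 1\<close>. Where the sums over \<open>insert e B\<close> are
  bounded, those over \<open>B\<close> thus tend to 0.\<close>

lemma word_sum_ge_renewal:
  assumes "0 \<notin> B" "finite B" "e \<notin> B" "0 < e" "0 \<le> s" "0 < p" "0 \<le> q" "q \<le> p"
  shows "real (Suc n) * (real e + 1) powr (-2 * s) * word_sum B s n p q \<le> word_sum (insert e B) s (Suc n) p q"
  using assms(6-)
proof (induction n arbitrary: p q)
  case 0
  have "(real e * p + q) powr (-2 * s) \<ge> ((real e + 1) * p) powr (-2 * s)"
  proof (rule powr_mono2')
    show "0 < real e * p + q" using next_state(1)[of "{e}" e p q] 0 assms(4) by simp
  qed (use 0 assms(5) in \<open>auto simp: algebra_simps\<close>)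
  moreover have "0 \<le> (\<Sum>a\<in>B. (real a * p + q) powr (-2 * s))" by (intro sum_nonneg) auto
  ultimately show ?case using 0 assms(2,3) by (simp add: powr_mult)
next
  case (Suc n)
  let ?\<kappa> = "(real e + 1) powr (-2 * s)"
  have eB: "0 \<notin> insert e B" using assms by auto
  have pe: "0 < real e * p + q" using next_state(1)[OF eB, of e p q] Suc.prems by simp
  have "?\<kappa> * word_sum B s (Suc n) p q \<le> word_sum B s (Suc n) (real e * p + q) p"
  proof -
    have le: "(1 / (real e + 1)) * (real e * p + q) \<le> p"
      using Suc.prems by (simp add: field_simps)
    have "0 \<le> real e * q" using Suc.prems by simp
    then have "real e * p + q + p \<le> (real e + 1) * (p + q)"
      by (simp add: algebra_simps)
    then have le2: "(1 / (real e + 1)) * (real e * p + q + p) \<le> p + q"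
      by (simp add: divide_le_eq mult.commute)
    have "word_sum B s (Suc n) p q \<le> (1 / (real e + 1)) powr (-2 * s) * word_sum B s (Suc n) (real e * p + q) p"
      using le le2 pe Suc.prems assms by (intro cf_sum_dominate) auto
    then have "?\<kappa> * word_sum B s (Suc n) p q \<le> ?\<kappa> * ((1 / (real e + 1)) powr (-2 * s) * word_sum B s (Suc n) (real e * p + q) p)"
      by (intro mult_left_mono) auto
    also have "\<dots> = word_sum B s (Suc n) (real e * p + q) p"
      by (simp add: powr_divide flip: powr_add)
    finally show ?thesis .
  qed
  also have "\<dots> \<le> word_sum (insert e B) s (Suc n) (real e * p + q) p"
    using assms eB pe Suc.prems by (intro word_sum_mono) auto
  finally have 1: "?\<kappa> * word_sum B s (Suc n) p q \<le> word_sum (insert e B) s (Suc n) (real e * p + q) p" .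
  have "real (Suc n) * ?\<kappa> * word_sum B s (Suc n) p q =
      (\<Sum>a\<in>B. real (Suc n) * ?\<kappa> * word_sum B s n (real a * p + q) p)"
    by (simp add: sum_distrib_left)
  also have "\<dots> \<le> (\<Sum>a\<in>B. word_sum (insert e B) s (Suc n) (real a * p + q) p)"
    using next_state[OF assms(1)] Suc.prems by (intro sum_mono Suc.IH) auto
  finally have "real (Suc n) * ?\<kappa> * word_sum B s (Suc n) p q + ?\<kappa> * word_sum B s (Suc n) p q
      \<le> (\<Sum>a\<in>B. word_sum (insert e B) s (Suc n) (real a * p + q) p) + word_sum (insert e B) s (Suc n) (real e * p + q) p"
    using 1 by (rule add_mono)
  moreover have "word_sum (insert e B) s (Suc (Suc n)) p q =
     (\<Sum>a\<in>B. word_sum (insert e B) s (Suc n) (real a * p + q) p) + word_sum (insert e B) s (Suc n) (real e * p + q) p"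
    using assms(2,3) unfolding cf_sum.simps(2)[of "insert e B" _ _ "Suc n"] by simp
  ultimately show ?case by (simp add: algebra_simps del: cf_sum.simps)
qed

text \<open>\<open>cf_sum A (damp e z)\<close> weights each word by \<open>z\<close> to the number of occurrences of \<open>e\<close>.\<close>

definition damp :: "nat \<Rightarrow> real \<Rightarrow> nat \<Rightarrow> real" where
  "damp e z a = (if a = e then z else 1)"

lemma cf_sum_damp_Suc:
  assumes "finite B" "e \<notin> B"
  shows "cf_sum (insert e B) (damp e z) s (Suc n) p q =
    z * cf_sum (insert e B) (damp e z) s n (real e * p + q) p +
    (\<Sum>a\<in>B. cf_sum (insert e B) (damp e z) s n (real a * p + q) p)"
proof -
  have "(\<Sum>a\<in>B. damp e z a * cf_sum (insert e B) (damp e z) s n (real a * p + q) p) =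
    (\<Sum>a\<in>B. cf_sum (insert e B) (damp e z) s n (real a * p + q) p)"
    using assms(2) by (intro sum.cong) (auto simp: damp_def)
  then show ?thesis using assms by (simp add: damp_def[of e z e])
qed

lemma word_sum_insert_Suc:
  assumes "finite B" "e \<notin> B"
  shows "word_sum (insert e B) s (Suc n) p q =
    word_sum (insert e B) s n (real e * p + q) p +
    (\<Sum>a\<in>B. word_sum (insert e B) s n (real a * p + q) p)"
  using assms by simp

lemma damp_le_word_sum:
  assumes "0 \<le> z" "z \<le> 1"
  shows "cf_sum A (damp e z) s n p q \<le> word_sum A s n p q"
proof (induction n arbitrary: p q)
  case (Suc n)
  have "damp e z a * cf_sum A (damp e z) s n (real a * p + q) p \<le> 1 * word_sum A s n (real a * p + q) p" for a
    using assms by (intro mult_mono Suc.IH) (auto simp: damp_def intro: cf_sum_nonneg)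
  then show ?case by (auto intro: sum_mono)
qed auto

text \<open>Words without \<open>e\<close> form the first summand; any other word carries at least
  one factor \<open>z\<close>, and further factors are at most 1.\<close>

lemma damp_small:
  assumes "finite B" "e \<notin> B" "0 \<le> z" "z \<le> 1"
  shows "cf_sum (insert e B) (damp e z) s n p q \<le> word_sum B s n p q + z * word_sum (insert e B) s n p q"
proof (induction n arbitrary: p q)
  case (Suc n)
  have "cf_sum (insert e B) (damp e z) s (Suc n) p q \<le>
      z * word_sum (insert e B) s n (real e * p + q) p +
      (\<Sum>a\<in>B. word_sum B s n (real a * p + q) p + z * word_sum (insert e B) s n (real a * p + q) p)"
    unfolding cf_sum_damp_Suc[OF assms(1,2)] using assms
    by (intro add_mono mult_left_mono sum_mono Suc damp_le_word_sum)
  then show ?case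
    using assms(1,2) by (simp add: sum.distrib sum_distrib_left algebra_simps)
qed (use assms in auto)

text \<open>Interpolates in \<open>z\<close>: words with at least \<open>J\<close> occurrences of \<open>e\<close> gain the factor \<open>z\<^sup>J\<close>,
  the others are controlled by a smaller damping \<open>z0\<close>.\<close>

lemma damp_interpolate:
  assumes "finite B" "e \<notin> B" "0 < z0" "z0 \<le> z" "z \<le> 1"
  shows "cf_sum (insert e B) (damp e z) s n p q \<le>
    z powr J * word_sum (insert e B) s n p q + (z / z0) powr J * cf_sum (insert e B) (damp e z0) s n p q"
proof (induction n arbitrary: p q J)
  case 0
  have "1 \<le> z powr J + (z / z0) powr J"
  proof (cases "J \<le> 0")
    case True
    then have "1 powr J \<le> z powr J" using assms by (intro powr_mono2') auto
    then show ?thesis by (simp add: add_increasing2)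
  next
    case False
    then have "1 \<le> (z / z0) powr J" using assms by (intro ge_one_powr_ge_zero) auto
    then show ?thesis by (simp add: add_increasing)
  qed
  then have "1 * p powr (-2 * s) \<le> (z powr J + (z / z0) powr J) * p powr (-2 * s)"
    by (intro mult_right_mono) auto
  then show ?case by (simp add: algebra_simps)
next
  case (Suc n)
  let ?W = "word_sum (insert e B) s n" and ?Q = "cf_sum (insert e B) (damp e z0) s n"
  have z: "z * z powr (J - 1) = z powr J" "z * (z / z0) powr (J - 1) = z0 * (z / z0) powr J"
    using assms by (simp_all add: powr_diff)
  have "cf_sum (insert e B) (damp e z) s (Suc n) p q \<le>
     z * (z powr (J - 1) * ?W (real e * p + q) p + (z / z0) powr (J - 1) * ?Q (real e * p + q) p) +
     (\<Sum>a\<in>B. z powr J * ?W (real a * p + q) p + (z / z0) powr J * ?Q (real a * p + q) p)"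
    unfolding cf_sum_damp_Suc[OF assms(1,2)] using assms
    by (intro add_mono mult_left_mono sum_mono Suc) auto
  also have "z * (z powr (J - 1) * ?W (real e * p + q) p + (z / z0) powr (J - 1) * ?Q (real e * p + q) p) =
     z powr J * ?W (real e * p + q) p + (z / z0) powr J * (z0 * ?Q (real e * p + q) p)"
    using z by (simp add: distrib_left mult.assoc[symmetric]) 
  finally show ?case
    unfolding cf_sum_damp_Suc[OF assms(1,2)] word_sum_insert_Suc[OF assms(1,2)]
    by (simp add: sum.distrib distrib_left sum_distrib_left)
qed

text \<open>This is the opposite comparison to \<open>word_sum_replace_le\<close>. For
  \<open>q \<le> p\<close>, changing \<open>e\<close> to \<open>r\<close> scales denominators by at
  least \<open>(r + 2) / (e + 2)\<close>; the 2 comes from the worst case \<open>q = p\<close> of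
  \<open>(r * p + q + p) / (e * p + q + p)\<close>.\<close>

lemma word_sum_le_damp:
  assumes "0 \<notin> B" "finite B" "e \<notin> B" "0 < e" "finite R" "B \<inter> R = {}" "0 \<le> s" "0 \<le> z"
    and R: "\<And>r. r \<in> R \<Longrightarrow> e \<le> r" "(\<Sum>r\<in>R. ((real e + 2) / (real r + 2)) powr (2 * s)) \<le> z"
    and "0 < p" "0 \<le> q" "q \<le> p"
  shows "word_sum (B \<union> R) s n p q \<le> cf_sum (insert e B) (damp e z) s n p q"
  using assms(11-)
proof (induction n arbitrary: p q)
  case 0
  then show ?case by simp
next
  case (Suc n)
  let ?Q = "cf_sum (insert e B) (damp e z) s n"
  have damp0: "0 \<le> damp e z a" for a using assms(8) by (simp add: damp_def)
  have BR: "0 \<notin> B \<union> R" using R(1) assms(1,4) by force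
  have eB: "0 \<notin> insert e B" using assms by auto
  have "word_sum (B \<union> R) s (Suc n) p q =
      (\<Sum>r\<in>R. word_sum (B \<union> R) s n (real r * p + q) p) + (\<Sum>a\<in>B. word_sum (B \<union> R) s n (real a * p + q) p)"
    using assms(2,5,6) by (simp add: sum.union_disjoint)
  also have "\<dots> \<le> (\<Sum>r\<in>R. ?Q (real r * p + q) p) + (\<Sum>a\<in>B. ?Q (real a * p + q) p)"
    using next_state[OF BR] Suc.prems by (intro add_mono sum_mono Suc.IH) auto
  also have "(\<Sum>r\<in>R. ?Q (real r * p + q) p) \<le> (\<Sum>r\<in>R. ((real e + 2) / (real r + 2)) powr (2 * s) * ?Q (real e * p + q) p)"
  proof (rule sum_mono)
    fix r assume r: "r \<in> R"
    have er: "real e \<le> real r" using R(1)[OF r] by simp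
    let ?\<rho> = "(real r + 2) / (real e + 2)"
    have "?Q (real r * p + q) p \<le> ?\<rho> powr (-2 * s) * ?Q (real e * p + q) p"
    proof (rule cf_sum_dominate[OF eB damp0])
      show "0 < real e * p + q" using next_state(1)[OF eB, of e p q] Suc.prems by simp
      have 1: "(real r - real e) * q \<le> (real r - real e) * (2 * p)"
        "(real r - real e) * q \<le> (real r - real e) * p"
        using er Suc.prems by (auto intro!: mult_left_mono)
      have "(real r + 2) * (real e * p + q) \<le> (real e + 2) * (real r * p + q)"
        using 1 by (simp add: algebra_simps)
      then show "?\<rho> * (real e * p + q) \<le> real r * p + q"
        by (simp add: divide_le_eq mult.commute)
      have "(real r + 2) * (real e * p + q + p) \<le> (real e + 2) * (real r * p + q + p)"
        using 1 by (simp add: algebra_simps)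
      then show "?\<rho> * (real e * p + q + p) \<le> real r * p + q + p"
        by (simp add: divide_le_eq mult.commute)
    qed (use assms Suc.prems in auto)
    also have "?\<rho> powr (-2 * s) = ((real e + 2) / (real r + 2)) powr (2 * s)"
      by (simp add: powr_minus powr_divide)
    finally show "?Q (real r * p + q) p \<le> ((real e + 2) / (real r + 2)) powr (2 * s) * ?Q (real e * p + q) p" .
  qed
  also have "\<dots> \<le> z * ?Q (real e * p + q) p"
    unfolding sum_distrib_right[symmetric] using R(2) damp0 by (intro mult_right_mono cf_sum_nonneg) auto
  finally show ?case unfolding cf_sum_damp_Suc[OF assms(2,3)] by simp
qed

text \<open>At the critical exponent \<sigma> the word sums stay bounded. By renewal, words avoiding
  \<open>e\<close> then have a sum below 1 at some length, and a sufficiently small damping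
  \<open>z0\<close> preserves this. Interpolation transfers it to the given \<open>z\<close>: many
  occurrences of \<open>e\<close> gain from \<open>z\<close>, and the rest decays.\<close>

lemma damped_sum_less_1:
  assumes "0 \<notin> B" "finite B" "e \<notin> B" "0 < e" "0 < crit_exp (insert e B)" "0 < z" "z < 1"
  obtains n where "0 < n" "cf_sum (insert e B) (damp e z) (crit_exp (insert e B)) n 1 0 < 1"
proof -
  define A where "A = insert e B"
  define \<sigma> where "\<sigma> = crit_exp A"
  have A: "0 \<notin> A" "finite A" using assms by (auto simp: A_def)
  have \<sigma>: "0 < \<sigma>" using assms(5) by (simp add: \<sigma>_def A_def)
  \<comment> \<open>A larger sum would by continuity remain too large slightly above \<sigma>, where
    the alphabet is subcritical.\<close>
  have bound: "word_sum A \<sigma> n 1 0 \<le> 4 powr \<sigma>" if "0 < n" for n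
  proof (rule ccontr)
    assume *: "\<not> ?thesis"
    have "isCont (\<lambda>s. word_sum A s n 1 0 - 4 powr s) \<sigma>"
      using A by (intro continuous_intros isCont_cf_sum) auto
    then have "((\<lambda>s. word_sum A s n 1 0 - 4 powr s) \<longlongrightarrow> word_sum A \<sigma> n 1 0 - 4 powr \<sigma>) (at_right \<sigma>)"
      unfolding isCont_def by (rule tendsto_mono[OF at_le, rotated]) auto
    then have "eventually (\<lambda>s. 0 < word_sum A s n 1 0 - 4 powr s) (at_right \<sigma>)"
      using * by (intro order_tendstoD) auto
    moreover have "eventually (\<lambda>s. \<sigma> < s) (at_right \<sigma>)" by (rule eventually_at_right_less)
    ultimately have "eventually (\<lambda>s. 0 < word_sum A s n 1 0 - 4 powr s \<and> \<sigma> < s) (at_right \<sigma>)"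
      by (rule eventually_conj)
    then obtain s where s: "0 < word_sum A s n 1 0 - 4 powr s" "\<sigma> < s"
      using eventually_happens'[OF trivial_limit_at_right_real] by blast
    then have "\<not> subcritical A s" using A that \<sigma> by (intro not_subcriticalI[of A s n]) auto
    with subcritical_above[OF A(1)] s(2) show False by (simp add: \<sigma>_def)
  qed
  define \<kappa> where "\<kappa> = (real e + 1) powr (-2 * \<sigma>)"
  have \<kappa>: "0 < \<kappa>" by (simp add: \<kappa>_def)
  \<comment> \<open>Renewal bounds the sum over \<open>B\<close> by
    \<open>4 powr \<sigma> / (\<kappa> * (i + 1))\<close>, and this \<open>i\<close> brings it below
    1.\<close>
  obtain i where i: "4 powr \<sigma> / \<kappa> < real i" using reals_Archimedean2 by blast
  then have i0: "0 < i" using \<kappa> by (cases i) (auto simp: divide_less_0_iff)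
  have "real (Suc i) * \<kappa> * word_sum B \<sigma> i 1 0 \<le> 4 powr \<sigma>"
    using word_sum_ge_renewal[OF assms(1-4), of \<sigma> 1 0 i] bound[of "Suc i"] \<sigma>
    unfolding A_def \<kappa>_def by (simp del: cf_sum.simps)
  also have "\<dots> < real i * \<kappa>" using i \<kappa> by (simp add: divide_less_eq)
  finally have "real (Suc i) * \<kappa> * word_sum B \<sigma> i 1 0 < real i * \<kappa>" .
  moreover have "real i * \<kappa> * word_sum B \<sigma> i 1 0 \<le> real (Suc i) * \<kappa> * word_sum B \<sigma> i 1 0"
    using \<kappa> by (intro mult_right_mono cf_sum_nonneg) auto
  ultimately have "real i * \<kappa> * (word_sum B \<sigma> i 1 0) < real i * \<kappa> * 1" by linarith
  then have WB: "word_sum B \<sigma> i 1 0 < 1" using \<kappa> i0 by (simp add: mult_less_cancel_left)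
  define z0 where "z0 = min z ((1 - word_sum B \<sigma> i 1 0) / (2 * 4 powr \<sigma>))"
  have z0: "0 < z0" "z0 \<le> z" using assms(6) WB by (auto simp: z0_def)
  define q0 where "q0 = cf_sum A (damp e z0) \<sigma> i 1 0"
  have damp0: "0 \<le> damp e x a" if "0 \<le> x" for x a using that by (simp add: damp_def)
  have "q0 \<le> word_sum B \<sigma> i 1 0 + z0 * word_sum A \<sigma> i 1 0"
    unfolding q0_def A_def using assms z0 by (intro damp_small) auto
  also have "z0 * word_sum A \<sigma> i 1 0 \<le> ((1 - word_sum B \<sigma> i 1 0) / (2 * 4 powr \<sigma>)) * 4 powr \<sigma>"
    using bound[OF i0] z0 WB by (intro mult_mono) (auto simp: z0_def intro: cf_sum_nonneg)
  also have "\<dots> = (1 - word_sum B \<sigma> i 1 0) / 2" by simp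
  finally have q0: "q0 < 1" using WB by (simp add: field_simps)
  have q0_nn: "0 \<le> q0" unfolding q0_def using damp0 z0 by (intro cf_sum_nonneg) auto
  have "0 < 1 / (3 * 4 powr \<sigma>)" by simp
  then obtain J where J: "z ^ J < 1 / (3 * 4 powr \<sigma>)" using real_arch_pow_inv assms(7) by blast
  have "0 < 1 / (3 * (z / z0) ^ J)" using assms(6) z0 by simp
  then obtain k where k: "q0 ^ k < 1 / (3 * (z / z0) ^ J)" using real_arch_pow_inv q0 by blast
  have k': "q0 ^ Suc k < 1 / (3 * (z / z0) ^ J)"
    using k q0 q0_nn power_decreasing[of k "Suc k" q0] by simp
  define n where "n = i * Suc k"
  have n: "0 < n" using i0 by (simp add: n_def)
  have "cf_sum A (damp e z) \<sigma> n 1 0 \<le> z powr J * word_sum A \<sigma> n 1 0 + (z / z0) powr J * cf_sum A (damp e z0) \<sigma> n 1 0"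
    unfolding A_def using assms z0 by (intro damp_interpolate) auto
  also have "\<dots> = z ^ J * word_sum A \<sigma> n 1 0 + (z / z0) ^ J * cf_sum A (damp e z0) \<sigma> n 1 0"
    using assms(6) z0 by (simp add: powr_realpow)
  also have "\<dots> \<le> 1 / (3 * 4 powr \<sigma>) * 4 powr \<sigma> + (z / z0) ^ J * (1 / (3 * (z / z0) ^ J))"
  proof (intro add_mono mult_mono)
    have "cf_sum A (damp e z0) \<sigma> n 1 0 \<le> q0 ^ Suc k"
      unfolding n_def q0_def using A \<sigma> z0 damp0 by (intro cf_sum_power_le) auto
    then show "cf_sum A (damp e z0) \<sigma> n 1 0 \<le> 1 / (3 * (z / z0) ^ J)" using k' by simp
  qed (use J bound[OF n] assms(6) z0 damp0 in \<open>auto intro: cf_sum_nonneg\<close>)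
  also have "\<dots> < 1" using assms(6) z0 by simp
  finally show ?thesis using that n unfolding A_def \<sigma>_def by blast
qed

text \<open>At the critical exponent of \<open>insert e B\<close> some damped sum is strictly below
  1. By continuity it stays so at a smaller exponent above \<open>s0\<close>, where damped sums
  still dominate the word sums over \<open>B \<union> R\<close>.\<close>

lemma crit_exp_gap:
  assumes "0 \<notin> B" "finite B" "e \<notin> B" "0 < e" "B \<inter> R = {}"
    and R: "\<And>r. r \<in> R \<Longrightarrow> e \<le> r" and s0: "0 < s0" "s0 < crit_exp (insert e B)"
    and z: "z < 1" "\<And>R'. R' \<subseteq> R \<Longrightarrow> finite R' \<Longrightarrow> (\<Sum>r\<in>R'. ((real e + 2) / (real r + 2)) powr (2 * s0)) \<le> z"
  shows "crit_exp (B \<union> R) < crit_exp (insert e B)"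
proof -
  define \<sigma> where "\<sigma> = crit_exp (insert e B)"
  \<comment> \<open>The interpolation needs a positive damping factor, and \<open>z\<close> may be
    0.\<close>
  define z' where "z' = max z (1 / 2)"
  have z': "0 < z'" "z' < 1" using z(1) by (auto simp: z'_def)
  obtain n where n: "0 < n" "cf_sum (insert e B) (damp e z') \<sigma> n 1 0 < 1"
    unfolding \<sigma>_def using s0 damped_sum_less_1[OF assms(1-4) _ z'] by auto
  have eB: "0 \<notin> insert e B" using assms by auto
  have "isCont (\<lambda>s. cf_sum (insert e B) (damp e z') s n 1 0) \<sigma>"
    using eB by (intro isCont_cf_sum) auto
  then have "((\<lambda>s. cf_sum (insert e B) (damp e z') s n 1 0) \<longlongrightarrow> cf_sum (insert e B) (damp e z') \<sigma> n 1 0) (at_left \<sigma>)"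
    unfolding isCont_def by (rule tendsto_mono[OF at_le, rotated]) auto
  then have "eventually (\<lambda>s. cf_sum (insert e B) (damp e z') s n 1 0 < 1) (at_left \<sigma>)"
    using n(2) by (rule order_tendstoD(2))
  moreover have "eventually (\<lambda>s. s \<in> {s0<..<\<sigma>}) (at_left \<sigma>)"
    using s0(2) by (intro eventually_at_leftI[of s0]) (auto simp: \<sigma>_def)
  ultimately have "eventually (\<lambda>s. cf_sum (insert e B) (damp e z') s n 1 0 < 1 \<and> s \<in> {s0<..<\<sigma>}) (at_left \<sigma>)"
    by (rule eventually_conj)
  then obtain s where s: "cf_sum (insert e B) (damp e z') s n 1 0 < 1" "s0 < s" "s < \<sigma>"
    using eventually_happens'[OF trivial_limit_at_left_real] by fastforce
  have "subcritical (B \<union> R) s"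
  proof (rule subcriticalI[OF n(1) s(1)])
    fix A' assume A': "A' \<subseteq> B \<union> R" "finite A'"
    have R0: "0 \<notin> R" using R assms(4) by force
    have R': "A' \<inter> R \<subseteq> R" "finite (A' \<inter> R)" using A' by auto
    have "(\<Sum>r\<in>A' \<inter> R. ((real e + 2) / (real r + 2)) powr (2 * s)) \<le> (\<Sum>r\<in>A' \<inter> R. ((real e + 2) / (real r + 2)) powr (2 * s0))"
      using R s by (intro sum_mono powr_mono') auto
    also have "\<dots> \<le> z'" using z(2)[OF R'] by (simp add: z'_def)
    finally have sum: "(\<Sum>r\<in>A' \<inter> R. ((real e + 2) / (real r + 2)) powr (2 * s)) \<le> z'" .
    have "word_sum A' s n 1 0 \<le> word_sum (B \<union> (A' \<inter> R)) s n 1 0"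
      using A' assms R0 s s0 by (intro word_sum_mono) auto
    also have "\<dots> \<le> cf_sum (insert e B) (damp e z') s n 1 0"
      using assms R' R s s0 z' sum by (intro word_sum_le_damp) auto
    finally show "word_sum A' s n 1 0 \<le> cf_sum (insert e B) (damp e z') s n 1 0" .
  qed
  then have "crit_exp (B \<union> R) \<le> s" using s s0 by (intro crit_exp_le) auto
  with s(3) show ?thesis by (simp add: \<sigma>_def)
qed

section \<open>Numerical bounds on the critical exponent\<close>

lemma crit_exp_inj_le:
  assumes "0 \<notin> A'" "inj_on h A" "h ` A \<subseteq> A'" "\<And>a. a \<in> A \<Longrightarrow> h a \<le> a"
  shows "crit_exp A \<le> crit_exp A'"
  unfolding crit_exp_def
proof (rule cInf_superset_mono[OF crit_exp_set_nonempty[OF assms(1)] crit_exp_bdd])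
  show "{s. 0 < s \<and> subcritical A' s} \<subseteq> {s. 0 < s \<and> subcritical A s}"
  proof safe
    fix s :: real assume s: "0 < s" "subcritical A' s"
    then obtain n c where n: "n > 0" "c < 1"
      and le: "\<And>F. F \<subseteq> A' \<Longrightarrow> finite F \<Longrightarrow> word_sum F s n 1 0 \<le> c"
      unfolding subcritical_def by blast
    show "subcritical A s"
    proof (rule subcriticalI[OF n])
      fix F assume F: "F \<subseteq> A" "finite F"
      have "word_sum F s n 1 0 \<le> word_sum (h ` F) s n 1 0"
        using F assms s inj_on_subset[OF assms(2) F(1)] by (intro word_sum_inj_le[where h = h]) auto
      also have "\<dots> \<le> c" using F assms(3) by (intro le) auto
      finally show "word_sum F s n 1 0 \<le> c" .
    qed
  qed
qed

text \<open>Rational exponents are certified through integer powers, which reduces the numerical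
  claims to arithmetic on literals.\<close>

lemma powr_frac_le:
  fixes u c :: real
  assumes "0 \<le> u" "0 \<le> c" "0 < Q" "u ^ P \<le> c ^ Q"
  shows "u powr (real P / real Q) \<le> c"
proof (cases "u = 0")
  case False
  then have u: "0 < u" using assms(1) by simp
  have "u powr (real P / real Q) = (u ^ P) powr (1 / real Q)"
    using u by (simp add: powr_powr flip: powr_realpow)
  also have "\<dots> \<le> (c ^ Q) powr (1 / real Q)" using assms u by (intro powr_mono2) auto
  also have "\<dots> = c"
  proof (cases "c = 0")
    case False
    then show ?thesis using assms by (simp add: powr_powr flip: powr_realpow)
  qed (use assms in auto)
  finally show ?thesis .
qed (use assms in auto)

lemma powr_frac_ge:
  fixes u c :: real
  assumes "0 < u" "0 \<le> c" "0 < Q" "c ^ Q \<le> u ^ P"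
  shows "c \<le> u powr (real P / real Q)"
proof (cases "c = 0")
  case False
  then have c: "0 < c" using assms(2) by simp
  have "c = (c ^ Q) powr (1 / real Q)"
    using assms c by (simp add: powr_powr flip: powr_realpow)
  also have "\<dots> \<le> (u ^ P) powr (1 / real Q)" using assms c by (intro powr_mono2) auto
  also have "\<dots> = u powr (real P / real Q)"
    using assms by (simp add: powr_powr flip: powr_realpow)
  finally show ?thesis .
qed auto

section \<open>Certified tables for branch sums\<close>

text \<open>Any \<open>c \<ge> 0\<close> is admissible in \<open>word_sum_le_branch\<close>; 11/10
  is a choice near the value 1 of Gauss's density for which the tables succeed.\<close>

abbreviation gauss_branch :: "real \<Rightarrow> nat \<Rightarrow> real" where
  "gauss_branch x a \<equiv> branch (11 / 10) x (real a)"

text \<open>This is the cross-multiplied difference of the branches at \<open>y\<close> and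
  \<open>x\<close>; the sign of the second factor decides monotonicity.\<close>

lemma branch_cross:
  fixes a c x y :: real
  shows "(1 + c * y) * ((a + x) * (a + c + x)) - (1 + c * x) * ((a + y) * (a + c + y)) =
    (y - x) * (c * a * (a + c) - (2 * a + c) - (x + y) - c * x * y)"
  by (simp add: algebra_simps)

lemma divide_le_divide_cross:
  fixes a b c d :: real
  shows "0 < b \<Longrightarrow> 0 < d \<Longrightarrow> a * d \<le> c * b \<Longrightarrow> a / b \<le> c / d"
  by (simp add: field_simps)

text \<open>The second factor in \<open>branch_cross\<close> is nonnegative on \<open>[0, 1]\<close>
  for digits at least 3 and negative for the digit 1. For the digit 2 it changes sign, which
  explains the condition \<open>a = 1 \<or> 3 \<le> a\<close> on table digits.\<close>

lemma gauss_branch_mono: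
  assumes "3 \<le> a" "0 \<le> x" "x \<le> y" "y \<le> 1"
  shows "gauss_branch x a \<le> gauss_branch y a"
proof -
  let ?c = "11 / 10 :: real" and ?a = "real a"
  have a: "3 \<le> ?a" using assms(1) by simp
  have "3 * ?a \<le> ?a * ?a" using a by (intro mult_right_mono) auto
  moreover have "x * y \<le> 1 * 1" using assms by (intro mult_mono) auto
  moreover have "?c * ?a * (?a + ?c) = 11 / 10 * (?a * ?a) + 121 / 100 * ?a" "?c * x * y = 11 / 10 * (x * y)"
    by (simp_all add: algebra_simps)
  ultimately have "0 \<le> ?c * ?a * (?a + ?c) - (2 * ?a + ?c) - (x + y) - ?c * x * y"
    using a assms by linarith
  then have "0 \<le> (y - x) * (?c * ?a * (?a + ?c) - (2 * ?a + ?c) - (x + y) - ?c * x * y)"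
    using assms by (intro mult_nonneg_nonneg) auto
  then have "(1 + ?c * x) * ((?a + y) * (?a + ?c + y)) \<le> (1 + ?c * y) * ((?a + x) * (?a + ?c + x))"
    unfolding branch_cross[symmetric] by linarith
  then show ?thesis
    unfolding branch_def using a assms by (intro divide_le_divide_cross mult_pos_pos) auto
qed

lemma gauss_branch_antimono_1:
  assumes "0 \<le> x" "x \<le> y"
  shows "branch (11 / 10) y 1 \<le> branch (11 / 10) x 1"
proof -
  let ?c = "11 / 10 :: real"
  have nonneg: "0 \<le> ?c * x * y" using assms by (intro mult_nonneg_nonneg) auto
  have "?c * 1 * (1 + ?c) - (2 * 1 + ?c) - (x + y) - u \<le> 0" if "0 \<le> u" for u :: real
    using assms that by simp
  from this[OF nonneg] have "?c * 1 * (1 + ?c) - (2 * 1 + ?c) - (x + y) - ?c * x * y \<le> 0" .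
  then have "(y - x) * (?c * 1 * (1 + ?c) - (2 * 1 + ?c) - (x + y) - ?c * x * y) \<le> 0"
    using assms by (intro mult_nonneg_nonpos) auto
  then have "(1 + ?c * y) * ((1 + x) * (1 + ?c + x)) \<le> (1 + ?c * x) * ((1 + y) * (1 + ?c + y))"
    unfolding branch_cross[symmetric] by linarith
  then show ?thesis
    unfolding branch_def using assms by (intro divide_le_divide_cross mult_pos_pos) auto
qed

lemma gauss_branch_nonneg: "0 \<le> x \<Longrightarrow> 0 \<le> gauss_branch x a"
  unfolding branch_def by simp

text \<open>\<open>d / D\<close> is an upper bound of \<open>gauss_branch (i / N) a powr (P / Q)\<close>.\<close>

definition entry_ok :: "nat \<Rightarrow> nat \<Rightarrow> nat \<Rightarrow> nat \<Rightarrow> nat \<Rightarrow> nat \<Rightarrow> nat \<Rightarrow> bool" where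
  "entry_ok D P Q N i a d \<longleftrightarrow>
     (N * (10 * N + 11 * i)) ^ P * D ^ Q \<le> d ^ Q * ((a * N + i) * (10 * a * N + 11 * N + 10 * i)) ^ P"

lemma entry_ok_bound:
  assumes "entry_ok D P Q N i a d" "0 < D" "0 < N" "0 < Q" "0 < a"
  shows "gauss_branch (real i / real N) a powr (real P / real Q) \<le> real d / real D"
proof (rule powr_frac_le)
  let ?u = "real N * (10 * real N + 11 * real i)"
  let ?v = "(real a * real N + real i) * (10 * real a * real N + 11 * real N + 10 * real i)"
  have pos: "0 < real a * real N + real i" "0 < 10 * real a * real N + 11 * real N + 10 * real i"
    using assms by (auto intro!: add_pos_nonneg)
  have v: "0 < ?v" using pos by (rule mult_pos_pos)
  have eq: "gauss_branch (real i / real N) a = ?u / ?v"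
  proof -
    have 1: "1 + 11 / 10 * (real i / real N) = (10 * real N + 11 * real i) / (10 * real N)"
      "real a + real i / real N = (real a * real N + real i) / real N"
      "real a + 11 / 10 + real i / real N = (10 * real a * real N + 11 * real N + 10 * real i) / (10 * real N)"
      using assms(3) by (simp_all add: field_simps)
    show ?thesis unfolding branch_def 1 using assms(3) pos by simp
  qed
  show "0 \<le> gauss_branch (real i / real N) a" by (simp add: gauss_branch_nonneg)
  have "real ((N * (10 * N + 11 * i)) ^ P * D ^ Q) \<le> real (d ^ Q * ((a * N + i) * (10 * a * N + 11 * N + 10 * i)) ^ P)"
    using assms(1) unfolding entry_ok_def of_nat_le_iff .
  then have "?u ^ P * real D ^ Q \<le> real d ^ Q * ?v ^ P" by simp
  then show "gauss_branch (real i / real N) a ^ P \<le> (real d / real D) ^ Q"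
    unfolding eq power_divide using v assms(2) by (simp add: divide_le_eq le_divide_eq mult.commute)
qed (use assms in auto)

text \<open>Row \<open>i\<close> covers the interval from \<open>i / N\<close> to \<open>(i + 1) / N\<close>. The branch of digit \<open>1\<close> is
  decreasing and evaluated at the left end, all others are increasing and evaluated at the right end.\<close>

fun row_ok :: "nat \<Rightarrow> nat \<Rightarrow> nat \<Rightarrow> nat \<Rightarrow> nat \<Rightarrow> nat list \<Rightarrow> nat list \<Rightarrow> bool" where
  "row_ok D P Q N i [] [] \<longleftrightarrow> True"
| "row_ok D P Q N i (a # as) (d # ds) \<longleftrightarrow>
     entry_ok D P Q N (if a = 1 then i else i + 1) a d \<and> row_ok D P Q N i as ds"
| "row_ok D P Q N i _ _ \<longleftrightarrow> False"

fun table_ok :: "nat \<Rightarrow> nat \<Rightarrow> nat \<Rightarrow> nat \<Rightarrow> nat \<Rightarrow> nat list \<Rightarrow> nat \<Rightarrow> nat list list \<Rightarrow> bool" where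
  "table_ok D K P Q N as i [] \<longleftrightarrow> i = N"
| "table_ok D K P Q N as i (ds # T) \<longleftrightarrow>
     row_ok D P Q N i as ds \<and> sum_list ds \<le> K \<and> table_ok D K P Q N as (i + 1) T"

lemma row_ok_bound:
  assumes "row_ok D P Q N i as ds" "0 < D" "0 < N" "0 < Q" "\<And>a. a \<in> set as \<Longrightarrow> a = 1 \<or> 3 \<le> a"
    and "i < N" "real i / real N \<le> x" "x \<le> real (i + 1) / real N"
  shows "(\<Sum>a\<leftarrow>as. gauss_branch x a powr (real P / real Q)) \<le> real (sum_list ds) / real D"
  using assms(1,5)
proof (induction as arbitrary: ds)
  case Nil
  then show ?case by (cases ds) auto
next
  case (Cons a as)
  then obtain d ds' where ds: "ds = d # ds'" by (cases ds) auto
  have x: "0 \<le> x" using assms(7) by (rule order_trans[rotated]) simp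
  have end1: "real (i + 1) / real N \<le> 1" using assms(3,6) by simp
  have "gauss_branch x a powr (real P / real Q) \<le> real d / real D"
  proof (cases "a = 1")
    case True
    have "gauss_branch x a powr (real P / real Q) \<le> gauss_branch (real i / real N) a powr (real P / real Q)"
    proof (rule powr_mono2)
      show "gauss_branch x a \<le> gauss_branch (real i / real N) a"
        using assms(7) True gauss_branch_antimono_1[of "real i / real N" x] by simp
    qed (use x in \<open>simp_all add: gauss_branch_nonneg\<close>)
    also have "\<dots> \<le> real d / real D"
      using Cons.prems True assms ds by (intro entry_ok_bound) auto
    finally show ?thesis .
  next
    case False
    then have a: "3 \<le> a" using Cons.prems(2)[of a] by simp
    have "gauss_branch x a powr (real P / real Q) \<le> gauss_branch (real (i + 1) / real N) a powr (real P / real Q)"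
      using assms(8) x end1 gauss_branch_mono[OF a x] by (intro powr_mono2) (auto intro: gauss_branch_nonneg)
    also have "\<dots> \<le> real d / real D"
      using Cons.prems False assms ds a by (intro entry_ok_bound) auto
    finally show ?thesis .
  qed
  then show ?case
    using Cons.IH[of ds'] Cons.prems ds by (simp add: add_divide_distrib)
qed

lemma table_ok_bound:
  assumes "table_ok D K P Q N as i T" "0 < D" "0 < N" "0 < Q" "\<And>a. a \<in> set as \<Longrightarrow> a = 1 \<or> 3 \<le> a"
    and "i < N" "real i / real N \<le> x" "x \<le> 1"
  shows "(\<Sum>a\<leftarrow>as. gauss_branch x a powr (real P / real Q)) \<le> real K / real D"
  using assms(1,6,7)
proof (induction T arbitrary: i)
  case Nil
  then show ?case by simp
next
  case (Cons ds T)
  show ?case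
  proof (cases "x \<le> real (i + 1) / real N")
    case True
    have "(\<Sum>a\<leftarrow>as. gauss_branch x a powr (real P / real Q)) \<le> real (sum_list ds) / real D"
      using Cons.prems True assms by (intro row_ok_bound[of D P Q N i]) auto
    also have "\<dots> \<le> real K / real D" using Cons.prems by (intro divide_right_mono) auto
    finally show ?thesis .
  next
    case False
    then have "real (i + 1) / real N < 1" using assms(8) by simp
    then have "i + 1 < N" using assms(3) by simp
    then show ?thesis using Cons.prems False by (intro Cons.IH[of "i + 1"]) auto
  qed
qed

lemma subcritical_of_branch_sum:
  assumes "0 \<notin> A" "0 < s" "k < 1"
    and "\<And>A' x. A' \<subseteq> A \<Longrightarrow> finite A' \<Longrightarrow> 0 \<le> x \<Longrightarrow> x \<le> 1 \<Longrightarrow> (\<Sum>a\<in>A'. gauss_branch x a powr s) \<le> k"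
  shows "subcritical A s"
proof -
  have k: "0 \<le> k" using assms(4)[of "{}" 0] by simp
  have "0 < 1 / (2 * (21 / 10) powr s)" by simp
  then obtain n where n: "k ^ n < 1 / (2 * (21 / 10) powr s)" using real_arch_pow_inv assms(3) by blast
  have "k ^ Suc n \<le> k ^ n" using k assms(3) by (intro power_decreasing) auto
  with n have n': "k ^ Suc n \<le> 1 / (2 * (21 / 10) powr s)" by linarith
  show ?thesis
  proof (rule subcriticalI[of "Suc n" "1 / 2"])
    fix A' assume A': "A' \<subseteq> A" "finite A'"
    have "word_sum A' s (Suc n) 1 0 \<le> (1 + 11 / 10) powr s * k ^ Suc n"
      using A' assms k by (intro word_sum_le_branch) auto
    also have "\<dots> \<le> (21 / 10) powr s * (1 / (2 * (21 / 10) powr s))"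
      using n' by (intro mult_mono) (use k in auto)
    finally show "word_sum A' s (Suc n) 1 0 \<le> 1 / 2" by simp
  qed auto
qed

lemma crit_exp_le_table:
  assumes "table_ok D K P Q N as 0 T" "0 < D" "0 < N" "0 < P" "0 < Q" "K < D"
    and "\<forall>a\<in>set as. a = 1 \<or> 3 \<le> a" "distinct as"
  shows "crit_exp (set as) \<le> real P / real Q"
proof (rule crit_exp_le)
  show "subcritical (set as) (real P / real Q)"
  proof (rule subcritical_of_branch_sum[where k = "real K / real D"])
    fix A' and x :: real assume A': "A' \<subseteq> set as" and x: "0 \<le> x" "x \<le> 1"
    have "(\<Sum>a\<in>A'. gauss_branch x a powr (real P / real Q)) \<le> (\<Sum>a\<in>set as. gauss_branch x a powr (real P / real Q))"
      using A' by (intro sum_mono2) auto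
    also have "\<dots> = (\<Sum>a\<leftarrow>as. gauss_branch x a powr (real P / real Q))"
      using assms(8) by (simp add: sum_list_distinct_conv_sum_set)
    also have "\<dots> \<le> real K / real D"
      using assms x by (intro table_ok_bound[of D K P Q N as 0 T]) auto
    finally show "(\<Sum>a\<in>A'. gauss_branch x a powr (real P / real Q)) \<le> real K / real D" .
  qed (use assms in auto)
qed (use assms in auto)

text \<open>8/5 is a quotient of Fibonacci numbers just below the golden ratio, so Fibonacci-like
  sequences satisfy the hypothesis from some index on.\<close>

lemma growth_power:
  fixes e :: "nat \<Rightarrow> nat"
  assumes "\<And>k. m \<le> k \<Longrightarrow> 8 * e k \<le> 5 * e (Suc k)"
  shows "(8 / 5) ^ j * real (e m) \<le> real (e (m + j))"
proof (induction j)
  case (Suc j)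
  have "real (8 * e (m + j)) \<le> real (5 * e (Suc (m + j)))"
    using assms[of "m + j"] by (simp only: of_nat_le_iff) 
  then have "8 / 5 * real (e (m + j)) \<le> real (e (Suc (m + j)))" by simp
  moreover have "8 / 5 * ((8 / 5) ^ j * real (e m)) \<le> 8 / 5 * real (e (m + j))"
    using Suc by (intro mult_left_mono) auto
  ultimately have "8 / 5 * ((8 / 5) ^ j * real (e m)) \<le> real (e (Suc (m + j)))" by (rule order_trans[rotated])
  then show ?case by (simp add: mult.assoc)
qed auto

text \<open>The first \<open>m\<close> digits are left to the table, the others to a geometric
  series. \<open>21 / 10\<close> is the numerator \<open>1 + c\<close> of \<open>branch\<close> at
  \<open>x = 1\<close>, and \<open>25 / 64\<close> is the square of \<open>5 / 8\<close>;
  \<open>X\<close> and \<open>y\<close> bound the corresponding powers.\<close>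

lemma crit_exp_le_table_tail:
  fixes e :: "nat \<Rightarrow> nat"
  assumes "table_ok D K P Q N as 0 T" "0 < D" "0 < N" "0 < P" "0 < Q"
    and "\<forall>a\<in>set as. a = 1 \<or> 3 \<le> a" "distinct as"
    and e: "strict_mono e" "0 < e 0" "as = map e [0..<m]"
    and growth: "\<And>k. m \<le> k \<Longrightarrow> 8 * e k \<le> 5 * e (Suc k)"
    and X: "0 \<le> X" "(21 / 10 / real (e m) ^ 2) ^ P \<le> X ^ Q"
    and y: "0 \<le> y" "y < 1" "(25 / 64) ^ P \<le> y ^ Q"
    and less: "real K / real D + X / (1 - y) < 1"
  shows "crit_exp (range e) \<le> real P / real Q"
proof (rule crit_exp_le)
  let ?s = "real P / real Q"
  have e_pos: "0 < e k" for k
    using e by (metis le0 less_le_trans strict_mono_less_eq)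
  have inj: "inj e" using e(1) by (rule strict_mono_imp_inj_on)
  show "subcritical (range e) ?s"
  proof (rule subcritical_of_branch_sum[OF _ _ less])
    show "0 \<notin> range e" using e_pos by (metis imageE less_irrefl)
    fix A' and x :: real assume A': "A' \<subseteq> range e" "finite A'" and x: "0 \<le> x" "x \<le> 1"
    let ?h = "\<lambda>a. gauss_branch x a powr ?s"
    obtain F where F: "finite F" "A' = e ` F"
      using A' by (meson finite_subset_image)
    obtain M where M: "F \<subseteq> {..<M}" using F(1) by (auto simp: finite_nat_iff_bounded)
    have tail: "?h (e (m + j)) \<le> X * y ^ j" for j
    proof -
      have em: "0 < real (e m)" using e_pos by simp
      have g: "(8 / 5) ^ j * real (e m) \<le> real (e (m + j))" using growth by (rule growth_power)
      have pos: "0 < (8 / 5) ^ j * real (e m)" using em by simp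
      have "gauss_branch x (e (m + j)) \<le> (21 / 10) / (((8 / 5) ^ j * real (e m)) * ((8 / 5) ^ j * real (e m)))"
        unfolding branch_def using x g pos by (intro frac_le mult_mono) auto
      also have "\<dots> = (21 / 10 / real (e m) ^ 2) * (25 / 64) ^ j"
      proof -
        have "(8 / 5 :: real) ^ j * (8 / 5) ^ j = (64 / 25) ^ j" by (simp flip: power_mult_distrib)
        moreover have "(25 / 64 :: real) ^ j = 1 / (64 / 25) ^ j" by (simp add: power_divide)
        ultimately show ?thesis by (simp add: power2_eq_square algebra_simps)
      qed
      finally have "?h (e (m + j)) \<le> ((21 / 10 / real (e m) ^ 2) * (25 / 64) ^ j) powr ?s"
        using x by (intro powr_mono2) (auto intro: gauss_branch_nonneg)
      also have "\<dots> = (21 / 10 / real (e m) ^ 2) powr ?s * ((25 / 64) powr ?s) ^ j"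
      proof -
        have "((25 / 64 :: real) ^ j) powr ?s = ((25 / 64) powr ?s) ^ j"
          by (simp add: powr_powr powr_power mult.commute flip: powr_realpow)
        then show ?thesis by (simp only: powr_mult)
      qed
      also have "\<dots> \<le> X * y ^ j"
        using X y assms(5) by (intro mult_mono power_mono powr_frac_le) auto
      finally show ?thesis .
    qed
    have "(\<Sum>a\<in>A'. ?h a) = (\<Sum>k\<in>F. ?h (e k))"
      unfolding F(2) using inj by (subst sum.reindex) (auto intro: inj_on_subset)
    also have "\<dots> \<le> (\<Sum>k<m + M. ?h (e k))" using M by (intro sum_mono2) auto
    also have "\<dots> = (\<Sum>k<m. ?h (e k)) + (\<Sum>j<M. ?h (e (m + j)))"
      by (induction M) (simp_all add: ac_simps)
    also have "(\<Sum>k<m. ?h (e k)) = (\<Sum>a\<leftarrow>as. ?h a)"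
      unfolding e(3) by (simp add: o_def interv_sum_list_conv_sum_set_nat atLeast0LessThan)
    also have "\<dots> \<le> real K / real D"
      using assms x by (intro table_ok_bound[of D K P Q N as 0 T]) auto
    also have "(\<Sum>j<M. ?h (e (m + j))) \<le> (\<Sum>j<M. X * y ^ j)" by (intro sum_mono tail)
    also have "\<dots> \<le> X / (1 - y)"
    proof -
      have "(\<Sum>j<M. y ^ j) \<le> (\<Sum>j. y ^ j)"
        using y by (intro sum_le_suminf summable_geometric) auto
      also have "\<dots> = 1 / (1 - y)" using y by (intro suminf_geometric) auto
      finally have "X * (\<Sum>j<M. y ^ j) \<le> X * (1 / (1 - y))" using X(1) by (rule mult_left_mono)
      then show ?thesis by (simp add: sum_distrib_left)
    qed
    finally show "(\<Sum>a\<in>A'. ?h a) \<le> real K / real D + X / (1 - y)" by simp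
  qed (use assms in auto)
qed (use assms in auto)

section \<open>Fibonacci-like digit sequences\<close>

lemma gen_fib_pos: "0 < a \<Longrightarrow> 0 < b \<Longrightarrow> 0 < gen_fib a b n"
  by (induction a b n rule: gen_fib.induct) auto

lemma gen_fib_strict_mono: "0 < a \<Longrightarrow> a < b \<Longrightarrow> strict_mono (gen_fib a b)"
proof (rule strict_mono_Suc_iff[THEN iffD2], rule allI)
  fix n assume "0 < a" "a < b"
  then show "gen_fib a b n < gen_fib a b (Suc n)"
    using gen_fib_pos[of a b] by (cases n) auto
qed

lemma gen_fib_mono: "a \<le> a' \<Longrightarrow> b \<le> b' \<Longrightarrow> gen_fib a b n \<le> gen_fib a' b' n"
  by (induction a b n rule: gen_fib.induct) (auto intro: add_mono)

lemma gen_fib_Suc: "gen_fib x1 x2 (Suc k) = gen_fib x2 (x1 + x2) k"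
  by (induction x1 x2 k rule: gen_fib.induct) auto

text \<open>Sliding the starting pair costs one addition per index, whereas the defining recursion
  branches.\<close>

lemma gen_fib_numeral: "gen_fib x1 x2 (numeral k) = gen_fib x2 (x1 + x2) (pred_numeral k)"
  by (simp add: numeral_eq_Suc gen_fib_Suc)

lemma gen_fib_1: "gen_fib x1 x2 1 = x2"
  by simp

text \<open>The recurrence preserves inequalities, so bounds for two consecutive ratios control all
  later ones: the sequence started at \<open>x1, x2\<close> is a majorant that does not depend on
  \<open>n\<close>.\<close>

lemma gen_fib_ratio:
  assumes "y * gen_fib a b (Suc n) \<le> x1 * gen_fib a b n" "y * gen_fib a b (n + 2) \<le> x2 * gen_fib a b n"
  shows "y * gen_fib a b (n + Suc k) \<le> gen_fib x1 x2 k * gen_fib a b n"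
  using assms by (induction x1 x2 k rule: gen_fib.induct) (auto simp: algebra_simps intro: add_mono)

text \<open>The inequality says that \<open>5 * f (k + 1) - 8 * f k\<close> is at least
  \<open>3 * d\<close>, and this difference obeys the same recurrence. The shift
  \<open>d = 2\<close> is that of the quotients \<open>(e + 2) / (r + 2)\<close>.\<close>

lemma gen_fib_growth_shift:
  assumes "8 * (gen_fib a b m + d) \<le> 5 * (gen_fib a b (Suc m) + d)"
    "8 * (gen_fib a b (Suc m) + d) \<le> 5 * (gen_fib a b (Suc (Suc m)) + d)" "m \<le> k"
  shows "8 * (gen_fib a b k + d) \<le> 5 * (gen_fib a b (Suc k) + d)"
proof -
  have "8 * (gen_fib a b (m + j) + d) \<le> 5 * (gen_fib a b (Suc (m + j)) + d) \<and>
      8 * (gen_fib a b (Suc (m + j)) + d) \<le> 5 * (gen_fib a b (Suc (Suc (m + j))) + d)" for j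
    using assms(1,2) by (induction j) auto
  from this[of "k - m"] show ?thesis using assms(3) by simp
qed

lemmas gen_fib_growth = gen_fib_growth_shift[where d = 0, unfolded add_0_right]

text \<open>The list entry \<open>c / D\<close> is a lower bound of \<open>(y / x1) powr (P / Q)\<close>.\<close>

fun powr_sum_ok :: "nat \<Rightarrow> nat \<Rightarrow> nat \<Rightarrow> nat \<Rightarrow> nat \<Rightarrow> nat \<Rightarrow> nat list \<Rightarrow> bool" where
  "powr_sum_ok D P Q y x1 x2 [] \<longleftrightarrow> True"
| "powr_sum_ok D P Q y x1 x2 (c # cs) \<longleftrightarrow>
     c ^ Q * x1 ^ P \<le> D ^ Q * y ^ P \<and> powr_sum_ok D P Q y x2 (x1 + x2) cs"

lemma powr_sum_ok_bound:
  assumes "powr_sum_ok D P Q y x1 x2 cs" "0 < D" "0 < Q" "0 < y" "0 < x1" "0 < x2"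
  shows "real (sum_list cs) / real D \<le> (\<Sum>k<length cs. (real y / real (gen_fib x1 x2 k)) powr (real P / real Q))"
  using assms(1,5,6)
proof (induction cs arbitrary: x1 x2)
  case (Cons c cs)
  have "real (c ^ Q * x1 ^ P) \<le> real (D ^ Q * y ^ P)"
    using Cons.prems by (simp only: of_nat_le_iff powr_sum_ok.simps)
  then have "real c ^ Q * real x1 ^ P \<le> real D ^ Q * real y ^ P" by simp
  then have "(real c / real D) ^ Q \<le> (real y / real x1) ^ P"
    using assms(2) Cons.prems(2) by (simp add: power_divide divide_le_eq le_divide_eq mult.commute)
  then have 1: "real c / real D \<le> (real y / real x1) powr (real P / real Q)"
    using assms Cons.prems by (intro powr_frac_ge) auto
  have "real (sum_list cs) / real D \<le> (\<Sum>k<length cs. (real y / real (gen_fib x1 x2 (Suc k))) powr (real P / real Q))"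
    unfolding gen_fib_Suc using Cons by auto
  then show ?case
    using 1 by (simp add: sum.lessThan_Suc_shift add_divide_distrib del: sum.lessThan_Suc)
qed auto

lemma swap_sum_ge_1:
  assumes ok: "powr_sum_ok D P Q y x1 x2 cs" "D \<le> sum_list cs"
    and pos: "0 < D" "0 < Q" "0 < y" "0 < x1" "0 < x2" "0 < a" "0 < b"
    and ratio: "y * gen_fib a b (Suc n) \<le> x1 * gen_fib a b n" "y * gen_fib a b (n + 2) \<le> x2 * gen_fib a b n"
  shows "1 \<le> (\<Sum>k=1..length cs. (real (gen_fib a b n) / real (gen_fib a b (n + k))) powr (real P / real Q))"
proof -
  have "1 \<le> real (sum_list cs) / real D" using ok(2) pos(1) by (simp add: le_divide_eq)
  also have "\<dots> \<le> (\<Sum>k<length cs. (real y / real (gen_fib x1 x2 k)) powr (real P / real Q))"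
    using ok(1) pos by (intro powr_sum_ok_bound) auto
  also have "\<dots> \<le> (\<Sum>k<length cs. (real (gen_fib a b n) / real (gen_fib a b (n + Suc k))) powr (real P / real Q))"
  proof (rule sum_mono)
    fix k
    have "real (y * gen_fib a b (n + Suc k)) \<le> real (gen_fib x1 x2 k * gen_fib a b n)"
      using gen_fib_ratio[OF ratio] by (simp only: of_nat_le_iff)
    then have "real y / real (gen_fib x1 x2 k) \<le> real (gen_fib a b n) / real (gen_fib a b (n + Suc k))"
      using pos gen_fib_pos[of a b] gen_fib_pos[of x1 x2]
      by (intro divide_le_divide_cross) (auto simp: mult.commute)
    then show "(real y / real (gen_fib x1 x2 k)) powr (real P / real Q) \<le>
        (real (gen_fib a b n) / real (gen_fib a b (n + Suc k))) powr (real P / real Q)"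
      by (intro powr_mono2) auto
  qed
  also have "\<dots> = (\<Sum>k=1..length cs. (real (gen_fib a b n) / real (gen_fib a b (n + k))) powr (real P / real Q))"
    by (rule sum.reindex_bij_witness[of _ "\<lambda>k. k - 1" Suc]) auto
  finally show ?thesis .
qed

lemma swap_threshold:
  assumes ok: "powr_sum_ok D P Q y x1 x2 cs" "D \<le> sum_list cs"
    and pos: "0 < D" "0 < Q" "0 < y" "0 < x1" "0 < x2" "0 < a" "0 < b"
    and ratio: "y * gen_fib a b (Suc n) \<le> x1 * gen_fib a b n" "y * gen_fib a b (n + 2) \<le> x2 * gen_fib a b n"
    and le: "crit_exp X \<le> \<tau>" "2 * \<tau> = real P / real Q"
  shows "\<exists>\<tau> m. crit_exp X \<le> \<tau> \<and>
    1 \<le> (\<Sum>k=1..m. (real (gen_fib a b n) / real (gen_fib a b (n + k))) powr (2 * \<tau>))"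
  using swap_sum_ge_1[OF ok pos ratio] le by metis

lemma crit_exp_image_le:
  fixes e e' :: "nat \<Rightarrow> nat"
  assumes "inj e" "inj e'" "0 \<notin> e' ` I" "\<And>k. e' k \<le> e k"
  shows "crit_exp (e ` I) \<le> crit_exp (e' ` I)"
proof (rule crit_exp_inj_le[OF assms(3), where h = "\<lambda>a. e' (inv e a)"])
  show "inj_on (\<lambda>a. e' (inv e a)) (e ` I)"
    by (rule inj_onI) (auto simp: inv_f_f[OF assms(1)] dest!: injD[OF assms(2)])
  show "(\<lambda>a. e' (inv e a)) ` e ` I \<subseteq> e' ` I" using assms(1) by auto
  show "e' (inv e a) \<le> a" if "a \<in> e ` I" for a using that assms(1,4) by auto
qed

section \<open>Full spectra\<close>

text \<open>When \<open>e n\<close> is tested, \<open>B\<close> contains only earlier digits, so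
  \<open>t\<close> lies below the dimension of the first \<open>n + 1\<close> digits. The threshold
  may thus depend on \<open>n\<close>, which rescues small digits with unfavourable ratios. The
  digit \<open>e 0\<close> alone has dimension 0 and is never rejected.\<close>

lemma full_spectrum:
  fixes e :: "nat \<Rightarrow> nat"
  assumes e: "strict_mono e" "0 < e 0"
    and thr: "\<And>n. 0 < n \<Longrightarrow> \<exists>\<tau> m. crit_exp (e ` {..n}) \<le> \<tau> \<and>
        1 \<le> (\<Sum>k=1..m. (real (e n) / real (e (n + k))) powr (2 * \<tau>))"
  shows "{0..crit_exp (range e)} = {crit_exp A | A. A \<subseteq> range e}"
proof -
  have e0: "0 \<notin> range e"
    using e by (metis imageE less_nat_zero_code strict_mono_less_eq zero_le le_zero_eq)
  have "\<exists>A. t = crit_exp A \<and> A \<subseteq> range e" if t: "0 \<le> t" "t \<le> crit_exp (range e)" for t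
  proof -
    have "t < crit_exp (B \<union> e ` {n<..})" if B: "B \<subseteq> e ` {..<n}" "t < crit_exp (insert (e n) B)" for n B
    proof (cases "n = 0")
      case True
      then show ?thesis using B t(1) crit_exp_singleton[OF e(2)] by auto
    next
      case False
      then obtain \<tau> m where \<tau>: "crit_exp (e ` {..n}) \<le> \<tau>"
        "1 \<le> (\<Sum>k=1..m. (real (e n) / real (e (n + k))) powr (2 * \<tau>))" using thr[of n] by auto
      have "crit_exp (insert (e n) B) \<le> crit_exp (e ` {..n})"
        using B(1) e0 by (intro crit_exp_mono) auto
      then have "t < \<tau>" using B(2) \<tau>(1) by linarith
      then show ?thesis using crit_exp_swap[OF e t(1) _ B \<tau>(2)] by simp
    qed
    then show ?thesis using crit_exp_attained[OF e t] by metis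
  qed
  moreover have "0 \<le> crit_exp A" "crit_exp A \<le> crit_exp (range e)" if "A \<subseteq> range e" for A
    using that e0 by (auto intro!: crit_exp_mono crit_exp_nonneg)
  ultimately show ?thesis by (auto simp: set_eq_iff)
qed

lemma crit_exp_gen_fib_1_3: "crit_exp (range (gen_fib 1 3)) \<le> 5 / 7"
proof -
  have "crit_exp (range (gen_fib 1 3)) \<le> real 5 / real 7"
  proof (rule crit_exp_le_table_tail)
    \<comment> \<open>The rows leave 0.002 for the tail from the digit 199 on, which takes
      \<open>0.0009 / 0.48\<close>, less than 0.0019. Evaluating at opposite ends of an interval
      loses something; 28 rows keep the loss within this margin.\<close>
    show "table_ok 10000 9980 5 7 28 [1, 3, 4, 7, 11, 18, 29, 47, 76, 123] 0
     [[5887, 1687, 1180, 571, 312, 159, 82, 42, 21, 11],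
     [5831, 1708, 1198, 583, 318, 162, 84, 43, 22, 11],
     [5775, 1727, 1215, 594, 325, 166, 86, 44, 22, 12],
     [5720, 1745, 1232, 604, 332, 170, 88, 45, 23, 12],
     [5667, 1762, 1248, 615, 338, 173, 90, 46, 24, 12],
     [5613, 1779, 1263, 625, 345, 177, 92, 47, 24, 12],
     [5561, 1794, 1278, 635, 351, 181, 94, 48, 25, 13],
     [5510, 1808, 1292, 645, 357, 184, 96, 49, 25, 13],
     [5459, 1822, 1305, 654, 363, 187, 97, 50, 26, 13],
     [5410, 1835, 1318, 663, 369, 191, 99, 51, 26, 13],
     [5361, 1847, 1331, 672, 375, 194, 101, 52, 27, 14],
     [5313, 1859, 1343, 681, 381, 197, 103, 53, 27, 14],
     [5266, 1869, 1354, 689, 386, 200, 105, 54, 28, 14],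
     [5219, 1880, 1365, 698, 392, 204, 106, 55, 28, 14],
     [5174, 1889, 1375, 706, 397, 207, 108, 56, 29, 15],
     [5129, 1898, 1386, 714, 402, 210, 110, 56, 29, 15],
     [5085, 1907, 1395, 721, 407, 213, 112, 57, 30, 15],
     [5042, 1915, 1405, 729, 413, 216, 113, 58, 30, 15],
     [5000, 1922, 1414, 736, 418, 219, 115, 59, 30, 16],
     [4958, 1929, 1422, 743, 422, 222, 116, 60, 31, 16],
     [4917, 1936, 1430, 750, 427, 225, 118, 61, 31, 16],
     [4877, 1942, 1438, 757, 432, 227, 120, 62, 32, 16],
     [4838, 1948, 1446, 764, 437, 230, 121, 63, 32, 17],
     [4799, 1953, 1453, 770, 441, 233, 123, 63, 33, 17],
     [4761, 1958, 1460, 777, 446, 236, 124, 64, 33, 17],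
     [4724, 1963, 1467, 783, 450, 238, 126, 65, 34, 17],
     [4687, 1968, 1473, 789, 455, 241, 127, 66, 34, 18],
     [4651, 1972, 1479, 795, 459, 244, 129, 67, 34, 18]]"
      by (simp add: entry_ok_def)
    show "[1, 3, 4, 7, 11, 18, 29, 47, 76, 123] = map (gen_fib 1 3) [0..<10]"
      by (simp add: upt_rec gen_fib_numeral)
    show "strict_mono (gen_fib 1 3)" by (rule gen_fib_strict_mono) auto
    show "8 * gen_fib 1 3 k \<le> 5 * gen_fib 1 3 (Suc k)" if "10 \<le> k" for k
      by (rule gen_fib_growth[OF _ _ that]) (simp_all add: gen_fib_numeral)
    show "(21 / 10 / real (gen_fib 1 3 10) ^ 2) ^ 5 \<le> (9 / 10000 :: real) ^ 7"
      by (simp add: gen_fib_numeral power_divide)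
    show "(25 / 64) ^ 5 \<le> (52 / 100 :: real) ^ 7" by (simp add: power_divide)
  qed auto
  then show ?thesis by simp
qed

lemma crit_exp_gen_fib_1_4: "crit_exp (range (gen_fib 1 4)) \<le> 2 / 3"
proof -
  have "crit_exp (range (gen_fib 1 4)) \<le> real 2 / real 3"
  proof (rule crit_exp_le_table_tail)
    show "table_ok 1000 971 2 3 5 [1, 4, 5, 9, 14, 23] 0
     [[610, 145, 112, 55, 32, 17],
     [581, 153, 119, 60, 35, 19],
     [554, 159, 126, 64, 38, 21],
     [529, 164, 131, 68, 40, 22],
     [507, 168, 135, 72, 43, 23]]"
      by (simp add: entry_ok_def)
    show "[1, 4, 5, 9, 14, 23] = map (gen_fib 1 4) [0..<6]"
      by (simp add: upt_rec gen_fib_numeral)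
    show "strict_mono (gen_fib 1 4)" by (rule gen_fib_strict_mono) auto
    show "8 * gen_fib 1 4 k \<le> 5 * gen_fib 1 4 (Suc k)" if "6 \<le> k" for k
      by (rule gen_fib_growth[OF _ _ that]) (simp_all add: gen_fib_numeral)
    show "(21 / 10 / real (gen_fib 1 4 6) ^ 2) ^ 2 \<le> (134 / 10000 :: real) ^ 3"
      by (simp add: gen_fib_numeral power_divide)
    show "(25 / 64) ^ 2 \<le> (535 / 1000 :: real) ^ 3" by (simp add: power_divide)
  qed auto
  then show ?thesis by simp
qed

lemma crit_exp_1_3_4: "crit_exp {1, 3, 4} \<le> 2 / 3"
proof -
  have "table_ok 1000 998 2 3 1 [1, 3, 4] 0
     [[610, 220, 168]]"
    by (simp add: entry_ok_def)
  from crit_exp_le_table[OF this] show ?thesis by simp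
qed

lemma crit_exp_1_3_4_7_11: "crit_exp {1, 3, 4, 7, 11} \<le> 7 / 10"
proof -
  have "table_ok 1000 999 7 10 10 [1, 3, 4, 7, 11] 0
     [[595, 179, 127, 63, 35],
     [580, 184, 131, 66, 37],
     [565, 188, 136, 69, 39],
     [551, 192, 139, 72, 41],
     [538, 195, 142, 74, 42],
     [525, 197, 145, 76, 44],
     [512, 200, 148, 78, 45],
     [501, 201, 150, 80, 47],
     [490, 203, 152, 82, 48],
     [479, 204, 154, 84, 49]]"
    by (simp add: entry_ok_def)
  from crit_exp_le_table[OF this] show ?thesis by simp
qed

lemma crit_exp_1_4_5: "crit_exp {1, 4, 5} \<le> 3 / 5"
proof -
  have "table_ok 1000 980 3 5 2 [1, 4, 5] 0
     [[641, 188, 151],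
     [575, 201, 165]]"
    by (simp add: entry_ok_def)
  from crit_exp_le_table[OF this] show ?thesis by simp
qed

text \<open>Ratios of consecutive digits alternate about the golden ratio. After 4 and 11 they are
  so large that the swap sum at 5/7 stays below 1, and sharper bounds for \<open>{1, 3, 4}\<close>
  and \<open>{1, 3, 4, 7, 11}\<close> step in. From 18 on the ratios are at most 13/8, which is just
  enough for 5/7.\<close>

lemma spectrum_gen_fib_1_3:
  "{0..crit_exp (range (gen_fib 1 3))} = {crit_exp A | A. A \<subseteq> range (gen_fib 1 3)}"
proof (rule full_spectrum)
  let ?f = "gen_fib 1 3"
  show "strict_mono ?f" by (rule gen_fib_strict_mono) auto
  fix n :: nat assume n: "0 < n"
  have le: "crit_exp (?f ` {..n}) \<le> 5 / 7"
    using crit_exp_gen_fib_1_3 crit_exp_mono[of "range ?f" "?f ` {..n}"] gen_fib_pos[of 1 3]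
    by (force simp: image_iff)
  consider "n = 1" | "n = 2" | "n = 3" | "n = 4" | "5 \<le> n" using n by linarith
  then show "\<exists>\<tau> m. crit_exp (?f ` {..n}) \<le> \<tau> \<and> 1 \<le> (\<Sum>k=1..m. (real (?f n) / real (?f (n + k))) powr (2 * \<tau>))"
  proof cases
    case 1
    show ?thesis
      by (rule swap_threshold[OF _ _ _ _ _ _ _ _ _ _ _ le, of 100 10 7 3 4 7 "[66, 29, 15]"])
        (simp_all add: 1 gen_fib_numeral)
  next
    case 2
    have "{..n} = {0, 1, 2}" using 2 by auto
    then have "?f ` {..n} = {1, 3, 4}" by (simp add: gen_fib_numeral)
    then have le': "crit_exp (?f ` {..n}) \<le> 2 / 3" using crit_exp_1_3_4 by simp
    show ?thesis
      by (rule swap_threshold[OF _ _ _ _ _ _ _ _ _ _ _ le', of 1000 4 3 4 7 11 "[474, 259, 134, 71, 37, 19, 10]"])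
        (simp_all add: 2 gen_fib_numeral)
  next
    case 3
    show ?thesis
      by (rule swap_threshold[OF _ _ _ _ _ _ _ _ _ _ _ le, of 100 10 7 7 11 18 "[52, 25, 13, 6, 3, 1]"])
        (simp_all add: 3 gen_fib_numeral)
  next
    case 4
    have "{..n} = {0, 1, 2, 3, 4}" using 4 by auto
    then have "?f ` {..n} = {1, 3, 4, 7, 11}" by (simp add: gen_fib_numeral)
    then have le': "crit_exp (?f ` {..n}) \<le> 7 / 10" using crit_exp_1_3_4_7_11 by simp
    show ?thesis
      by (rule swap_threshold[OF _ _ _ _ _ _ _ _ _ _ _ le', of 1000 7 5 11 18 29 "[501, 257, 130, 66, 34, 17]"])
        (simp_all add: 4 gen_fib_numeral)
  next
    case 5
    then obtain j where j: "n = Suc j" "4 \<le> j" by (cases n) auto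
    have "8 * ?f j \<le> 5 * ?f (Suc j)"
      by (rule gen_fib_growth[OF _ _ j(2)]) (simp_all add: gen_fib_numeral)
    then have ratio: "8 * ?f (Suc n) \<le> 13 * ?f n" "8 * ?f (n + 2) \<le> 21 * ?f n"
      by (simp_all add: j(1))
    show ?thesis
      by (rule swap_threshold[OF _ _ _ _ _ _ _ _ _ ratio le, of 1000 10 7 "[499, 251, 126, 63, 32, 16, 8, 4, 2]"])
        simp_all
  qed
qed simp

text \<open>A larger second digit enlarges every later one, so the dimension bounds for
  \<open>b = 4\<close> serve all \<open>b\<close>. The swap ratios have to be bounded uniformly in
  \<open>b\<close>.\<close>

lemma spectrum_gen_fib_1_ge_4:
  assumes "4 \<le> b"
  shows "{0..crit_exp (range (gen_fib 1 b))} = {crit_exp A | A. A \<subseteq> range (gen_fib 1 b)}"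
proof (rule full_spectrum)
  let ?f = "gen_fib 1 b"
  show mono: "strict_mono ?f" using assms by (intro gen_fib_strict_mono) auto
  have inj: "inj ?f" "inj (gen_fib 1 4)"
    using mono gen_fib_strict_mono[of 1 4] by (auto intro: strict_mono_imp_inj_on)
  have pos: "0 < gen_fib 1 4 k" for k by (rule gen_fib_pos) auto
  have digits: "crit_exp (?f ` I) \<le> crit_exp (gen_fib 1 4 ` I)" for I
  proof (rule crit_exp_image_le[OF inj])
    show "0 \<notin> gen_fib 1 4 ` I" using pos by (metis imageE less_irrefl)
  qed (use assms in \<open>auto intro: gen_fib_mono\<close>)
  fix n :: nat assume n: "0 < n"
  have "crit_exp (?f ` {..n}) \<le> crit_exp (gen_fib 1 4 ` {..n})" by (rule digits)
  also have "\<dots> \<le> crit_exp (range (gen_fib 1 4))" 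
    using pos by (intro crit_exp_mono) (metis imageE less_irrefl, auto)
  finally have le: "crit_exp (?f ` {..n}) \<le> 2 / 3" using crit_exp_gen_fib_1_4 by linarith
  consider "n = 1" | "n = 2" | "3 \<le> n" using n by linarith
  then show "\<exists>\<tau> m. crit_exp (?f ` {..n}) \<le> \<tau> \<and> 1 \<le> (\<Sum>k=1..m. (real (?f n) / real (?f (n + k))) powr (2 * \<tau>))"
  proof cases
    case 1
    show ?thesis
      by (rule swap_threshold[OF _ _ _ _ _ _ _ _ _ _ _ le, of 100 4 3 4 5 9 "[74, 33]"])
        (use assms in \<open>simp_all add: 1 gen_fib_numeral\<close>)
  next
    case 2
    have "{..n} = {0, 1, 2}" using 2 by auto
    then have "gen_fib 1 4 ` {..n} = {1, 4, 5}" by (simp add: gen_fib_numeral)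
    then have le': "crit_exp (?f ` {..n}) \<le> 3 / 5" using digits[of "{..n}"] crit_exp_1_4_5 by simp
    \<comment> \<open>The ratios to the next two digits increase to 2 and 3 as \<open>b\<close>
      grows, so no smaller uniform bounds exist.\<close>
    show ?thesis
      by (rule swap_threshold[OF _ _ _ _ _ _ _ _ _ _ _ le', of 1000 6 5 1 2 3 "[435, 267, 144, 82, 46, 25, 14]"])
        (use assms in \<open>simp_all add: 2 gen_fib_numeral\<close>)
  next
    case 3
    then obtain j where j: "n = Suc (Suc (Suc j))" by (metis Suc_le_D numeral_3_eq_3 Suc_le_mono)
    have "?f j \<le> ?f (Suc j)" using mono by (simp add: strict_mono_less_eq)
    \<comment> \<open>Expressed through \<open>?f (Suc j)\<close> and \<open>?f j\<close>, both
      bounds reduce to \<open>?f j \<le> ?f (Suc j)\<close>.\<close>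
    then have ratio: "3 * ?f (Suc n) \<le> 5 * ?f n" "3 * ?f (n + 2) \<le> 8 * ?f n"
      by (simp_all add: j)
    show ?thesis
      by (rule swap_threshold[OF _ _ _ _ _ _ _ _ _ ratio le, of 100 4 3 "[50, 27, 14, 7, 3]"])
        (use assms in simp_all)
  qed
qed simp

lemma zero_notin_gen_fib: "0 < a \<Longrightarrow> 0 < b \<Longrightarrow> 0 \<notin> range (gen_fib a b)"
  by (metis gen_fib_pos imageE less_irrefl)

section \<open>The gap for the digits 1, 2, 3, 5, 8, ..\<close>

text \<open>The number \<theta> = 5/8 is slightly above the inverse golden ratio, so \<theta> +
  \<theta>^2 \<ge> 1. This yields \<open>a * p + q + \<theta> * p \<le> (a + \<theta>) * (p +
  \<theta> * q)\<close> for all \<open>a \<ge> 1\<close>, so the test function has one-letter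
  weights \<open>(a + \<theta>) powr (-3/2)\<close>, which add up to more than 1.\<close>

lemma crit_exp_fib_initial_ge: "3 / 4 \<le> crit_exp {1, 2, 3, 5, 8, 13, 21}"
proof (rule crit_exp_ge)
  let ?A = "{1, 2, 3, 5, 8, 13, 21} :: nat set"
  let ?f = "\<lambda>p q :: real. (p + 5 / 8 * q) powr (- (3 / 2))"
  show "\<not> subcritical ?A (3 / 4)"
  proof (rule subcritical_finite_not_ge_1)
    fix n :: nat
    have "1 ^ n * ?f 1 0 \<le> 1 * word_sum ?A (3 / 4) n 1 0"
    proof (rule word_sum_test_ge)
      fix p q :: real assume pq: "0 < p" "0 \<le> q" "q \<le> p"
      show "?f p q \<le> 1 * p powr (-2 * (3 / 4))"
        using pq by (simp add: powr_mono2')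
      have step: "(real a + 5 / 8) powr (- (3 / 2)) * ?f p q \<le> ?f (real a * p + q) p" if "1 \<le> a" for a
      proof -
        have a: "1 \<le> real a" using that by simp
        have "q * (1 - 25 / 64) \<le> q * (5 / 8 * real a)" using a pq by (intro mult_left_mono) auto
        then have "real a * p + q + 5 / 8 * p \<le> (real a + 5 / 8) * (p + 5 / 8 * q)"
          by (simp add: algebra_simps)
        moreover have "0 < real a * p + q + 5 / 8 * p" using a pq by (simp add: add_pos_nonneg)
        ultimately have "((real a + 5 / 8) * (p + 5 / 8 * q)) powr (- (3 / 2)) \<le> (real a * p + q + 5 / 8 * p) powr (- (3 / 2))"
          by (intro powr_mono2') auto
        then show ?thesis using a pq by (simp only: powr_mult)
      qed
      have weight: "c / 10000 \<le> (real a + 5 / 8) powr (- (3 / 2))"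
        if "c\<^sup>2 * (8 * real a + 5) ^ 3 \<le> 10000\<^sup>2 * 8 ^ 3" "0 \<le> c" for a and c :: real
      proof -
        have "(c / 10000) ^ 2 \<le> (8 / (8 * real a + 5)) ^ 3"
          using that(1) by (simp add: power_divide divide_le_eq le_divide_eq mult.commute)
        then have "c / 10000 \<le> (8 / (8 * real a + 5)) powr (real 3 / real 2)"
          using that(2) by (intro powr_frac_ge) auto
        also have "8 / (8 * real a + 5) = inverse (real a + 5 / 8)" by (simp add: field_simps)
        finally show ?thesis by (simp add: powr_minus inverse_eq_divide powr_divide)
      qed
      have "1 * ?f p q \<le> (\<Sum>a\<in>?A. (real a + 5 / 8) powr (- (3 / 2))) * ?f p q"
      proof (rule mult_right_mono)
        show "1 \<le> (\<Sum>a\<in>?A. (real a + 5 / 8) powr (- (3 / 2)))"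
          using weight[of 4827 1] weight[of 2351 2] weight[of 1448 3] weight[of 749 5] weight[of 394 8]
            weight[of 198 13] weight[of 99 21] by simp
      qed simp
      also have "\<dots> \<le> (\<Sum>a\<in>?A. ?f (real a * p + q) p)"
        unfolding sum_distrib_right by (intro sum_mono step) auto
      finally show "1 * ?f p q \<le> (\<Sum>a\<in>?A. ?f (real a * p + q) p)" .
    qed auto
    then show "1 \<le> word_sum ?A (3 / 4) n 1 0" by simp
  qed auto
qed auto

lemma range_diff_eq_skip:
  fixes e :: "nat \<Rightarrow> nat"
  assumes "inj e"
  shows "range e - {e j} = range (\<lambda>k. e (if k < j then k else Suc k))"
proof
  show "range e - {e j} \<subseteq> range (\<lambda>k. e (if k < j then k else Suc k))"
  proof
    fix x assume "x \<in> range e - {e j}"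
    then obtain k where k: "x = e k" "k \<noteq> j" by auto
    show "x \<in> range (\<lambda>k. e (if k < j then k else Suc k))"
    proof (cases "k < j")
      case True
      then show ?thesis using k by (auto intro!: image_eqI[of _ _ k])
    next
      case False
      then show ?thesis using k by (auto intro!: image_eqI[of _ _ "k - 1"])
    qed
  qed
  show "range (\<lambda>k. e (if k < j then k else Suc k)) \<subseteq> range e - {e j}"
    by (auto simp: inj_eq[OF assms] split: if_splits)
qed

text \<open>Omitting a smaller digit leaves a termwise larger enumeration. Among the digits up to
  \<open>e n\<close>, omitting the last one therefore loses least.\<close>

lemma crit_exp_remove_mono:
  fixes e :: "nat \<Rightarrow> nat"
  assumes "strict_mono e" "0 < e 0" "j \<le> n"
  shows "crit_exp (range e - {e j}) \<le> crit_exp (range e - {e n})"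
proof -
  have inj: "inj e" using assms(1) by (rule strict_mono_imp_inj_on)
  have pos: "0 < e k" for k using assms(1,2) by (metis le0 less_le_trans strict_mono_less_eq)
  show ?thesis
    unfolding range_diff_eq_skip[OF inj]
  proof (rule crit_exp_image_le)
    have skip: "inj (\<lambda>k. e (if k < i then k else Suc k))" for i
      by (rule injI) (auto simp: inj_eq[OF inj] split: if_splits)
    show "inj (\<lambda>k. e (if k < j then k else Suc k))" by (rule skip)
    show "inj (\<lambda>k. e (if k < n then k else Suc k))" by (rule skip)
    show "0 \<notin> range (\<lambda>k. e (if k < n then k else Suc k))"
    proof
      assume "0 \<in> range (\<lambda>k. e (if k < n then k else Suc k))"
      then obtain k where "0 = e (if k < n then k else Suc k)" by (rule rangeE)
      then show False using pos[of "if k < n then k else Suc k"] by linarith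
    qed
    show "e (if k < n then k else Suc k) \<le> e (if k < j then k else Suc k)" for k
      using assms by (simp add: strict_mono_less_eq)
  qed
qed

text \<open>The digit with index 9 is 89, the first one where \<open>5 * f (k + 1) - 8 * f k\<close>
  reaches the 6 demanded by the shift by 2. The exponent 37/50 is chosen between the swap threshold
  near 0.7202 and the lower bound 3/4 for the dimension.\<close>

lemma fib_gap: "crit_exp (range (gen_fib 1 2) - {gen_fib 1 2 9}) < crit_exp (gen_fib 1 2 ` {..9})"
proof -
  let ?f = "gen_fib 1 2"
  have mono: "strict_mono ?f" by (rule gen_fib_strict_mono) auto
  then have inj: "inj ?f" by (rule strict_mono_imp_inj_on)
  have f0: "0 \<notin> range ?f" by (rule zero_notin_gen_fib) auto
  \<comment> \<open>\<open>y\<close> bounds the decay per digit of the traded weights;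
    \<open>y < 1 / 2\<close> is exactly what keeps the geometric series from \<open>y\<close> on
    below 1.\<close>
  define y :: real where "y = (5 / 8) powr (2 * (37 / 50))"
  have y: "0 < y" "y < 1 / 2"
  proof -
    show "0 < y" by (simp add: y_def)
    have "y = (5 / 8) powr (real 37 / real 25)" by (simp add: y_def)
    also have "\<dots> \<le> 4999 / 10000" by (rule powr_frac_le) (simp_all add: power_divide)
    finally show "y < 1 / 2" by simp
  qed
  have growth: "(8 / 5) ^ j * (real (?f 9) + 2) \<le> real (?f (9 + j)) + 2" for j
  proof -
    have "8 * (?f k + 2) \<le> 5 * (?f (Suc k) + 2)" if "9 \<le> k" for k
      by (rule gen_fib_growth_shift[OF _ _ that]) (simp_all add: gen_fib_numeral)
    then have "(8 / 5) ^ j * real (?f 9 + 2) \<le> real (?f (9 + j) + 2)"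
      by (rule growth_power[where e = "\<lambda>k. ?f k + 2"])
    then show ?thesis by (simp only: of_nat_add of_nat_numeral)
  qed
  have "crit_exp (?f ` {..<9} \<union> ?f ` {9<..}) < crit_exp (insert (?f 9) (?f ` {..<9}))"
  proof (rule crit_exp_gap)
    show "0 \<notin> ?f ` {..<9}" using f0 by blast
    show "0 < ?f 9" by (rule gen_fib_pos) auto
    show "?f 9 \<notin> ?f ` {..<9}" by (simp add: inj_image_mem_iff[OF inj] del: One_nat_def)
    show "?f ` {..<9} \<inter> ?f ` {9<..} = {}" unfolding image_Int[OF inj, symmetric] by auto
    show "?f 9 \<le> r" if "r \<in> ?f ` {9<..}" for r using that mono by (auto simp: strict_mono_less_eq)
    have "crit_exp {1, 2, 3, 5, 8, 13, 21} \<le> crit_exp (insert (?f 9) (?f ` {..<9}))"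
    proof (rule crit_exp_mono)
      show "0 \<notin> insert (?f 9) (?f ` {..<9})" using f0 by blast
      have "{1, 2, 3, 5, 8, 13, 21} = ?f ` {0, 1, 2, 3, 4, 5, 6}"
        by (simp add: gen_fib_numeral gen_fib_1 del: One_nat_def)
      also have "\<dots> \<subseteq> ?f ` {..<9}" by (rule image_mono) auto
      also have "\<dots> \<subseteq> insert (?f 9) (?f ` {..<9})" by (rule subset_insertI)
      finally show "{1, 2, 3, 5, 8, 13, 21} \<subseteq> insert (?f 9) (?f ` {..<9})" .
    qed
    then show "37 / 50 < crit_exp (insert (?f 9) (?f ` {..<9}))"
      using crit_exp_fib_initial_ge by linarith
    show "y / (1 - y) < 1" using y by (simp add: divide_less_eq)
    fix R' assume R': "R' \<subseteq> ?f ` {9<..}" "finite R'"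
    let ?h = "\<lambda>r. ((real (?f 9) + 2) / (real r + 2)) powr (2 * (37 / 50))"
    obtain I where I: "I \<subseteq> {9<..}" "finite I" "R' = ?f ` I" using R' by (meson finite_subset_image)
    obtain M where M: "I \<subseteq> {..<M}" using I(2) by (auto simp: finite_nat_iff_bounded)
    have h: "?h (?f (9 + k)) \<le> y ^ k" for k
    proof -
      have "(real (?f 9) + 2) / (real (?f (9 + k)) + 2) \<le> 1 / (8 / 5) ^ k"
      proof (rule divide_le_divide_cross)
        show "(real (?f 9) + 2) * (8 / 5) ^ k \<le> 1 * (real (?f (9 + k)) + 2)"
          using growth[of k] by (simp only: mult_1 mult.commute)
      qed (simp_all add: add_nonneg_pos)
      also have "\<dots> = (5 / 8) ^ k" by (simp add: power_divide)
      finally have "?h (?f (9 + k)) \<le> ((5 / 8) ^ k) powr (2 * (37 / 50))"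
        by (intro powr_mono2) auto
      also have "\<dots> = y ^ k"
        unfolding y_def by (simp add: powr_powr powr_power mult.commute flip: powr_realpow)
      finally show ?thesis .
    qed
    have "(\<Sum>r\<in>R'. ?h r) = (\<Sum>i\<in>I. ?h (?f i))"
      unfolding I(3) using inj by (subst sum.reindex) (auto intro: inj_on_subset)
    also have "\<dots> \<le> (\<Sum>i\<in>(\<lambda>k. 9 + Suc k) ` {..<M}. ?h (?f i))"
    proof (rule sum_mono2)
      show "I \<subseteq> (\<lambda>k. 9 + Suc k) ` {..<M}"
      proof
        fix i assume "i \<in> I"
        then have "9 < i" "i < M" using I(1) M by auto
        then show "i \<in> (\<lambda>k. 9 + Suc k) ` {..<M}" by (intro image_eqI[of _ _ "i - 10"]) auto
      qed
    qed auto
    also have "\<dots> = (\<Sum>k<M. ?h (?f (9 + Suc k)))" by (subst sum.reindex) (auto simp: inj_on_def)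
    also have "\<dots> \<le> (\<Sum>k<M. y ^ Suc k)" by (intro sum_mono h)
    also have "\<dots> = y * (\<Sum>k<M. y ^ k)" by (simp add: sum_distrib_left)
    also have "(\<Sum>k<M. y ^ k) \<le> (\<Sum>k. y ^ k)"
      using y by (intro sum_le_suminf summable_geometric) auto
    also have "\<dots> = 1 / (1 - y)" using y by (intro suminf_geometric) auto
    finally show "(\<Sum>r\<in>R'. ?h r) \<le> y / (1 - y)" using y by (simp add: mult_left_mono)
  qed simp_all
  moreover have "range ?f - {?f 9} = ?f ` {..<9} \<union> ?f ` {9<..}"
  proof -
    have "range ?f - {?f 9} = ?f ` (UNIV - {9})" using image_set_diff[OF inj, of UNIV "{9}"] by simp
    also have "UNIV - {9} = {..<9} \<union> {9::nat<..}" by auto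
    finally show ?thesis by (simp add: image_Un)
  qed
  moreover have "insert (?f 9) (?f ` {..<9}) = ?f ` {..9}"
    by (simp add: lessThan_Suc_atMost[symmetric] lessThan_Suc numeral_eq_Suc)
  ultimately show ?thesis by simp
qed

theorem theorem1p2:
  shows "(\<forall>a1 a2 :: nat. 0 < a1 \<and> a1 < a2 \<longrightarrow> a1 = 1 \<and> 3 \<le> a2 \<longrightarrow>
            {0..hausdorff_dim (cfrac_set (gen_fib_set a1 a2))} = dim_spectrum (gen_fib_set a1 a2))
       \<and> (\<exists>s. 0 < s \<and> s < hausdorff_dim (cfrac_set (gen_fib_set 1 2)) \<and>
            {0..s} \<subseteq> dim_spectrum (gen_fib_set 1 2))
       \<and> (\<exists>a b. 0 < a \<and> a < b \<and> b < hausdorff_dim (cfrac_set (gen_fib_set 1 2)) \<and>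
            {a<..<b} \<inter> dim_spectrum (gen_fib_set 1 2) = {})"
proof (intro conjI allI impI)
  fix a1 a2 :: nat
  assume "0 < a1 \<and> a1 < a2" and a: "a1 = 1 \<and> 3 \<le> a2"
  have "0 \<notin> range (gen_fib 1 a2)" using a by (intro zero_notin_gen_fib) auto
  moreover have "{0..crit_exp (range (gen_fib 1 a2))} = {crit_exp A | A. A \<subseteq> range (gen_fib 1 a2)}"
    using spectrum_gen_fib_1_3 spectrum_gen_fib_1_ge_4[of a2] a by (cases "a2 = 3") auto
  ultimately show "{0..hausdorff_dim (cfrac_set (gen_fib_set a1 a2))} = dim_spectrum (gen_fib_set a1 a2)"
    using a by (simp add: gen_fib_set_def hausdorff_dim_cfrac_set dim_spectrum_eq)
next
  let ?f = "gen_fib 1 2" and ?F = "gen_fib_set 1 2"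
  have mono: "strict_mono ?f" by (rule gen_fib_strict_mono) auto
  have f0: "0 \<notin> range ?f" by (rule zero_notin_gen_fib) auto
  have dim: "hausdorff_dim (cfrac_set ?F) = crit_exp (range ?f)"
    using f0 by (simp add: gen_fib_set_def hausdorff_dim_cfrac_set)
  have spec: "dim_spectrum ?F = {crit_exp A | A. A \<subseteq> range ?f}"
    using f0 by (simp add: gen_fib_set_def dim_spectrum_eq)
  have initial: "3 / 4 \<le> crit_exp (?f ` {..9})"
  proof -
    have "{1, 2, 3, 5, 8, 13, 21} = ?f ` {0, 1, 2, 3, 4, 5, 6}"
        by (simp add: gen_fib_numeral gen_fib_1 del: One_nat_def)
    also have "\<dots> \<subseteq> ?f ` {..9}" by (rule image_mono) auto
    finally have "crit_exp {1, 2, 3, 5, 8, 13, 21} \<le> crit_exp (?f ` {..9})"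
      using f0 by (intro crit_exp_mono) auto
    then show ?thesis using crit_exp_fib_initial_ge by linarith
  qed
  have initial_le: "crit_exp (?f ` {..9}) \<le> crit_exp (range ?f)"
    using f0 by (intro crit_exp_mono) auto
  show "\<exists>s. 0 < s \<and> s < hausdorff_dim (cfrac_set ?F) \<and> {0..s} \<subseteq> dim_spectrum ?F"
  proof (intro exI conjI subsetI)
    show "1 / 8 < hausdorff_dim (cfrac_set ?F)" using initial initial_le dim by linarith
    fix t :: real assume "t \<in> {0..1 / 8}"
    then have t: "0 \<le> t" "t \<le> 1 / 8" by auto
    have swap: "t < crit_exp (B \<union> ?f ` {n<..})"
      if B: "B \<subseteq> ?f ` {..<n}" "t < crit_exp (insert (?f n) B)" for n B
    proof -
      have "?f (Suc n) \<le> 2 * ?f n"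
      proof (cases n)
        case (Suc m)
        have "?f m < ?f (Suc m)" using mono by (rule strict_monoD) simp
        then show ?thesis by (simp add: Suc)
      qed simp
      \<comment> \<open>The next two digits are at most 2 and 4 times as large; the square roots of
        1/2 and 1/4 are at least 7/10 and 5/10. So the swap works below the exponent 1/4, and the
        bound 1/8 on \<open>t\<close> leaves room.\<close>
      then have "1 \<le> (\<Sum>k=1..length [7, 5::nat]. (real (?f n) / real (?f (n + k))) powr (real 1 / real 2))"
        by (intro swap_sum_ge_1[of 10 1 2 1 2 4 "[7, 5]"]) simp_all
      then have sum: "1 \<le> (\<Sum>k=1..length [7, 5::nat]. (real (?f n) / real (?f (n + k))) powr (2 * (1 / 4)))"
        by (simp only: of_nat_1 of_nat_numeral) simp
      show ?thesis by (rule crit_exp_swap[OF mono _ t(1) _ B sum]) (use t in simp_all)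
    qed
    have "t \<le> crit_exp (range ?f)" using t initial initial_le by linarith
    then obtain A where "A \<subseteq> range ?f" "crit_exp A = t"
      using crit_exp_attained[OF mono _ t(1)] swap by auto
    then show "t \<in> dim_spectrum ?F" unfolding spec by blast
  qed simp
  \<comment> \<open>The maximum makes \<open>a\<close> positive, and 1/2 is still below the bound
    3/4 for the initial digits.\<close>
  define a where "a = max (1 / 2) (crit_exp (range ?f - {?f 9}))"
  define b where "b = (a + crit_exp (?f ` {..9})) / 2"
  have ab: "1 / 2 \<le> a" "a < b" "b < crit_exp (?f ` {..9})"
    using initial fib_gap by (auto simp: a_def b_def max_def)
  show "\<exists>a b. 0 < a \<and> a < b \<and> b < hausdorff_dim (cfrac_set ?F) \<and> {a<..<b} \<inter> dim_spectrum ?F = {}"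
  proof (intro exI conjI)
    show "0 < a" "a < b" "b < hausdorff_dim (cfrac_set ?F)" using ab dim initial_le by auto
    have gap: "crit_exp A \<le> a \<or> b \<le> crit_exp A" if A: "A \<subseteq> range ?f" for A
    proof (cases "?f ` {..9} \<subseteq> A")
      case True
      then have "crit_exp (?f ` {..9}) \<le> crit_exp A" using A f0 by (intro crit_exp_mono) auto
      then show ?thesis using ab by linarith
    next
      case False
      then obtain j where j: "j \<le> 9" "?f j \<notin> A" by auto
      have "crit_exp A \<le> crit_exp (range ?f - {?f j})"
        using A j f0 by (intro crit_exp_mono) auto
      also have "\<dots> \<le> crit_exp (range ?f - {?f 9})"
        using mono j by (intro crit_exp_remove_mono) auto
      finally show ?thesis unfolding a_def by (simp add: le_max_iff_disj)
    qed
    show "{a<..<b} \<inter> dim_spectrum ?F = {}"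
    proof (rule equals0I)
      fix x assume "x \<in> {a<..<b} \<inter> dim_spectrum ?F"
      then obtain A where A: "A \<subseteq> range ?f" "x = crit_exp A" "a < x" "x < b"
        unfolding spec by auto
      then show False using gap[OF A(1)] by linarith
    qed
  qed
qed

end
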